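(* Let $\mathcal{L}=\{L_\alpha\}_{\alpha\in\tau}$ be a lamination by graphs over the unit disk $\mathbb{D}$, and let $T=\int_\tau[L_\alpha]\,d\mu(\alpha)$ be a uniformly laminar current in $\mathbb{D}^2$ subordinate to $\mathcal{L}$. Let $\varepsilon>0$ and $f\in L^{1+\varepsilon}_{loc}(\|T\|)$ be such that the current $fT$ is positive and closed in $\mathbb{D}^2$. Then $fT$ is uniformly laminar.
   Context: Lamination by graphs over $\mathbb{D}$: a family $\mathcal{L}$ of pairwise disjoint graphs $L_\alpha=\{(z,\varphi_\alpha(z)):z\in\mathbb{D}\}$ of holomorphic functions $\varphi_\alpha$, indexed by $\alpha\in\tau$, where $\tau\subset\mathbb{D}$ is closed, $\varphi_\alpha(0)=\alpha$, and there is $\eta>0$ with $|\varphi_\alpha(z)|\le 1-\eta$ for all $\alpha\in\tau$, $z\in\mathbb{D}$. Uniformly laminar current subordinate to $\mathcal{L}$: a (positive closed, of locally finite mass) current in $\mathbb{D}^2$ of the form $T=\int_\tau[L_\alpha]\,d\mu(\alpha)$, where $[L_\alpha]$ is the current of integration on $L_\alpha$ and $\mu$ is a finite positive measure on $\tau$. A current in $\mathbb{D}^2$ is uniformly laminar if it is uniformly laminar subordinate to some lamination by graphs over $\mathbb{D}$. $\|T\|$ denotes the trace measure of $T$. *)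

theory Defs
  imports "HOL-Analysis.Analysis"
begin

type_synonym C2 = "complex \<times> complex"

text \<open>Differential forms on \<open>\<complex>\<^sup>2\<close> have complex coefficients: a 1-form (2-form) assigns to a point a
  real-linear (alternating real-bilinear) complex-valued map on tangent vectors.\<close>

type_synonym form1 = "C2 \<Rightarrow> C2 \<Rightarrow> complex"
type_synonym form2 = "C2 \<Rightarrow> C2 \<Rightarrow> C2 \<Rightarrow> complex"

text \<open>Currents of dimension 2 are functionals on 2-forms of which only the values on test forms
  matter. Linearity and continuity are not recorded separately: every functional to which the
  predicates below are applied is given by integration.\<close>

type_synonym current2 = "form2 \<Rightarrow> complex"

abbreviation unit_disk :: "complex set" where
  "unit_disk \<equiv> ball 0 1"

abbreviation bidisk :: "C2 set" where
  "bidisk \<equiv> unit_disk \<times> unit_disk"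


subsection \<open>Test functions and test forms\<close>

primrec Ck :: "nat \<Rightarrow> ('a::euclidean_space \<Rightarrow> 'b::real_normed_vector) \<Rightarrow> bool" where
  "Ck 0 g \<longleftrightarrow> continuous_on UNIV g"
| "Ck (Suc n) g \<longleftrightarrow> (\<forall>x. g differentiable (at x)) \<and>
     (\<forall>v. Ck n (\<lambda>x. frechet_derivative g (at x) v))"

definition smooth :: "('a::euclidean_space \<Rightarrow> 'b::real_normed_vector) \<Rightarrow> bool" where
  "smooth g \<longleftrightarrow> (\<forall>n. Ck n g)"

definition test_function :: "(C2 \<Rightarrow> complex) \<Rightarrow> bool" where
  "test_function h \<longleftrightarrow> smooth h \<and> (\<exists>K. compact K \<and> K \<subseteq> bidisk \<and> (\<forall>p. p \<notin> K \<longrightarrow> h p = 0))"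

definition test_form1 :: "form1 \<Rightarrow> bool" where
  "test_form1 \<theta> \<longleftrightarrow> (\<forall>p. linear (\<theta> p)) \<and> (\<forall>u. smooth (\<lambda>p. \<theta> p u)) \<and>
     (\<exists>K. compact K \<and> K \<subseteq> bidisk \<and> (\<forall>p u. p \<notin> K \<longrightarrow> \<theta> p u = 0))"

definition test_form2 :: "form2 \<Rightarrow> bool" where
  "test_form2 \<psi> \<longleftrightarrow> (\<forall>p. bilinear (\<psi> p) \<and> (\<forall>u. \<psi> p u u = 0)) \<and>
     (\<forall>u v. smooth (\<lambda>p. \<psi> p u v)) \<and>
     (\<exists>K. compact K \<and> K \<subseteq> bidisk \<and> (\<forall>p u v. p \<notin> K \<longrightarrow> \<psi> p u v = 0))"

definition ext_deriv :: "form1 \<Rightarrow> form2" where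
  "ext_deriv \<theta> = (\<lambda>p u v. frechet_derivative (\<lambda>q. \<theta> q v) (at p) u
                        - frechet_derivative (\<lambda>q. \<theta> q u) (at p) v)"

definition cscale :: "complex \<Rightarrow> C2 \<Rightarrow> C2" where
  "cscale c u = (c * fst u, c * snd u)"

text \<open>For \<open>r + s = 2\<close>, a 2-form has bidegree \<open>(r, s)\<close> iff it has weight \<open>(r, s)\<close> under complex
  scaling of tangent vectors.\<close>

definition bidegree :: "nat \<Rightarrow> nat \<Rightarrow> form2 \<Rightarrow> bool" where
  "bidegree r s \<psi> \<longleftrightarrow>
     (\<forall>p c u v. \<psi> p (cscale c u) (cscale c v) = c ^ r * cnj c ^ s * \<psi> p u v)"

text \<open>A (1,1)-form is positive iff it is nonnegative on every complex line; \<open>v, \<i>v\<close> is an oriented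
  real basis of the line spanned by \<open>v\<close>.\<close>

definition positive_form :: "form2 \<Rightarrow> bool" where
  "positive_form \<psi> \<longleftrightarrow> bidegree 1 1 \<psi> \<and> (\<forall>p v. \<psi> p v (cscale \<i> v) \<in> \<real>\<^sub>\<ge>\<^sub>0)"


subsection \<open>Positive and closed currents, trace measure\<close>

text \<open>Vanishing on forms of bidegree (2,0) and (0,2) says that the current has
  bidimension (1,1).\<close>

definition positive_current :: "current2 \<Rightarrow> bool" where
  "positive_current T \<longleftrightarrow>
     (\<forall>\<psi>. test_form2 \<psi> \<and> (bidegree 2 0 \<psi> \<or> bidegree 0 2 \<psi>) \<longrightarrow> T \<psi> = 0) \<and>
     (\<forall>\<psi>. test_form2 \<psi> \<and> positive_form \<psi> \<longrightarrow> T \<psi> \<in> \<real>\<^sub>\<ge>\<^sub>0)"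

definition closed_current :: "current2 \<Rightarrow> bool" where
  "closed_current T \<longleftrightarrow> (\<forall>\<theta>. test_form1 \<theta> \<longrightarrow> T (ext_deriv \<theta>) = 0)"

text \<open>The standard Kaehler form \<open>(\<i>/2) (dz \<and> d\<bar>z + dw \<and> d\<bar>w)\<close>, since
  \<open>(\<i>/2) dz \<and> d\<bar>z = dx \<and> dy\<close> maps \<open>(u, v)\<close> to \<open>Im (cnj u * v)\<close>.\<close>

definition kaehler_form :: "C2 \<Rightarrow> C2 \<Rightarrow> real" where
  "kaehler_form u v = Im (cnj (fst u) * fst v) + Im (cnj (snd u) * snd v)"

text \<open>The Radon measure \<open>T \<and> \<beta>\<close> on the bidisk, for \<open>\<beta>\<close> the Kaehler form; it exists and is unique
  for positive \<open>T\<close>.\<close>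

definition trace_measure :: "current2 \<Rightarrow> C2 measure" where
  "trace_measure T = (THE \<sigma>. sets \<sigma> = sets (restrict_space borel bidisk) \<and>
     (\<forall>K. compact K \<and> K \<subseteq> bidisk \<longrightarrow> emeasure \<sigma> K < \<infinity>) \<and>
     (\<forall>h. test_function h \<longrightarrow>
        (\<integral>p. h p \<partial>\<sigma>) = T (\<lambda>p u v. h p * of_real (kaehler_form u v))))"

definition Lp_loc :: "real \<Rightarrow> C2 measure \<Rightarrow> (C2 \<Rightarrow> complex) \<Rightarrow> bool" where
  "Lp_loc r \<sigma> f \<longleftrightarrow> f \<in> borel_measurable \<sigma> \<and>
     (\<forall>K. compact K \<and> K \<subseteq> bidisk \<longrightarrow> set_integrable \<sigma> K (\<lambda>p. norm (f p) powr r))"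


subsection \<open>Multiplication of a current by a function\<close>

text \<open>A positive current has measure coefficients, dominated by its trace measure \<open>\<sigma>\<close>. So
  \<open>T = t \<sigma>\<close> for a bounded measurable field \<open>t\<close> of 2-vectors, given by its coefficients on the
  real basis of \<open>\<complex>\<^sup>2\<close>, and \<open>f T = (f t) \<sigma>\<close>. The pairing of \<open>t\<close> with 2-forms is unique up to
  \<open>\<sigma>\<close>-null sets, so \<open>f T\<close> does not depend on the choice of \<open>t\<close>.\<close>

definition vec_pairing :: "(C2 \<Rightarrow> C2 \<Rightarrow> complex) \<Rightarrow> (C2 \<Rightarrow> C2 \<Rightarrow> complex) \<Rightarrow> complex" where
  "vec_pairing t \<omega> = (\<Sum>a\<in>Basis. \<Sum>b\<in>Basis. t a b * \<omega> a b)"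

definition vec_density :: "current2 \<Rightarrow> (C2 \<Rightarrow> C2 \<Rightarrow> C2 \<Rightarrow> complex) \<Rightarrow> bool" where
  "vec_density T t \<longleftrightarrow>
     (\<forall>a\<in>Basis. \<forall>b\<in>Basis. (\<lambda>p. t p a b) \<in> borel_measurable (trace_measure T)) \<and>
     (\<exists>C. \<forall>p. \<forall>a\<in>Basis. \<forall>b\<in>Basis. norm (t p a b) \<le> C) \<and>
     (\<forall>\<psi>. test_form2 \<psi> \<longrightarrow> T \<psi> = (\<integral>p. vec_pairing (t p) (\<psi> p) \<partial>trace_measure T))"

definition mult_current :: "(C2 \<Rightarrow> complex) \<Rightarrow> current2 \<Rightarrow> current2" where
  "mult_current f T = (\<lambda>\<psi>. \<integral>p. f p * vec_pairing ((SOME t. vec_density T t) p) (\<psi> p)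
                             \<partial>trace_measure T)"


subsection \<open>Laminations by graphs and uniformly laminar currents\<close>

definition graph :: "(complex \<Rightarrow> complex) \<Rightarrow> C2 set" where
  "graph g = (\<lambda>z. (z, g z)) ` unit_disk"

definition lamination :: "complex set \<Rightarrow> (complex \<Rightarrow> complex \<Rightarrow> complex) \<Rightarrow> bool" where
  "lamination \<tau> \<phi> \<longleftrightarrow>
     closedin (top_of_set unit_disk) \<tau> \<and>
     (\<forall>\<alpha>\<in>\<tau>. \<phi> \<alpha> holomorphic_on unit_disk \<and> \<phi> \<alpha> 0 = \<alpha>) \<and>
     disjoint_family_on (\<lambda>\<alpha>. graph (\<phi> \<alpha>)) \<tau> \<and>
     (\<exists>\<eta>>0. \<forall>\<alpha>\<in>\<tau>. \<forall>z\<in>unit_disk. norm (\<phi> \<alpha> z) \<le> 1 - \<eta>)"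

text \<open>The integral of a 2-form over the graph of \<open>g\<close>: its pullback under \<open>z \<mapsto> (z, g z)\<close>, whose
  differential maps the real basis \<open>1, \<i>\<close> to \<open>(1, g' z)\<close> and \<open>(\<i>, \<i> g' z)\<close>.\<close>

definition integration_current :: "(complex \<Rightarrow> complex) \<Rightarrow> current2" where
  "integration_current g = (\<lambda>\<psi>. LINT z:unit_disk|lborel.
     \<psi> (z, g z) (1, deriv g z) (\<i>, \<i> * deriv g z))"

definition finite_measure_on :: "complex set \<Rightarrow> complex measure \<Rightarrow> bool" where
  "finite_measure_on \<tau> \<mu> \<longleftrightarrow> finite_measure \<mu> \<and> sets \<mu> = sets (restrict_space borel \<tau>)"

definition laminar_current ::
    "(complex \<Rightarrow> complex \<Rightarrow> complex) \<Rightarrow> complex measure \<Rightarrow> current2" where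
  "laminar_current \<phi> \<mu> = (\<lambda>\<psi>. \<integral>\<alpha>. integration_current (\<phi> \<alpha>) \<psi> \<partial>\<mu>)"

definition uniformly_laminar :: "current2 \<Rightarrow> bool" where
  "uniformly_laminar T \<longleftrightarrow> (\<exists>\<tau> \<phi> \<mu>. lamination \<tau> \<phi> \<and> finite_measure_on \<tau> \<mu> \<and>
     (\<forall>\<psi>. test_form2 \<psi> \<longrightarrow> T \<psi> = laminar_current \<phi> \<mu> \<psi>))"

end

theory Submission
  imports Defs "HOL-Complex_Analysis.Complex_Analysis" "HOL-Real_Asymp.Real_Asymp"
begin

text \<open>On the product of the disk and the transversal, \<open>T\<close> becomes a product measure and \<open>f T\<close> integrates
  forms against \<open>F (z, \<alpha>) = f (z, \<phi>\<^sub>\<alpha> z)\<close>. It suffices that \<open>F\<close> depends only on \<open>\<alpha>\<close>: then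
  \<open>f T\<close> is laminar for \<open>F \<mu>\<close>, and positivity of \<open>f T\<close> makes \<open>F\<close> nonnegative. Closedness, tested against
  1-forms \<open>\<rho>(z) G(z, w) \<eta>\<close> with \<open>G\<close> almost constant on leaves and close to the indicator of a compact set
  \<open>E\<close> of leaves, gives \<open>\<integral> F \<partial>\<^sub>v\<rho> 1\<^sub>E = 0\<close> in the limit, whence the claim by du Bois-Reymond. Such \<open>G\<close> exist
  although the holonomy is only Hoelder continuous: \<open>- ln (\<bar>\<phi>\<^sub>\<alpha> - \<phi>\<^sub>\<beta>\<bar> / 2)\<close> is a positive harmonic function, so
  by Harnack its logarithm is Lipschitz on leaves, uniformly in \<open>\<beta>\<close>, while it is unbounded near the leaf
  of \<open>\<beta>\<close>.\<close>

section \<open>Calculus of smooth functions\<close>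

text \<open>The density is only measurable and locally integrable, so no derivative can fall on it;
  test forms must be smooth on C^2, while the natural leafwise test functions
  \<open>\<rho>(z) * indicator E\<close> jump across leaves. Hence two demands on \<open>G\<close>:
  pointwise convergence to the indicator, for the main term, and leafwise derivatives that are
  bounded and tend to 0, so that dominated convergence removes the error term. Harnack's constants
  blow up at the boundary of the disk, so everything happens over \<open>norm z \<le> r\<close> with
  \<open>r < 1\<close>. Du Bois-Reymond is carried out with rectangles: sliding one in a coordinate
  direction shows that the mass of \<open>R \<times> E\<close> is the area of \<open>R\<close> times
  a constant depending on \<open>E\<close> alone, and such products generate the sigma-algebra. The
  mean over one fixed square then serves as the leafwise constant. A separate difficulty lies in the
  definitions: the trace measure is given by \<open>THE\<close> and the density of 2-vectors by
  \<open>SOME\<close>, so both must be identified, the first by uniqueness of Radon measures, the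
  second only up to its symmetric part.\<close>

primrec Ck_on :: "nat \<Rightarrow> 'a set \<Rightarrow> ('a::euclidean_space \<Rightarrow> 'b::real_normed_vector) \<Rightarrow> bool" where
  "Ck_on 0 S g \<longleftrightarrow> continuous_on S g"
| "Ck_on (Suc n) S g \<longleftrightarrow> (\<forall>x\<in>S. g differentiable (at x)) \<and>
     (\<forall>v. Ck_on n S (\<lambda>x. frechet_derivative g (at x) v))"

text \<open>Smoothness relative to a set, because a leaf function \<open>\<phi> a\<close> is
  controlled on the disk only. Derivatives are taken at points, not within \<open>S\<close>, so most
  rules below assume \<open>S\<close> open.\<close>

definition smooth_on :: "'a set \<Rightarrow> ('a::euclidean_space \<Rightarrow> 'b::real_normed_vector) \<Rightarrow> bool" where
  "smooth_on S g \<longleftrightarrow> (\<forall>n. Ck_on n S g)"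

lemma Ck_iff_Ck_on: "Ck n g \<longleftrightarrow> Ck_on n UNIV g"
  by (induction n arbitrary: g) auto

lemma smooth_iff_smooth_on: "smooth g \<longleftrightarrow> smooth_on UNIV g"
  by (simp add: smooth_def smooth_on_def Ck_iff_Ck_on)

lemma frechet_derivative_eqI:
  "(f has_derivative f') (at x) \<Longrightarrow> frechet_derivative f (at x) = f'"
  by (rule frechet_derivative_at[symmetric])

lemma Ck_on_cong:
  assumes "open S" "\<And>x. x \<in> S \<Longrightarrow> f x = g x"
  shows "Ck_on n S f \<longleftrightarrow> Ck_on n S g"
  using assms(2)
proof (induction n arbitrary: f g)
  case 0
  then show ?case by (auto intro: continuous_on_cong)
next
  case (Suc n)
  have "(f has_derivative D) (at x) \<longleftrightarrow> (g has_derivative D) (at x)" if "x \<in> S" for x D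
    using has_derivative_transform_within_open[OF _ assms(1) that] Suc.prems by metis
  then have "f differentiable (at x) \<longleftrightarrow> g differentiable (at x)"
    and "frechet_derivative f (at x) = frechet_derivative g (at x)" if "x \<in> S" for x
    using that by (auto simp: differentiable_def frechet_derivative_def)
  then show ?case using Suc.IH[of "\<lambda>x. frechet_derivative f (at x) v" "\<lambda>x. frechet_derivative g (at x) v" for v]
    by simp
qed

lemma Ck_on_subset: "Ck_on n S f \<Longrightarrow> T \<subseteq> S \<Longrightarrow> Ck_on n T f"
  by (induction n arbitrary: f) (auto intro: continuous_on_subset)

lemma Ck_on_Un:
  assumes "open S" "open T" "Ck_on n S f" "Ck_on n T f"
  shows "Ck_on n (S \<union> T) f"
  using assms(3,4) by (induction n arbitrary: f) (auto intro: continuous_on_open_Un assms)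

text \<open>\<open>frechet_derivative\<close> is a choice term; with this rule it suffices to
  exhibit a derivative \<open>g'\<close> and to treat the functions \<open>g' x v\<close>
  inductively.\<close>

lemma Ck_on_SucI:
  assumes "open S" "\<And>x. x \<in> S \<Longrightarrow> (g has_derivative g' x) (at x)" "\<And>v. Ck_on n S (\<lambda>x. g' x v)"
  shows "Ck_on (Suc n) S g"
proof -
  have "Ck_on n S (\<lambda>x. frechet_derivative g (at x) v)" for v
    using assms(3)[of v] Ck_on_cong[OF assms(1), of "\<lambda>x. g' x v" "\<lambda>x. frechet_derivative g (at x) v" n]
      frechet_derivative_eqI[OF assms(2)] by simp
  then show ?thesis
    using assms(2) by (auto simp: differentiable_def)
qed

lemma Ck_on_SucD: "Ck_on (Suc n) S f \<Longrightarrow> Ck_on n S f"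
proof (induction n arbitrary: f)
  case 0
  then show ?case
    by (auto intro!: differentiable_imp_continuous_on simp: differentiable_on_def differentiable_at_withinI)
next
  case (Suc n)
  then show ?case by (metis Ck_on.simps(2))
qed

lemma Ck_on_has_derivative:
  "Ck_on (Suc n) S f \<Longrightarrow> x \<in> S \<Longrightarrow> (f has_derivative frechet_derivative f (at x)) (at x)"
  by (simp add: frechet_derivative_works)

lemma Ck_on_const: "Ck_on n S (\<lambda>x. c)"
proof (induction n arbitrary: c)
  case (Suc n)
  have "frechet_derivative (\<lambda>x. c) (at x) = (\<lambda>v. 0)" for x :: 'a and c :: 'b
    by (rule frechet_derivative_eqI) simp
  then show ?case using Suc by simp
qed simp

lemma Ck_on_bounded_linear:
  assumes "bounded_linear f" "open S"
  shows "Ck_on n S f"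
proof (cases n)
  case 0
  then show ?thesis using assms by (simp add: linear_continuous_on)
next
  case (Suc m)
  show ?thesis unfolding Suc
    by (rule Ck_on_SucI[where g' = "\<lambda>x. f"])
       (use assms in \<open>auto intro: bounded_linear_imp_has_derivative Ck_on_const\<close>)
qed

lemma Ck_on_add:
  assumes "open S"
  shows "Ck_on n S f \<Longrightarrow> Ck_on n S g \<Longrightarrow> Ck_on n S (\<lambda>x. f x + g x)"
proof (induction n arbitrary: f g)
  case 0
  then show ?case by (auto intro: continuous_intros)
next
  case (Suc n)
  show ?case
    by (rule Ck_on_SucI[where g' = "\<lambda>x v. frechet_derivative f (at x) v + frechet_derivative g (at x) v"])
       (use Suc assms in \<open>auto intro!: derivative_intros simp: frechet_derivative_works[symmetric]\<close>)
qed

lemma (in bounded_bilinear) Ck_on_prod: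
  fixes f :: "'d::euclidean_space \<Rightarrow> 'a" and g :: "'d \<Rightarrow> 'b"
  assumes "open S"
  shows "Ck_on n S f \<Longrightarrow> Ck_on n S g \<Longrightarrow> Ck_on n S (\<lambda>x. prod (f x) (g x))"
proof (induction n arbitrary: f g)
  case 0
  then show ?case by (auto intro: continuous_on)
next
  case (Suc n)
  note fg = Ck_on_SucD[OF Suc.prems(1)] Ck_on_SucD[OF Suc.prems(2)]
  show ?case
    by (rule Ck_on_SucI[where g' = "\<lambda>x v. prod (f x) (frechet_derivative g (at x) v) + prod (frechet_derivative f (at x) v) (g x)"])
       (use Suc fg assms in \<open>auto intro!: FDERIV Ck_on_add simp: frechet_derivative_works[symmetric]\<close>)
qed

lemmas Ck_on_scaleR = bounded_bilinear.Ck_on_prod[OF bounded_bilinear_scaleR]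
lemmas Ck_on_mult = bounded_bilinear.Ck_on_prod[OF bounded_bilinear_mult]
lemmas Ck_on_inner = bounded_bilinear.Ck_on_prod[OF bounded_bilinear_inner]

lemma Ck_on_sum:
  assumes "open S" "\<And>i. i \<in> I \<Longrightarrow> Ck_on n S (f i)"
  shows "Ck_on n S (\<lambda>x. \<Sum>i\<in>I. f i x)"
  using assms(2) by (induction I rule: infinite_finite_induct) (auto intro: Ck_on_const Ck_on_add assms(1))

lemma Ck_on_prod:
  fixes f :: "'i \<Rightarrow> 'a::euclidean_space \<Rightarrow> 'b::{real_normed_algebra,comm_ring_1}"
  assumes "open S" "\<And>i. i \<in> I \<Longrightarrow> Ck_on n S (f i)"
  shows "Ck_on n S (\<lambda>x. \<Prod>i\<in>I. f i x)"
  using assms(2) by (induction I rule: infinite_finite_induct) (auto intro: Ck_on_const Ck_on_mult assms(1))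

text \<open>The chain rule gives \<open>g' (f x) (f' x v)\<close>, whose direction varies with
  \<open>x\<close>, whereas \<open>Ck_on\<close> differentiates in fixed directions. Expanding the
  inner vector in the basis leaves products of coordinates of \<open>f'\<close> with
  \<open>g'\<close> in basis directions, to which the induction hypothesis applies.\<close>

lemma Ck_on_compose:
  fixes f :: "'a::euclidean_space \<Rightarrow> 'b::euclidean_space" and g :: "'b \<Rightarrow> 'c::real_normed_vector"
  assumes "open S" "open T" "f ` S \<subseteq> T"
  shows "Ck_on n S f \<Longrightarrow> Ck_on n T g \<Longrightarrow> Ck_on n S (\<lambda>x. g (f x))"
proof (induction n arbitrary: g)
  case 0
  then show ?case using continuous_on_compose2[OF _ _ assms(3)] by simp
next
  case (Suc n)
  let ?F = "\<lambda>x. frechet_derivative f (at x)" and ?G = "\<lambda>y. frechet_derivative g (at y)"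
  have f: "Ck_on n S f" by (rule Ck_on_SucD) fact
  show ?case
  proof (rule Ck_on_SucI[where g' = "\<lambda>x v. \<Sum>b\<in>Basis. (?F x v \<bullet> b) *\<^sub>R ?G (f x) b", OF assms(1)])
    fix x assume x: "x \<in> S"
    have "(f has_derivative ?F x) (at x)" "(g has_derivative ?G (f x)) (at (f x))"
      by (rule Ck_on_has_derivative[OF Suc.prems(1) x], rule Ck_on_has_derivative[OF Suc.prems(2)])
         (use x assms(3) in blast)
    from diff_chain_at[OF this] have *: "((\<lambda>x. g (f x)) has_derivative (\<lambda>v. ?G (f x) (?F x v))) (at x)"
      by (simp only: o_def)
    have lin: "linear (?G (f x))"
      using \<open>(g has_derivative ?G (f x)) (at (f x))\<close> by (rule has_derivative_linear)
    have "?G (f x) w = (\<Sum>b\<in>Basis. (w \<bullet> b) *\<^sub>R ?G (f x) b)" for w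
    proof -
      have "?G (f x) w = ?G (f x) (\<Sum>b\<in>Basis. (w \<bullet> b) *\<^sub>R b)"
        by (simp only: euclidean_representation)
      also have "\<dots> = (\<Sum>b\<in>Basis. ?G (f x) ((w \<bullet> b) *\<^sub>R b))"
        by (rule linear_sum[OF lin])
      also have "\<dots> = (\<Sum>b\<in>Basis. (w \<bullet> b) *\<^sub>R ?G (f x) b)"
        by (rule sum.cong[OF refl], rule linear_cmul[OF lin])
      finally show ?thesis .
    qed
    then have "(\<lambda>v. ?G (f x) (?F x v)) = (\<lambda>v. \<Sum>b\<in>Basis. (?F x v \<bullet> b) *\<^sub>R ?G (f x) b)"
      by (rule ext)
    with * show "((\<lambda>x. g (f x)) has_derivative (\<lambda>v. \<Sum>b\<in>Basis. (?F x v \<bullet> b) *\<^sub>R ?G (f x) b)) (at x)"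
      by (rule has_derivative_eq_rhs)
  next
    fix v
    have "Ck_on n S (\<lambda>x. ?F x v \<bullet> b)" for b
      using Suc.prems(1) by (auto intro!: Ck_on_inner assms(1) Ck_on_const)
    moreover have "Ck_on n S (\<lambda>x. ?G (f x) b)" for b
      using Suc.prems(2) by (intro Suc.IH f) auto
    ultimately show "Ck_on n S (\<lambda>x. \<Sum>b\<in>Basis. (?F x v \<bullet> b) *\<^sub>R ?G (f x) b)"
      by (intro Ck_on_sum Ck_on_scaleR assms(1))
  qed
qed

lemma Ck_on_real_SucI:
  fixes g :: "real \<Rightarrow> real"
  assumes "open S" "\<And>x. x \<in> S \<Longrightarrow> (g has_real_derivative g' x) (at x)" "Ck_on n S g'"
  shows "Ck_on (Suc n) S g"
  by (rule Ck_on_SucI[where g' = "\<lambda>x v. g' x * v"])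
     (use assms in \<open>auto intro: Ck_on_mult Ck_on_const simp: has_field_derivative_def\<close>)

lemma Ck_on_exp: "Ck_on n UNIV (exp :: real \<Rightarrow> real)"
  by (induction n) (auto intro!: continuous_intros Ck_on_real_SucI[where g' = exp] simp del: Ck_on.simps(2))

lemma Ck_on_inverse: "Ck_on n {0<..} (inverse :: real \<Rightarrow> real)"
proof (induction n)
  case 0
  then show ?case by (auto intro!: continuous_intros)
next
  case (Suc n)
  show ?case
  proof (rule Ck_on_real_SucI)
    show "(inverse has_real_derivative (-1) * (inverse x * inverse x)) (at x)" if "x \<in> {0<..}" for x :: real
      using that by (auto intro!: derivative_eq_intros)
    show "Ck_on n {0<..} (\<lambda>x::real. (-1) * (inverse x * inverse x))"
      by (intro Ck_on_mult Ck_on_const Suc open_greaterThan)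
  qed simp
qed

lemma Ck_on_ln: "Ck_on n {0<..} (ln :: real \<Rightarrow> real)"
proof (cases n)
  case 0
  then show ?thesis by (auto intro!: continuous_intros)
next
  case (Suc m)
  show ?thesis unfolding Suc
    by (rule Ck_on_real_SucI[where g' = inverse])
       (auto intro!: derivative_eq_intros Ck_on_inverse simp: divide_simps)
qed

text \<open>The real derivative is multiplication by \<open>deriv f\<close>, which is again
  holomorphic, so the induction stays within holomorphic functions.\<close>

lemma Ck_on_holomorphic:
  assumes "open S"
  shows "f holomorphic_on S \<Longrightarrow> Ck_on n S f"
proof (induction n arbitrary: f)
  case 0
  then show ?case by (simp add: holomorphic_on_imp_continuous_on)
next
  case (Suc n)
  show ?case
    by (rule Ck_on_SucI[where g' = "\<lambda>x v. deriv f x * v"])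
       (use Suc assms in \<open>auto intro!: Ck_on_mult Ck_on_const holomorphic_deriv
          simp: has_field_derivative_def[symmetric] intro: holomorphic_derivI\<close>)
qed

lemma smooth_on_const: "smooth_on S (\<lambda>x. c)"
  by (simp add: smooth_on_def Ck_on_const)

lemma smooth_on_subset: "smooth_on S f \<Longrightarrow> T \<subseteq> S \<Longrightarrow> smooth_on T f"
  by (auto simp: smooth_on_def intro: Ck_on_subset)

lemma smooth_on_imp_continuous_on: "smooth_on S f \<Longrightarrow> continuous_on S f"
  by (metis smooth_on_def Ck_on.simps(1))

lemma smooth_on_has_derivative:
  "smooth_on S f \<Longrightarrow> x \<in> S \<Longrightarrow> (f has_derivative frechet_derivative f (at x)) (at x)"
  unfolding smooth_on_def using Ck_on_has_derivative by blast

lemma smooth_on_frechet_derivative: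
  "smooth_on S f \<Longrightarrow> smooth_on S (\<lambda>x. frechet_derivative f (at x) v)"
  unfolding smooth_on_def by (metis Ck_on.simps(2))

lemma smooth_on_bounded_linear: "bounded_linear f \<Longrightarrow> open S \<Longrightarrow> smooth_on S f"
  by (simp add: smooth_on_def Ck_on_bounded_linear)

lemma smooth_on_add: "open S \<Longrightarrow> smooth_on S f \<Longrightarrow> smooth_on S g \<Longrightarrow> smooth_on S (\<lambda>x. f x + g x)"
  by (simp add: smooth_on_def Ck_on_add)

lemma smooth_on_mult:
  fixes f g :: "'a::euclidean_space \<Rightarrow> 'b::real_normed_algebra"
  shows "open S \<Longrightarrow> smooth_on S f \<Longrightarrow> smooth_on S g \<Longrightarrow> smooth_on S (\<lambda>x. f x * g x)"
  by (simp add: smooth_on_def Ck_on_mult)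

lemma smooth_on_inner: "open S \<Longrightarrow> smooth_on S f \<Longrightarrow> smooth_on S g \<Longrightarrow> smooth_on S (\<lambda>x. f x \<bullet> g x)"
  by (simp add: smooth_on_def Ck_on_inner)

lemma smooth_on_sum: "open S \<Longrightarrow> (\<And>i. i \<in> I \<Longrightarrow> smooth_on S (f i)) \<Longrightarrow> smooth_on S (\<lambda>x. \<Sum>i\<in>I. f i x)"
  by (simp add: smooth_on_def Ck_on_sum)

lemma smooth_on_prod:
  fixes f :: "'i \<Rightarrow> 'a::euclidean_space \<Rightarrow> 'b::{real_normed_algebra,comm_ring_1}"
  shows "open S \<Longrightarrow> (\<And>i. i \<in> I \<Longrightarrow> smooth_on S (f i)) \<Longrightarrow> smooth_on S (\<lambda>x. \<Prod>i\<in>I. f i x)"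
  by (simp add: smooth_on_def Ck_on_prod)

lemma smooth_on_power:
  fixes f :: "'a::euclidean_space \<Rightarrow> 'b::{real_normed_algebra,comm_ring_1}"
  assumes "open S" "smooth_on S f"
  shows "smooth_on S (\<lambda>x. f x ^ k)"
  using smooth_on_prod[OF assms(1), of "{..<k}" "\<lambda>_. f"] assms(2) by simp

lemma smooth_on_minus:
  assumes "open S" "smooth_on S f"
  shows "smooth_on S (\<lambda>x. - f x)"
proof -
  have "Ck_on n S (\<lambda>x. (-1) *\<^sub>R f x)" for n
    by (rule Ck_on_scaleR) (use assms in \<open>auto simp: smooth_on_def intro: Ck_on_const\<close>)
  then show ?thesis by (simp add: smooth_on_def)
qed

lemma smooth_on_diff: "open S \<Longrightarrow> smooth_on S f \<Longrightarrow> smooth_on S g \<Longrightarrow> smooth_on S (\<lambda>x. f x - g x)"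
  using smooth_on_add[of S f "\<lambda>x. - g x"] smooth_on_minus[of S g] by simp

lemma smooth_on_compose:
  fixes f :: "'a::euclidean_space \<Rightarrow> 'b::euclidean_space" and g :: "'b \<Rightarrow> 'c::real_normed_vector"
  assumes "open S" "open T" "\<And>x. x \<in> S \<Longrightarrow> f x \<in> T" "smooth_on S f" "smooth_on T g"
  shows "smooth_on S (\<lambda>x. g (f x))"
  using Ck_on_compose[of S T f _ g] assms by (auto simp: smooth_on_def image_subset_iff)

lemma smooth_on_holomorphic: "open S \<Longrightarrow> f holomorphic_on S \<Longrightarrow> smooth_on S f"
  by (simp add: smooth_on_def Ck_on_holomorphic)

lemma smooth_on_exp: "open S \<Longrightarrow> smooth_on S f \<Longrightarrow> smooth_on S (\<lambda>x. exp (f x :: real))"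
  by (rule smooth_on_compose[of S UNIV f exp]) (auto simp: smooth_on_def Ck_on_exp)

lemma smooth_on_ln:
  "open S \<Longrightarrow> smooth_on S f \<Longrightarrow> (\<And>x. x \<in> S \<Longrightarrow> f x > 0) \<Longrightarrow> smooth_on S (\<lambda>x. ln (f x :: real))"
  by (rule smooth_on_compose[of S "{0<..}" f ln]) (auto simp: smooth_on_def Ck_on_ln)

lemma smooth_on_of_real:
  assumes "open S" "smooth_on S f"
  shows "smooth_on S (\<lambda>x. complex_of_real (f x))"
  by (rule smooth_on_compose[of S UNIV f]) (use assms in \<open>auto intro: smooth_on_bounded_linear bounded_linear_of_real\<close>)

text \<open>The open sets \<open>S\<close> and \<open>-K\<close> cover the space, and
  \<open>f\<close> is smooth on each. This is how functions built on the bidisk become global test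
  functions.\<close>

lemma smooth_on_zero_extension:
  assumes "open S" "closed K" "K \<subseteq> S" "smooth_on S f" "\<And>x. x \<notin> K \<Longrightarrow> f x = 0"
  shows "smooth f"
proof -
  have "Ck_on n (-K) f" for n
    using Ck_on_cong[of "-K" f "\<lambda>_. 0" n] Ck_on_const assms by (auto simp: open_Compl)
  then have "Ck_on n (S \<union> -K) f" for n
    using assms by (intro Ck_on_Un) (auto simp: smooth_on_def open_Compl)
  moreover have "S \<union> -K = UNIV" using assms(3) by auto
  ultimately show ?thesis by (simp add: smooth_iff_smooth_on smooth_on_def)
qed

subsection \<open>Bump functions\<close>

text \<open>Carrying all powers \<open>k\<close> makes this family closed under differentiation up
  to linear combinations, so smoothness of \<open>exp (-1/x)\<close> extended by 0 is a single
  induction for all \<open>k\<close> at once.\<close>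

definition flat_exp :: "nat \<Rightarrow> real \<Rightarrow> real" where
  "flat_exp k x = (if x > 0 then exp (- (1 / x)) / x ^ k else 0)"

lemma flat_exp_nonneg: "0 \<le> flat_exp k x"
  by (simp add: flat_exp_def)

lemma flat_exp_tendsto_0: "(flat_exp k \<longlongrightarrow> 0) (at 0)"
proof -
  have "((\<lambda>x::real. x ^ k / exp x) \<longlongrightarrow> 0) at_top"
    by (rule tendsto_power_div_exp_0)
  then have "((\<lambda>x::real. inverse x ^ k / exp (inverse x)) \<longlongrightarrow> 0) (at_right 0)"
    by (simp add: filterlim_at_right_to_top)
  moreover have "eventually (\<lambda>x::real. inverse x ^ k / exp (inverse x) = flat_exp k x) (at_right 0)"
    unfolding eventually_at_right_field
    by (rule exI[of _ 1]) (auto simp: flat_exp_def exp_minus field_simps)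
  ultimately have "(flat_exp k \<longlongrightarrow> 0) (at_right 0)"
    by (rule Lim_transform_eventually)
  moreover have "(flat_exp k \<longlongrightarrow> 0) (at_left 0)"
  proof (rule Lim_transform_eventually[OF tendsto_const])
    show "\<forall>\<^sub>F x in at_left 0. 0 = flat_exp k x"
      unfolding eventually_at_left_field by (rule exI[of _ "-1"]) (auto simp: flat_exp_def)
  qed
  ultimately show ?thesis by (simp add: filterlim_split_at)
qed

lemma flat_exp_has_derivative:
  "(flat_exp k has_real_derivative (flat_exp (k + 2) x - real k * flat_exp (k + 1) x)) (at x)"
proof -
  consider "x > 0" | "x < 0" | "x = 0" by linarith
  then show ?thesis
  proof cases
    case 1
    have "((\<lambda>x. exp (- (1 / x)) / x ^ k) has_real_derivative
        (exp (- (1/x)) * (1 / x\<^sup>2) * x ^ k - exp (- (1 / x)) * (real k * x ^ (k - 1))) / (x ^ k * x ^ k)) (at x)"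
      using 1 by (auto intro!: derivative_eq_intros simp: power2_eq_square)
    moreover have "(exp (- (1/x)) * (1 / x\<^sup>2) * x ^ k - exp (- (1 / x)) * (real k * x ^ (k - 1))) / (x ^ k * x ^ k)
        = flat_exp (k + 2) x - real k * flat_exp (k + 1) x"
      using 1 by (cases k) (auto simp: flat_exp_def field_simps power2_eq_square)
    ultimately have "((\<lambda>x. exp (- (1 / x)) / x ^ k) has_real_derivative
        (flat_exp (k + 2) x - real k * flat_exp (k + 1) x)) (at x)" by simp
    then show ?thesis
      by (rule has_field_derivative_transform_within_open[where S = "{0<..}"])
         (use 1 in \<open>auto simp: flat_exp_def\<close>)
  next
    case 2
    have "((\<lambda>x. 0) has_real_derivative (flat_exp (k + 2) x - real k * flat_exp (k + 1) x)) (at x)"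
      using 2 by (simp add: flat_exp_def)
    then show ?thesis
      by (rule has_field_derivative_transform_within_open[where S = "{..<0}"])
         (use 2 in \<open>auto simp: flat_exp_def\<close>)
  next
    case 3
    \<comment> \<open>The difference quotient of \<open>flat_exp k\<close> at 0 is
      \<open>flat_exp (Suc k)\<close>.\<close>
    have "((\<lambda>h. (flat_exp k (0 + h) - flat_exp k 0) / h) \<longlongrightarrow> 0) (at 0)"
      by (rule Lim_transform_eventually[OF flat_exp_tendsto_0[of "Suc k"]])
         (auto simp: flat_exp_def eventually_at_filter)
    then show ?thesis using 3 by (simp add: DERIV_def flat_exp_def)
  qed
qed

lemma smooth_on_flat_exp: "smooth_on UNIV (flat_exp k)"
proof -
  have "Ck_on n UNIV (flat_exp k)" for n
  proof (induction n arbitrary: k)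
    case 0
    then show ?case
      by (auto intro!: DERIV_isCont continuous_at_imp_continuous_on flat_exp_has_derivative)
  next
    case (Suc n)
    show ?case
      by (rule Ck_on_real_SucI[OF _ flat_exp_has_derivative])
         (use Suc Ck_on_add[of UNIV n "flat_exp (k+2)" "\<lambda>x. (- real k) * flat_exp (k + 1) x"]
           Ck_on_mult[of UNIV n "\<lambda>x. - real k" "flat_exp (k+1)"] Ck_on_const in auto)
  qed
  then show ?thesis by (simp add: smooth_on_def)
qed

lemma smooth_on_flat_exp_comp:
  "open S \<Longrightarrow> smooth_on S f \<Longrightarrow> smooth_on S (\<lambda>x. flat_exp k (f x))"
  by (rule smooth_on_compose[OF _ open_UNIV _ _ smooth_on_flat_exp]) auto

lemma flat_exp_le_1: "flat_exp 0 x \<le> 1"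
  by (simp add: flat_exp_def)

lemma flat_exp_scaled_tendsto:
  "(\<lambda>n. flat_exp 0 (real (Suc n) * x)) \<longlonglongrightarrow> indicator {0<..} x"
proof (cases "x > 0")
  case True
  have "(\<lambda>n. exp (- (1 / x) * inverse (real (Suc n)))) \<longlonglongrightarrow> exp (- (1 / x) * 0)"
    by (intro tendsto_intros LIMSEQ_inverse_real_of_nat)
  moreover have "exp (- (1 / x) * inverse (real (Suc n))) = flat_exp 0 (real (Suc n) * x)" for n
    using True by (simp add: flat_exp_def divide_simps del: of_nat_Suc)
  ultimately show ?thesis using True by simp
next
  case False
  then have "real (Suc n) * x \<le> 0" for n
    by (simp add: mult_nonneg_nonpos)
  then have "flat_exp 0 (real (Suc n) * x) = 0" for n
    by (metis flat_exp_def not_less)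
  then show ?thesis using False by (simp only:) simp
qed

text \<open>Smooth functions between 0 and 1, vanishing off the open box and converging pointwise to
  its indicator: each factor tends to the indicator of a half-line. \<open>Suc n\<close> keeps the
  scale positive.\<close>

definition box_bump :: "'a::euclidean_space \<Rightarrow> 'a \<Rightarrow> nat \<Rightarrow> 'a \<Rightarrow> real" where
  "box_bump a b n x = (\<Prod>i\<in>Basis. flat_exp 0 (real (Suc n) * ((x - a) \<bullet> i)) * flat_exp 0 (real (Suc n) * ((b - x) \<bullet> i)))"

lemma box_bump_nonneg: "0 \<le> box_bump a b n x"
  by (auto simp: box_bump_def intro!: prod_nonneg mult_nonneg_nonneg flat_exp_nonneg)

lemma box_bump_le_1: "box_bump a b n x \<le> 1"
  unfolding box_bump_def
  by (rule prod_le_1) (auto intro!: mult_nonneg_nonneg flat_exp_nonneg mult_le_one flat_exp_le_1)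

lemma box_bump_zero: "x \<notin> box a b \<Longrightarrow> box_bump a b n x = 0"
proof -
  assume "x \<notin> box a b"
  then obtain i where i: "i \<in> Basis" "(x - a) \<bullet> i \<le> 0 \<or> (b - x) \<bullet> i \<le> 0"
    by (auto simp: mem_box inner_diff_left not_less)
  then have "real (Suc n) * ((x - a) \<bullet> i) \<le> 0 \<or> real (Suc n) * ((b - x) \<bullet> i) \<le> 0"
    by (auto simp del: of_nat_Suc intro: mult_nonneg_nonpos)
  then have "flat_exp 0 (real (Suc n) * ((x - a) \<bullet> i)) * flat_exp 0 (real (Suc n) * ((b - x) \<bullet> i)) = 0"
    unfolding flat_exp_def by (auto simp del: of_nat_Suc)
  then show ?thesis unfolding box_bump_def using i(1) by (intro prod_zero) auto
qed

lemma smooth_on_box_bump: "smooth_on UNIV (box_bump a b n)"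
proof -
  have "smooth_on UNIV (\<lambda>x. flat_exp 0 (real (Suc n) * ((x - a) \<bullet> i)))"
    and "smooth_on UNIV (\<lambda>x. flat_exp 0 (real (Suc n) * ((b - x) \<bullet> i)))" for i :: 'a
    by (intro smooth_on_flat_exp_comp smooth_on_mult smooth_on_inner smooth_on_diff smooth_on_const smooth_on_bounded_linear[OF bounded_linear_ident];
        simp)+
  then show ?thesis unfolding box_bump_def
    by (intro smooth_on_prod smooth_on_mult) auto
qed

lemma box_bump_tendsto: "(\<lambda>n. box_bump a b n x) \<longlonglongrightarrow> indicator (box a b) x"
proof -
  have "(\<lambda>n. box_bump a b n x) \<longlonglongrightarrow>
     (\<Prod>i\<in>Basis. indicator {0<..} ((x - a) \<bullet> i) * indicator {0<..} ((b - x) \<bullet> i))"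
    unfolding box_bump_def by (intro tendsto_prod tendsto_mult flat_exp_scaled_tendsto)
  moreover have "(\<Prod>i\<in>Basis. indicator {0<..} ((x - a) \<bullet> i) * indicator {0<..} ((b - x) \<bullet> i))
     = (indicator (box a b) x :: real)"
  proof (cases "x \<in> box a b")
    case True
    then show ?thesis by (auto simp: mem_box inner_diff_left intro!: prod.neutral)
  next
    case False
    then obtain i where "i \<in> Basis" "(x - a) \<bullet> i \<le> 0 \<or> (b - x) \<bullet> i \<le> 0"
      by (auto simp: mem_box inner_diff_left not_less)
    then have "(\<Prod>i\<in>Basis. indicator {0<..} ((x - a) \<bullet> i) * indicator {0<..} ((b - x) \<bullet> i)) = (0::real)"
      by (intro prod_zero bexI[of _ i]) auto
    then show ?thesis using False by simp
  qed
  ultimately show ?thesis by simp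
qed

text \<open>The quotient \<open>A / (A + B)\<close>, where \<open>A\<close> is positive exactly
  inside radius \<open>s'\<close> and \<open>B\<close> exactly outside radius \<open>s\<close>; as
  \<open>s < s'\<close>, the two never vanish together. Squared norms are used since
  \<open>x \<bullet> x\<close> is smooth at 0.\<close>

lemma smooth_cutoff_exists:
  fixes s s' :: real
  assumes "0 \<le> s" "s < s'"
  obtains \<kappa> :: "'a::euclidean_space \<Rightarrow> real" where "smooth_on UNIV \<kappa>" "\<And>x. 0 \<le> \<kappa> x" "\<And>x. \<kappa> x \<le> 1"
    "\<And>x. norm x \<le> s \<Longrightarrow> \<kappa> x = 1" "\<And>x. norm x \<ge> s' \<Longrightarrow> \<kappa> x = 0"
proof -
  define A B where "A = (\<lambda>x::'a. flat_exp 0 (s'\<^sup>2 - x \<bullet> x))" and "B = (\<lambda>x::'a. flat_exp 0 (x \<bullet> x - s\<^sup>2))"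
  have ss: "s\<^sup>2 < s'\<^sup>2" using assms by (simp add: power_strict_mono)
  have pos: "A x + B x > 0" for x
  proof -
    have "A x > 0 \<or> B x > 0" using ss by (auto simp: A_def B_def flat_exp_def)
    moreover have "A x \<ge> 0" "B x \<ge> 0" by (auto simp: A_def B_def flat_exp_nonneg)
    ultimately show ?thesis by linarith
  qed
  have smA: "smooth_on UNIV A" unfolding A_def
    by (intro smooth_on_flat_exp_comp smooth_on_diff smooth_on_inner smooth_on_const
         smooth_on_bounded_linear[OF bounded_linear_ident] open_UNIV)
  have smB: "smooth_on UNIV B" unfolding B_def
    by (intro smooth_on_flat_exp_comp smooth_on_diff smooth_on_inner smooth_on_const
         smooth_on_bounded_linear[OF bounded_linear_ident] open_UNIV)
  define \<kappa> where "\<kappa> = (\<lambda>x. A x * inverse (A x + B x))"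
  show thesis
  proof
    have AB: "smooth_on UNIV (\<lambda>x. A x + B x)" by (intro smooth_on_add smA smB open_UNIV)
    have "smooth_on UNIV (\<lambda>x. inverse (A x + B x))"
      by (rule smooth_on_compose[where f = "\<lambda>x. A x + B x" and g = inverse, OF open_UNIV open_greaterThan])
         (use pos AB in \<open>auto simp: smooth_on_def Ck_on_inverse\<close>)
    then show "smooth_on UNIV \<kappa>" unfolding \<kappa>_def
      by (intro smooth_on_mult smA open_UNIV)
    have A0: "A x \<ge> 0" and B0: "B x \<ge> 0" for x by (auto simp: A_def B_def flat_exp_nonneg)
    show "0 \<le> \<kappa> x" for x using A0[of x] pos[of x] by (simp add: \<kappa>_def)
    show "\<kappa> x \<le> 1" for x using B0[of x] pos[of x] by (simp add: \<kappa>_def divide_simps)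
    show "\<kappa> x = 1" if "norm x \<le> s" for x
    proof -
      have "x \<bullet> x \<le> s\<^sup>2" using that by (metis norm_ge_zero power2_norm_eq_inner power_mono)
      then have "B x = 0" by (simp add: B_def flat_exp_def)
      then show ?thesis using pos[of x] by (simp add: \<kappa>_def)
    qed
    show "\<kappa> x = 0" if "norm x \<ge> s'" for x
    proof -
      have "x \<bullet> x \<ge> s'\<^sup>2" using that assms by (metis less_eq_real_def order.trans power2_norm_eq_inner power_mono)
      then show ?thesis by (simp add: \<kappa>_def A_def flat_exp_def)
    qed
  qed
qed

section \<open>Nonvanishing functions on the disk\<close>

text \<open>Schwarz's lemma, after mapping the left half-plane to the disk with \<open>k z\<close> going to \<open>0\<close>.\<close>

lemma deriv_bound_left_half_plane:
  assumes hol: "k holomorphic_on unit_disk" and neg: "\<And>z. z \<in> unit_disk \<Longrightarrow> Re (k z) < 0"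
    and z: "z \<in> unit_disk"
  shows "norm (deriv k z) \<le> 2 * (- Re (k z)) / (1 - norm z)"
proof -
  \<comment> \<open>The largest disk about \<open>z\<close> in the unit disk, rescaled to the unit
    disk for Schwarz's lemma; its radius produces the factor
    \<open>1 / (1 - norm z)\<close>.\<close>
  define \<rho> where "\<rho> = 1 - norm z"
  have \<rho>: "\<rho> > 0" using z by (simp add: \<rho>_def)
  define m where "m = (\<lambda>\<zeta>. (k (z + of_real \<rho> * \<zeta>) - k z) / (k (z + of_real \<rho> * \<zeta>) + cnj (k z)))"
  have inD: "z + of_real \<rho> * \<zeta> \<in> unit_disk" if "norm \<zeta> < 1" for \<zeta>
  proof -
    have "norm (z + of_real \<rho> * \<zeta>) \<le> norm z + \<rho> * norm \<zeta>"
      using norm_triangle_ineq[of z "of_real \<rho> * \<zeta>"] \<rho> by (simp add: norm_mult)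
    also have "\<dots> < norm z + \<rho>" using that \<rho> by simp
    finally show ?thesis by (simp add: \<rho>_def)
  qed
  have neg_add: "Re (a + cnj b) < 0" if "Re a < 0" "Re b < 0" for a b using that by simp
  have nz: "k (z + of_real \<rho> * \<zeta>) + cnj (k z) \<noteq> 0" if "norm \<zeta> < 1" for \<zeta>
    using neg_add[OF neg[OF inD[OF that]] neg[OF z]] by (metis less_irrefl zero_complex.simps(1))
  have holk: "(\<lambda>\<zeta>. k (z + of_real \<rho> * \<zeta>)) holomorphic_on ball 0 1"
    by (rule holomorphic_on_compose_gen[where g = k and f = "\<lambda>\<zeta>. z + of_real \<rho> * \<zeta>", unfolded o_def, OF _ hol])
       (use inD in \<open>auto intro!: holomorphic_intros\<close>)
  have "m holomorphic_on ball 0 1" unfolding m_def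
    by (intro holomorphic_intros holk) (use nz in auto)
  moreover have "m 0 = 0" by (simp add: m_def)
  moreover have "norm (m \<zeta>) < 1" if "norm \<zeta> < 1" for \<zeta>
  proof -
    define a b where "a = k (z + of_real \<rho> * \<zeta>)" and "b = k z"
    have "Re a < 0" "Re b < 0" using neg[OF inD[OF that]] neg[OF z] by (auto simp: a_def b_def)
    then have "Re a * Re b > 0" by (rule mult_neg_neg)
    \<comment> \<open>The difference of the two squares is \<open>4 * Re a * Re b\<close>.\<close>
    then have "(norm (a - b))\<^sup>2 < (norm (a + cnj b))\<^sup>2"
      unfolding cmod_power2 by (simp add: power2_eq_square algebra_simps)
    then have "norm (a - b) < norm (a + cnj b)"
      by (rule power2_less_imp_less) simp
    then show ?thesis by (simp add: m_def a_def[symmetric] b_def[symmetric] norm_divide divide_less_eq)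
  qed
  ultimately have m1: "norm (deriv m 0) \<le> 1" using Schwarz_Lemma(2)[of m 0] by simp
  have dk: "(k has_field_derivative deriv k z) (at z)"
    using hol z by (auto intro: holomorphic_derivI)
  have D: "((\<lambda>\<zeta>. k (z + of_real \<rho> * \<zeta>)) has_field_derivative deriv k z * of_real \<rho>) (at 0)"
    by (rule DERIV_chain2[where f = k and g = "\<lambda>\<zeta>. z + of_real \<rho> * \<zeta>"])
       (use dk in \<open>auto intro!: derivative_eq_intros\<close>)
  have nz0: "k z + cnj (k z) \<noteq> 0" using nz[of 0] by simp
  have "(m has_field_derivative (deriv k z * of_real \<rho>) / (k z + cnj (k z))) (at 0)"
    unfolding m_def
    using DERIV_divide[OF DERIV_diff[OF D DERIV_const[of "k z"]] DERIV_add[OF D DERIV_const[of "cnj (k z)"]]] nz0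
    by simp
  then have "deriv m 0 = deriv k z * of_real \<rho> / (2 * of_real (Re (k z)))"
    by (simp add: DERIV_imp_deriv complex_add_cnj)
  then have "norm (deriv k z) * \<rho> / (2 * (- Re (k z))) \<le> 1"
    using m1 neg[OF z] \<rho> by (simp add: norm_divide norm_mult)
  then show ?thesis using neg[OF z] \<rho> by (simp add: \<rho>_def divide_simps mult.commute split: if_splits)
qed

text \<open>The disk is contractible, so \<open>g / 2\<close> has a holomorphic logarithm
  \<open>k\<close>, and the bound 2 on \<open>g\<close> puts its values into the left half-plane.
  The positive harmonic function is \<open>- Re k\<close>.\<close>

lemma holomorphic_log_half_plane:
  assumes hol: "g holomorphic_on unit_disk" and nz: "\<And>z. z \<in> unit_disk \<Longrightarrow> g z \<noteq> 0"
    and bd: "\<And>z. z \<in> unit_disk \<Longrightarrow> norm (g z) < 2"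
  obtains k where "k holomorphic_on unit_disk" "\<And>z. z \<in> unit_disk \<Longrightarrow> g z = 2 * exp (k z)"
    "\<And>z. z \<in> unit_disk \<Longrightarrow> ln (2 / norm (g z)) = - Re (k z)"
    "\<And>z. z \<in> unit_disk \<Longrightarrow> Re (k z) < 0"
proof -
  have "(\<lambda>z. g z / 2) holomorphic_on unit_disk" by (intro holomorphic_intros hol) auto
  moreover have "contractible unit_disk" by (intro convex_imp_contractible convex_ball)
  ultimately obtain k where k: "k holomorphic_on unit_disk" "\<And>z. z \<in> unit_disk \<Longrightarrow> g z / 2 = exp (k z)"
    using contractible_imp_holomorphic_log[of "\<lambda>z. g z / 2" unit_disk] nz by auto
  have g: "g z = 2 * exp (k z)" if "z \<in> unit_disk" for z using k(2)[OF that] by (simp add: field_simps)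
  have n: "norm (g z) = 2 * exp (Re (k z))" if "z \<in> unit_disk" for z
    by (simp add: g[OF that] norm_mult)
  have ln: "ln (2 / norm (g z)) = - Re (k z)" if "z \<in> unit_disk" for z
    by (simp add: n[OF that] exp_minus[symmetric] inverse_eq_divide[symmetric])
  have neg: "Re (k z) < 0" if "z \<in> unit_disk" for z
  proof -
    have "exp (Re (k z)) < 1" using bd[OF that] n[OF that] by simp
    then show ?thesis by simp
  qed
  show thesis by (rule that[OF k(1) g ln neg])
qed

text \<open>Since \<open>g = 2 * exp k\<close>, the logarithmic derivative of \<open>g\<close> is
  \<open>k'\<close>, bounded by the half-plane estimate. Applied to differences of leaves, this is a
  log-Lipschitz bound for their slopes.\<close>

lemma deriv_bound_nonvanishing:
  assumes hol: "g holomorphic_on unit_disk" and nz: "\<And>z. z \<in> unit_disk \<Longrightarrow> g z \<noteq> 0"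
    and bd: "\<And>z. z \<in> unit_disk \<Longrightarrow> norm (g z) < 2" and z: "z \<in> unit_disk"
  shows "norm (deriv g z) \<le> 2 * norm (g z) * ln (2 / norm (g z)) / (1 - norm z)"
proof -
  obtain k where k: "k holomorphic_on unit_disk" "\<And>z. z \<in> unit_disk \<Longrightarrow> g z = 2 * exp (k z)"
    "\<And>z. z \<in> unit_disk \<Longrightarrow> ln (2 / norm (g z)) = - Re (k z)" "\<And>z. z \<in> unit_disk \<Longrightarrow> Re (k z) < 0"
    using holomorphic_log_half_plane[OF hol nz bd] by blast
  have "(k has_field_derivative deriv k z) (at z)"
    using k(1) z by (auto intro: holomorphic_derivI)
  then have "((\<lambda>z. 2 * exp (k z)) has_field_derivative 2 * (exp (k z) * deriv k z)) (at z)"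
    by (auto intro!: derivative_eq_intros)
  then have "(g has_field_derivative 2 * (exp (k z) * deriv k z)) (at z)"
    by (rule has_field_derivative_transform_within_open[OF _ open_ball z]) (simp add: k(2))
  then have "deriv g z = g z * deriv k z" using k(2)[OF z] by (simp add: DERIV_imp_deriv)
  then have "norm (deriv g z) = norm (g z) * norm (deriv k z)" by (simp add: norm_mult)
  also have "\<dots> \<le> norm (g z) * (2 * (- Re (k z)) / (1 - norm z))"
    using deriv_bound_left_half_plane[OF k(1,4) z] by (intro mult_left_mono) auto
  finally show ?thesis using k(3)[OF z] by (simp add: mult.assoc mult.left_commute)
qed

text \<open>The derivative bound integrated along the segment from 0 to \<open>z\<close>: there the
  logarithm of \<open>u = - Re k\<close> has derivative at most \<open>2 / (1 - r)\<close> in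
  absolute value. The constant is cruder than the classical one, but depends on \<open>r\<close>
  only.\<close>

lemma Harnack_nonvanishing:
  assumes hol: "g holomorphic_on unit_disk" and nz: "\<And>z. z \<in> unit_disk \<Longrightarrow> g z \<noteq> 0"
    and bd: "\<And>z. z \<in> unit_disk \<Longrightarrow> norm (g z) < 2" and z: "norm z \<le> r" "r < 1"
  defines "u \<equiv> \<lambda>z. ln (2 / norm (g z))"
  shows "u 0 > 0" "exp (- (2 / (1 - r))) * u 0 \<le> u z" "u z \<le> exp (2 / (1 - r)) * u 0"
proof -
  obtain k where k: "k holomorphic_on unit_disk" "\<And>z. z \<in> unit_disk \<Longrightarrow> g z = 2 * exp (k z)"
    "\<And>z. z \<in> unit_disk \<Longrightarrow> u z = - Re (k z)" "\<And>z. z \<in> unit_disk \<Longrightarrow> Re (k z) < 0"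
    unfolding u_def using holomorphic_log_half_plane[OF hol nz bd] by blast
  have r: "0 \<le> r" using z norm_ge_zero order_trans by blast
  have tz: "of_real t * z \<in> unit_disk" "norm (of_real t * z) \<le> r" if "0 \<le> t" "t \<le> 1" for t
  proof -
    have "\<bar>t\<bar> * norm z \<le> 1 * r" using that z by (intro mult_mono) auto
    then show "norm (of_real t * z) \<le> r" by (simp add: norm_mult)
    then show "of_real t * z \<in> unit_disk" using z by (simp add: norm_mult)
  qed
  have upos: "u w > 0" if "w \<in> unit_disk" for w using k(3,4)[OF that] by simp
  then show "u 0 > 0" by simp
  define L where "L = (\<lambda>t. ln (- Re (k (of_real t * z))))"
  define L' where "L' = (\<lambda>t. Re (deriv k (of_real t * z) * z) / Re (k (of_real t * z)))"
  have deriv: "(L has_real_derivative L' t) (at t)" if "0 \<le> t" "t \<le> 1" for t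
  proof -
    have "(k has_field_derivative deriv k (of_real t * z)) (at (of_real t * z))"
      using k(1) tz[OF that] by (auto intro: holomorphic_derivI)
    moreover have "((\<lambda>t. of_real t * z) has_vector_derivative z) (at t)"
      by (auto intro!: derivative_eq_intros)
    ultimately have "((\<lambda>t. k (of_real t * z)) has_vector_derivative (z * deriv k (of_real t * z))) (at t)"
      using field_vector_diff_chain_at[where f = "\<lambda>t. of_real t * z" and g = k and x = t] by (simp add: o_def)
    then have "((\<lambda>t. Re (k (of_real t * z))) has_real_derivative Re (z * deriv k (of_real t * z))) (at t)"
      unfolding has_real_derivative_iff_has_vector_derivative
      by (rule bounded_linear.has_vector_derivative[OF bounded_linear_Re])
    then have "((\<lambda>t. - Re (k (of_real t * z))) has_real_derivative - Re (z * deriv k (of_real t * z))) (at t)"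
      by (rule DERIV_minus)
    moreover have "- Re (k (of_real t * z)) > 0" using k(4)[OF tz(1)[OF that]] by simp
    ultimately have "(L has_real_derivative 1 / (- Re (k (of_real t * z))) * (- Re (z * deriv k (of_real t * z)))) (at t)"
      unfolding L_def by (rule DERIV_chain2[OF DERIV_ln_divide, rotated])
    moreover have "1 / (- a) * (- b) = b / a" for a b :: real by simp
    ultimately show ?thesis unfolding L'_def mult.commute[of _ z] by (simp only:)
  qed
  have bound: "\<bar>L' t\<bar> \<le> 2 / (1 - r)" if "0 \<le> t" "t \<le> 1" for t
  proof -
    let ?w = "of_real t * z" let ?a = "- Re (k ?w)"
    have a: "?a > 0" using k(4)[OF tz(1)[OF that]] by simp
    have "\<bar>Re (deriv k ?w * z)\<bar> \<le> norm (deriv k ?w) * norm z"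
      using abs_Re_le_cmod[of "deriv k ?w * z"] by (simp add: norm_mult)
    also have "\<dots> \<le> (2 * ?a / (1 - r)) * 1"
    proof (intro mult_mono)
      have "norm (deriv k ?w) \<le> 2 * ?a / (1 - norm ?w)"
        by (rule deriv_bound_left_half_plane[OF k(1,4) tz(1)[OF that]])
      also have "\<dots> \<le> 2 * ?a / (1 - r)"
        using a tz[OF that] z(2) by (intro divide_left_mono mult_pos_pos) auto
      finally show "norm (deriv k ?w) \<le> 2 * ?a / (1 - r)" .
      show "norm z \<le> 1" using z by simp
      show "0 \<le> 2 * ?a / (1 - r)" using a z(2) by (intro divide_nonneg_nonneg) auto
    qed simp
    finally have "\<bar>Re (deriv k ?w * z)\<bar> \<le> 2 / (1 - r) * ?a" by (simp only: mult_1_right times_divide_eq_left)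
    then have "\<bar>Re (deriv k ?w * z)\<bar> / ?a \<le> 2 / (1 - r)" using a by (simp only: pos_divide_le_eq)
    moreover have "\<bar>L' t\<bar> = \<bar>Re (deriv k ?w * z)\<bar> / ?a" unfolding L'_def using a by (simp only: abs_divide abs_of_neg neg_0_less_iff_less)
    ultimately show ?thesis by simp
  qed
  have "norm (L 1 - L 0) \<le> 2 / (1 - r) * norm (1 - 0 :: real)"
    by (rule field_differentiable_bound[where S = "{0..1}" and f' = L'])
       (use bound deriv in \<open>auto intro: DERIV_subset has_field_derivative_at_within\<close>)
  then have "\<bar>ln (u z) - ln (u 0)\<bar> \<le> 2 / (1 - r)"
    using z k(3)[of z] k(3)[of 0] by (simp add: L_def)
  moreover have "u z > 0" "u 0 > 0" using upos z by auto
  ultimately have "ln (exp (- (2 / (1 - r))) * u 0) \<le> ln (u z)" "ln (u z) \<le> ln (exp (2 / (1 - r)) * u 0)"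
    by (simp_all add: ln_mult)
  then show "exp (- (2 / (1 - r))) * u 0 \<le> u z" "u z \<le> exp (2 / (1 - r)) * u 0"
    using \<open>u z > 0\<close> \<open>u 0 > 0\<close> by simp_all
qed

section \<open>Measures determined by generators\<close>

text \<open>The sets over which \<open>f\<close> has integral 0 are closed under disjoint unions
  and, because the total integral is 0, under complements; Dynkin's theorem then reaches all
  measurable sets. The total is a separate assumption since \<open>G\<close> may lack the whole
  space.\<close>

lemma AE_zero_if_integral_zero_on_generator:
  fixes f :: "'a \<Rightarrow> 'b::{second_countable_topology, banach}"
  assumes sf: "sigma_finite_measure M" and int: "integrable M f" and G: "Int_stable G" "G \<subseteq> Pow (space M)" "sets M = sigma_sets (space M) G"
    and zero: "\<And>A. A \<in> G \<Longrightarrow> set_lebesgue_integral M A f = 0" and total: "integral\<^sup>L M f = 0"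
  shows "AE x in M. f x = 0"
proof (rule sigma_finite_measure.density_zero[OF sf int])
  fix A assume "A \<in> sets M"
  then have "A \<in> sigma_sets (space M) G" using G(3) by simp
  with G(1,2) show "set_lebesgue_integral M A f = 0"
  proof (induction rule: sigma_sets_induct_disjoint)
    case (basic A)
    then show ?case by (rule zero)
  next
    case empty
    then show ?case by (simp add: set_lebesgue_integral_def)
  next
    case (compl A)
    then have A: "A \<in> sets M" by (simp add: G(3))
    have "set_lebesgue_integral M (space M - A) f = (LINT x|M. f x - indicator A x *\<^sub>R f x)"
      unfolding set_lebesgue_integral_def
      by (rule Bochner_Integration.integral_cong) (auto simp: indicator_def)
    also have "\<dots> = integral\<^sup>L M f - set_lebesgue_integral M A f"
      unfolding set_lebesgue_integral_def
      by (rule Bochner_Integration.integral_diff[OF int]) (use int A in \<open>auto intro: integrable_mult_indicator\<close>)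
    finally show ?case using compl total by simp
  next
    case (union A)
    then have meas: "A i \<in> sets M" for i by (auto simp: G(3))
    have "set_lebesgue_integral M (\<Union>i. A i) f = (\<Sum>i. set_lebesgue_integral M (A i) f)"
      by (rule lebesgue_integral_countable_add)
         (use union(1) meas int in \<open>auto simp: disjoint_family_on_def set_integrable_def intro!: integrable_mult_indicator\<close>)
    then show ?case using union by simp
  qed
qed

text \<open>One factor is extended at a time. A complement in the first factor is taken inside
  \<open>space A \<times> b\<close>, which must itself be generated; this is why both generators
  contain the full space.\<close>

lemma sets_pair_measure_generator:
  assumes A: "sets A = sigma_sets (space A) GA" "GA \<subseteq> Pow (space A)" "space A \<in> GA"
    and B: "sets B = sigma_sets (space B) GB" "GB \<subseteq> Pow (space B)" "space B \<in> GB"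
  shows "sets (A \<Otimes>\<^sub>M B) = sigma_sets (space A \<times> space B) {a \<times> b |a b. a \<in> GA \<and> b \<in> GB}" (is "_ = ?S")
proof -
  let ?E = "{a \<times> b |a b. a \<in> GA \<and> b \<in> GB}" and ?\<Omega> = "space A \<times> space B"
  have E: "?E \<subseteq> Pow ?\<Omega>" using A(2) B(2) by blast
  interpret S: sigma_algebra ?\<Omega> ?S by (rule sigma_algebra_sigma_sets[OF E])
  have 1: "a \<times> b \<in> ?S" if "a \<in> sigma_sets (space A) GA" "b \<in> GB" for a b
    using that(1)
  proof (induction rule: sigma_sets.induct)
    case (Basic a)
    then show ?case using that(2) by (intro sigma_sets.Basic) auto
  next
    case (Compl a)
    have "space A \<times> b \<in> ?S" using A(3) that(2) by (intro sigma_sets.Basic) auto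
    then have "space A \<times> b - a \<times> b \<in> ?S" using Compl by blast
    moreover have "space A \<times> b - a \<times> b = (space A - a) \<times> b" by auto
    ultimately show ?case by simp
  next
    case (Union a)
    then have "(\<Union>i. a i \<times> b) \<in> ?S" by (intro sigma_sets.Union) auto
    moreover have "(\<Union>i. a i \<times> b) = (\<Union>i. a i) \<times> b" by auto
    ultimately show ?case by simp
  qed (auto intro: sigma_sets.Empty)
  have 2: "a \<times> b \<in> ?S" if "b \<in> sigma_sets (space B) GB" "a \<in> sigma_sets (space A) GA" for a b
    using that(1)
  proof (induction rule: sigma_sets.induct)
    case (Basic b)
    then show ?case using that(2) 1 by blast
  next
    case (Compl b)
    have "a \<times> space B \<in> ?S" using B(3) that(2) 1 by blast
    then have "a \<times> space B - a \<times> b \<in> ?S" using Compl by blast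
    moreover have "a \<times> space B - a \<times> b = a \<times> (space B - b)" by auto
    ultimately show ?case by simp
  next
    case (Union b)
    then have "(\<Union>i. a \<times> b i) \<in> ?S" by (intro sigma_sets.Union) auto
    moreover have "(\<Union>i. a \<times> b i) = a \<times> (\<Union>i. b i)" by auto
    ultimately show ?case by simp
  qed (auto intro: sigma_sets.Empty)
  have "sets (A \<Otimes>\<^sub>M B) \<subseteq> ?S"
    unfolding sets_pair_measure by (rule S.sigma_sets_subset) (auto simp: A(1) B(1) intro: 2)
  moreover have "?E \<subseteq> sets (A \<Otimes>\<^sub>M B)"
    using A(1) B(1) by (auto intro!: pair_measureI)
  then have "?S \<subseteq> sets (A \<Otimes>\<^sub>M B)"
    using sets.sigma_sets_subset[of ?E "A \<Otimes>\<^sub>M B"] by (simp add: space_pair_measure)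
  ultimately show ?thesis by blast
qed

subsection \<open>Boxes in an open set\<close>

text \<open>Requiring the closed box in \<open>U\<close> gives the bump functions of the open box
  compact support in \<open>U\<close>. Empty boxes are allowed, which keeps the family stable under
  intersection.\<close>

definition inner_boxes :: "'a::euclidean_space set \<Rightarrow> 'a set set" where
  "inner_boxes U = {box a b |a b. cbox a b \<subseteq> U}"

lemma Int_stable_inner_boxes: "Int_stable (inner_boxes U)"
proof (rule Int_stableI)
  fix A B :: "'a set" assume "A \<in> inner_boxes U" "B \<in> inner_boxes U"
  then obtain a b c d where *: "A = box a b" "B = box c d" "cbox a b \<subseteq> U"
    by (auto simp: inner_boxes_def)
  have "cbox (\<Sum>i\<in>Basis. max (a\<bullet>i) (c\<bullet>i) *\<^sub>R i) (\<Sum>i\<in>Basis. min (b\<bullet>i) (d\<bullet>i) *\<^sub>R i) \<subseteq> cbox a b"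
    by (auto simp: mem_box)
  with * show "A \<inter> B \<in> inner_boxes U"
    unfolding inner_boxes_def by (auto simp: box_Int_box)
qed

lemma inner_boxes_countable_cover:
  assumes "open V"
  obtains C where "countable C" "C \<subseteq> inner_boxes V" "\<Union>C = V"
proof -
  have "\<Union>(inner_boxes V) = V"
  proof
    show "\<Union>(inner_boxes V) \<subseteq> V" using box_subset_cbox by (fastforce simp: inner_boxes_def)
    show "V \<subseteq> \<Union>(inner_boxes V)"
    proof
      fix x assume "x \<in> V"
      then obtain a b where "x \<in> box a b" "cbox a b \<subseteq> V"
        using open_contains_cbox[of V x] assms by metis
      then show "x \<in> \<Union>(inner_boxes V)" by (auto simp: inner_boxes_def)
    qed
  qed
  moreover have "open S" if "S \<in> inner_boxes V" for S using that by (auto simp: inner_boxes_def)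
  ultimately show thesis using Lindelof[of "inner_boxes V"] that by metis
qed

text \<open>By Lindelof, each open subset of \<open>U\<close> is a countable union of inner
  boxes.\<close>

lemma sets_restrict_borel_inner_boxes:
  assumes "open U"
  shows "sets (restrict_space borel U) = sigma_sets U (inner_boxes U)"
proof -
  have sub: "inner_boxes U \<subseteq> Pow U" using box_subset_cbox by (fastforce simp: inner_boxes_def)
  interpret S: sigma_algebra U "sigma_sets U (inner_boxes U)" by (rule sigma_algebra_sigma_sets[OF sub])
  have "U \<inter> V \<in> sigma_sets U (inner_boxes U)" if "open V" for V
  proof -
    have "open (U \<inter> V)" using assms that by (rule open_Int)
    then obtain C where C: "countable C" "C \<subseteq> inner_boxes (U \<inter> V)" "\<Union>C = U \<inter> V"
      by (rule inner_boxes_countable_cover)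
    have "C \<subseteq> sigma_sets U (inner_boxes U)"
      using C(2) by (force simp: inner_boxes_def intro: sigma_sets.Basic)
    then show ?thesis using S.countable_Union[OF C(1)] C(3) by metis
  qed
  then have "(\<inter>) U ` {V. open V} \<subseteq> sigma_sets U (inner_boxes U)" by auto
  then have "sigma_sets U ((\<inter>) U ` {V. open V}) \<subseteq> sigma_sets U (inner_boxes U)"
    by (rule S.sigma_sets_subset)
  moreover have "sets (restrict_space borel U) = sigma_sets U ((\<inter>) U ` {V. open V})"
    unfolding sets_restrict_space borel_def
    by (simp add: sigma_sets_Int[of U UNIV, symmetric] assms sigma_sets.Basic)
  moreover have "inner_boxes U \<subseteq> sets (restrict_space borel U)"
    using assms box_subset_cbox by (fastforce simp: sets_restrict_space_iff inner_boxes_def)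
  then have "sigma_sets U (inner_boxes U) \<subseteq> sets (restrict_space borel U)"
    using sets.sigma_sets_subset[of "inner_boxes U" "restrict_space borel U"]
    by (simp add: space_restrict_space)
  ultimately show ?thesis by blast
qed

text \<open>Dominated convergence, with \<open>X\<close> truncated to the closed box, where it is
  integrable; the bumps vanish off the open box, so the truncation changes nothing.\<close>

lemma set_integral_box_limit:
  fixes X :: "'a::euclidean_space \<Rightarrow> complex"
  assumes sets: "sets \<sigma> = sets (restrict_space borel U)" and U: "open U" and ab: "cbox a b \<subseteq> U"
    and int: "set_integrable \<sigma> (cbox a b) X"
  shows "(\<lambda>n. \<integral>x. of_real (box_bump a b n x) * X x \<partial>\<sigma>) \<longlonglongrightarrow> (\<integral>x. indicator (box a b) x *\<^sub>R X x \<partial>\<sigma>)"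
proof -
  have sp: "space \<sigma> = U" using sets_eq_imp_space_eq[OF sets] by (simp add: space_restrict_space)
  have meas: "g \<in> borel_measurable \<sigma>" if "g \<in> borel_measurable borel" for g :: "'a \<Rightarrow> complex"
    unfolding measurable_cong_sets[OF sets refl] using that by (rule measurable_restrict_space1)
  have box: "box a b \<in> sets \<sigma>"
    using ab box_subset_cbox by (auto simp: sets sets_restrict_space_iff U)
  have int': "integrable \<sigma> (\<lambda>x. indicator (cbox a b) x *\<^sub>R X x)" using int by (simp add: set_integrable_def)
  let ?Y = "\<lambda>x. indicator (cbox a b) x *\<^sub>R X x"
  have eq: "of_real (box_bump a b n x) * X x = of_real (box_bump a b n x) * ?Y x" for n x
    using box_bump_zero[of x a b n] box_subset_cbox[of a b] by (cases "x \<in> box a b") auto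
  have bm: "(\<lambda>x. of_real (box_bump a b n x) :: complex) \<in> borel_measurable borel" for n
    using smooth_on_imp_continuous_on[OF smooth_on_box_bump, of a b n]
    by (auto intro!: borel_measurable_continuous_onI continuous_intros)
  have lim: "(\<lambda>n. \<integral>x. of_real (box_bump a b n x) * ?Y x \<partial>\<sigma>) \<longlonglongrightarrow> (\<integral>x. indicator (box a b) x *\<^sub>R ?Y x \<partial>\<sigma>)"
  proof (rule integral_dominated_convergence[where w = "\<lambda>x. norm (?Y x)"])
    show "(\<lambda>x. indicator (box a b) x *\<^sub>R ?Y x) \<in> borel_measurable \<sigma>"
      using int' box by (intro borel_measurable_scaleR borel_measurable_integrable[OF int']) auto
    show "(\<lambda>x. of_real (box_bump a b n x) * ?Y x) \<in> borel_measurable \<sigma>" for n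
      by (intro borel_measurable_times meas bm borel_measurable_integrable[OF int'])
    show "integrable \<sigma> (\<lambda>x. norm (?Y x))" using int' by (rule integrable_norm)
    have "(\<lambda>n. of_real (box_bump a b n x) * ?Y x) \<longlonglongrightarrow> of_real (indicator (box a b) x) * ?Y x" for x
      by (intro tendsto_mult tendsto_of_real box_bump_tendsto tendsto_const)
    then show "AE x in \<sigma>. (\<lambda>n. of_real (box_bump a b n x) * ?Y x) \<longlonglongrightarrow> indicator (box a b) x *\<^sub>R ?Y x"
      by (simp add: scaleR_conv_of_real)
    show "AE x in \<sigma>. norm (of_real (box_bump a b n x) * ?Y x) \<le> norm (?Y x)" for n
    proof (rule AE_I2)
      fix x
      have "\<bar>box_bump a b n x\<bar> * norm (?Y x) \<le> 1 * norm (?Y x)"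
        using box_bump_nonneg[of a b n x] box_bump_le_1[of a b n x] by (intro mult_right_mono) auto
      then show "norm (of_real (box_bump a b n x) * ?Y x) \<le> norm (?Y x)" by (simp add: norm_mult mult.left_commute)
    qed
  qed
  have "indicator (box a b) x *\<^sub>R ?Y x = indicator (box a b) x *\<^sub>R X x" for x
    using box_subset_cbox[of a b] by (auto simp: indicator_def)
  with lim show ?thesis unfolding eq by (simp only:)
qed

text \<open>\<open>X\<close> is only locally integrable, so the generator lemma is applied to its
  truncation to one inner box \<open>B\<close>; integrals over another box \<open>A\<close> then
  become integrals of \<open>X\<close> over the box \<open>A \<inter> B\<close>. Countably many
  \<open>B\<close> cover \<open>U\<close>.\<close>

lemma AE_zero_if_bump_integrals_zero:
  fixes X :: "'a::euclidean_space \<Rightarrow> complex"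
  assumes sets: "sets \<sigma> = sets (restrict_space borel U)" and U: "open U"
    and fin: "\<And>K. compact K \<Longrightarrow> K \<subseteq> U \<Longrightarrow> emeasure \<sigma> K < \<infinity>"
    and int: "\<And>a b. cbox a b \<subseteq> U \<Longrightarrow> set_integrable \<sigma> (cbox a b) X"
    and zero: "\<And>a b n. cbox a b \<subseteq> U \<Longrightarrow> (\<integral>x. of_real (box_bump a b n x) * X x \<partial>\<sigma>) = 0"
  shows "AE x in \<sigma>. X x = 0"
proof -
  have sp: "space \<sigma> = U" using sets_eq_imp_space_eq[OF sets] by (simp add: space_restrict_space)
  obtain C where C: "countable C" "C \<subseteq> inner_boxes U" "\<Union>C = U"
    by (rule inner_boxes_countable_cover[OF U])
  have "emeasure \<sigma> B < \<infinity>" "B \<in> sets \<sigma>" if B: "B \<in> inner_boxes U" for B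
  proof -
    obtain a b where *: "B = box a b" "cbox a b \<subseteq> U" using B by (auto simp: inner_boxes_def)
    then have s: "cbox a b \<in> sets \<sigma>" "box a b \<in> sets \<sigma>"
      using box_subset_cbox[of a b] by (auto simp: sets sets_restrict_space_iff U)
    then show "B \<in> sets \<sigma>" using * by simp
    show "emeasure \<sigma> B < \<infinity>"
      using fin[OF compact_cbox *(2)] emeasure_mono[OF box_subset_cbox s(1)] *(1) by (metis le_less_trans)
  qed
  then have sf: "sigma_finite_measure \<sigma>"
    unfolding sigma_finite_measure_def using C sp by (intro exI[of _ C]) (auto simp: less_top[symmetric] subset_iff)
  have box0: "(\<integral>x. indicator A x *\<^sub>R X x \<partial>\<sigma>) = 0" if A: "A \<in> inner_boxes U" for A
  proof -
    obtain a b where *: "A = box a b" "cbox a b \<subseteq> U" using A by (auto simp: inner_boxes_def)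
    then show ?thesis
      using set_integral_box_limit[OF sets U *(2) int[OF *(2)]] zero[OF *(2)]
      by (simp add: LIMSEQ_const_iff)
  qed
  have loc: "AE x in \<sigma>. x \<in> B \<longrightarrow> X x = 0" if B: "B \<in> inner_boxes U" for B
  proof -
    obtain a b where *: "B = box a b" "cbox a b \<subseteq> U" using B by (auto simp: inner_boxes_def)
    have "box a b \<in> sets \<sigma>"
      using *(2) box_subset_cbox by (auto simp: sets sets_restrict_space_iff U)
    then have intB: "integrable \<sigma> (\<lambda>x. indicator B x *\<^sub>R X x)"
      using set_integrable_subset[OF int[OF *(2)], of "box a b"] box_subset_cbox[of a b] *(1)
      by (auto simp: set_integrable_def)
    have "AE x in \<sigma>. indicator B x *\<^sub>R X x = 0"
    proof (rule AE_zero_if_integral_zero_on_generator[OF sf intB Int_stable_inner_boxes[of U]])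
      show "inner_boxes U \<subseteq> Pow (space \<sigma>)"
        unfolding sp using box_subset_cbox by (fastforce simp: inner_boxes_def)
      show "sets \<sigma> = sigma_sets (space \<sigma>) (inner_boxes U)"
        unfolding sp sets by (rule sets_restrict_borel_inner_boxes[OF U])
      show "(\<integral>x. indicator B x *\<^sub>R X x \<partial>\<sigma>) = 0" by (rule box0[OF B])
      show "set_lebesgue_integral \<sigma> A (\<lambda>x. indicator B x *\<^sub>R X x) = 0" if "A \<in> inner_boxes U" for A
        using box0[OF Int_stableD[OF Int_stable_inner_boxes that B]]
        by (simp add: set_lebesgue_integral_def indicator_inter_arith)
    qed
    then show ?thesis by (rule AE_mp) (auto simp: indicator_def)
  qed
  have "AE x in \<sigma>. \<forall>B\<in>C. x \<in> B \<longrightarrow> X x = 0"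
    using loc C by (subst AE_ball_countable) auto
  then show ?thesis by (rule AE_mp) (use C sp in auto)
qed

text \<open>The uniqueness half of Riesz representation, needed to evaluate the \<open>THE\<close>
  in \<open>trace_measure\<close>.\<close>

lemma measure_eqI_bump_integrals:
  fixes \<sigma> \<sigma>' :: "'a::euclidean_space measure"
  assumes sets: "sets \<sigma> = sets (restrict_space borel U)" "sets \<sigma>' = sets (restrict_space borel U)" and U: "open U"
    and fin: "\<And>K. compact K \<Longrightarrow> K \<subseteq> U \<Longrightarrow> emeasure \<sigma> K < \<infinity>" "\<And>K. compact K \<Longrightarrow> K \<subseteq> U \<Longrightarrow> emeasure \<sigma>' K < \<infinity>"
    and eq: "\<And>a b n. cbox a b \<subseteq> U \<Longrightarrow> (\<integral>x. of_real (box_bump a b n x) \<partial>\<sigma>) = (\<integral>x. complex_of_real (box_bump a b n x) \<partial>\<sigma>')"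
  shows "\<sigma> = \<sigma>'"
proof -
  obtain C where C: "countable C" "C \<subseteq> inner_boxes U" "\<Union>C = U"
    by (rule inner_boxes_countable_cover[OF U])
  have int: "set_integrable \<rho> (cbox a b) (\<lambda>x. 1 :: complex)" "box a b \<in> sets \<rho>" "emeasure \<rho> (box a b) < \<infinity>"
    if "sets \<rho> = sets (restrict_space borel U)" "\<And>K. compact K \<Longrightarrow> K \<subseteq> U \<Longrightarrow> emeasure \<rho> K < \<infinity>" "cbox a b \<subseteq> U"
    for \<rho> a b
  proof -
    have s: "cbox a b \<in> sets \<rho>" "box a b \<in> sets \<rho>"
      using that(3) box_subset_cbox[of a b] by (auto simp: that(1) sets_restrict_space_iff U)
    moreover have f: "emeasure \<rho> (cbox a b) < \<infinity>" using that(2,3) compact_cbox by blast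
    ultimately show "set_integrable \<rho> (cbox a b) (\<lambda>x. 1 :: complex)"
      by (auto simp: set_integrable_def)
    show "box a b \<in> sets \<rho>" by fact
    show "emeasure \<rho> (box a b) < \<infinity>"
      using f s(1) box_subset_cbox[of a b] by (metis emeasure_mono le_less_trans)
  qed
  have em: "emeasure \<sigma> A = emeasure \<sigma>' A" if A: "A \<in> inner_boxes U" for A
  proof -
    obtain a b where *: "A = box a b" "cbox a b \<subseteq> U" using A by (auto simp: inner_boxes_def)
    note 1 = int[OF sets(1) fin(1) *(2)] and 2 = int[OF sets(2) fin(2) *(2)]
    have "(\<integral>x. indicator (box a b) x *\<^sub>R (1::complex) \<partial>\<sigma>) = (\<integral>x. indicator (box a b) x *\<^sub>R (1::complex) \<partial>\<sigma>')"
      by (rule LIMSEQ_unique[OF set_integral_box_limit[OF sets(1) U *(2) 1(1), unfolded mult_1_right eq[OF *(2)]]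
            set_integral_box_limit[OF sets(2) U *(2) 2(1), unfolded mult_1_right]])
    then have "measure \<sigma> (box a b) = measure \<sigma>' (box a b)"
      using 1 2 by (simp add: sets.Int_space_eq2)
    then show ?thesis using 1(3) 2(3) *(1) by (simp add: emeasure_eq_ennreal_measure less_top)
  qed
  show ?thesis
  proof (rule measure_eqI_generator_eq_countable[OF Int_stable_inner_boxes[of U] _ em _ _ C(2,3,1)])
    show "inner_boxes U \<subseteq> Pow U" using box_subset_cbox by (fastforce simp: inner_boxes_def)
    show "sets \<sigma> = sigma_sets U (inner_boxes U)" "sets \<sigma>' = sigma_sets U (inner_boxes U)"
      using sets sets_restrict_borel_inner_boxes[OF U] by auto
    show "emeasure \<sigma> B \<noteq> \<infinity>" if "B \<in> C" for B
      using that C(2) int(3)[OF sets(1) fin(1)] by (fastforce simp: inner_boxes_def)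
  qed
qed

subsection \<open>Compact subsets of a compact set\<close>

lemma sets_restrict_borel_compacts:
  fixes \<tau> :: "'a::t2_space set"
  assumes "compact \<tau>"
  shows "sets (restrict_space borel \<tau>) = sigma_sets \<tau> {E. compact E \<and> E \<subseteq> \<tau>}"
proof -
  have cl: "closed \<tau>" using assms by (rule compact_imp_closed)
  have "(\<inter>) \<tau> ` Collect closed = {E. compact E \<and> E \<subseteq> \<tau>}"
  proof (intro set_eqI iffI)
    fix E assume "E \<in> (\<inter>) \<tau> ` Collect closed"
    then show "E \<in> {E. compact E \<and> E \<subseteq> \<tau>}" using assms by (auto intro: compact_Int_closed)
  next
    fix E assume "E \<in> {E. compact E \<and> E \<subseteq> \<tau>}"
    then show "E \<in> (\<inter>) \<tau> ` Collect closed" using compact_imp_closed by (intro image_eqI[of _ _ E]) auto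
  qed
  then show ?thesis
    unfolding sets_restrict_space borel_eq_closed
    using sigma_sets_Int[of \<tau> UNIV "Collect closed"] cl by (simp add: sigma_sets.Basic)
qed

text \<open>If the set where \<open>g < 0\<close> had positive measure, inner regularity would give
  a compact subset of positive measure, over which the integral of \<open>g\<close> is negative.
  Compact test sets are used because the leaf cutoffs exist for compact sets of leaves.\<close>

lemma AE_nonneg_if_integral_nonneg_on_compacts:
  fixes g :: "'a::polish_space \<Rightarrow> real"
  assumes \<tau>: "compact \<tau>" and \<mu>: "finite_measure \<mu>" "sets \<mu> = sets (restrict_space borel \<tau>)"
    and int: "integrable \<mu> g"
    and nonneg: "\<And>E. compact E \<Longrightarrow> E \<subseteq> \<tau> \<Longrightarrow> 0 \<le> (\<integral>x. indicator E x *\<^sub>R g x \<partial>\<mu>)"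
  shows "AE x in \<mu>. 0 \<le> g x"
proof -
  interpret finite_measure \<mu> by fact
  have sp: "space \<mu> = \<tau>" using sets_eq_imp_space_eq[OF \<mu>(2)] by (simp add: space_restrict_space)
  have id: "(\<lambda>x. x) \<in> \<mu> \<rightarrow>\<^sub>M borel"
    unfolding measurable_cong_sets[OF \<mu>(2) refl] by (intro measurable_restrict_space1) simp
  have bor: "E \<in> sets \<mu>" if "E \<in> sets borel" "E \<subseteq> \<tau>" for E
    using that \<tau> by (auto simp: \<mu>(2) sets_restrict_space_iff compact_imp_closed)
  \<comment> \<open>\<open>N\<close> is \<mu> carried to the Borel sets of the whole space, the
    setting of \<open>inner_regular\<close>.\<close>
  define N where "N = distr \<mu> borel (\<lambda>x. x)"
  define A where "A = {x \<in> space \<mu>. g x < 0}"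
  have A: "A \<in> sets \<mu>" unfolding A_def using int by measurable
  then have Ab: "A \<in> sets borel"
    using \<tau> by (auto simp: \<mu>(2) sets_restrict_space_iff compact_imp_closed)
  have N: "emeasure N E = emeasure \<mu> E" if "E \<in> sets borel" "E \<subseteq> \<tau>" for E
    unfolding N_def using that sp by (subst emeasure_distr[OF id]) (auto simp: Int_absorb2)
  have null: "emeasure \<mu> K = 0" if K: "compact K" "K \<subseteq> A" for K
  proof -
    have K\<tau>: "K \<subseteq> \<tau>" using K(2) sp by (auto simp: A_def)
    then have Ks: "K \<in> sets \<mu>" using K(1) by (intro bor) (auto simp: compact_imp_closed)
    have intK: "integrable \<mu> (\<lambda>x. indicator K x *\<^sub>R (- g x))"
      using int Ks by (intro integrable_mult_indicator) auto
    have nn: "AE x in \<mu>. 0 \<le> indicator K x *\<^sub>R (- g x)" using K(2) by (intro AE_I2) (auto simp: A_def indicator_def)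
    have "(\<integral>x. indicator K x *\<^sub>R (- g x) \<partial>\<mu>) \<le> 0" using nonneg[OF K(1) K\<tau>] by simp
    moreover have "(\<integral>x. indicator K x *\<^sub>R (- g x) \<partial>\<mu>) \<ge> 0" using nn by (rule integral_nonneg_AE)
    ultimately have "AE x in \<mu>. indicator K x *\<^sub>R (- g x) = 0"
      using integral_nonneg_eq_0_iff_AE[OF intK nn] by simp
    then have "AE x in \<mu>. x \<notin> K" by (rule AE_mp) (use K(2) in \<open>auto simp: A_def indicator_def intro!: AE_I2\<close>)
    then show ?thesis using Ks by (simp add: AE_iff_measurable[of K] K\<tau> sp Int_absorb1 Collect_conj_eq)
  qed
  have "emeasure N A = (SUP K \<in> {K. K \<subseteq> A \<and> compact K}. emeasure N K)"
  proof (rule inner_regular)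
    show "emeasure N (space N) \<noteq> \<infinity>"
      unfolding N_def using emeasure_finite by (simp add: emeasure_distr[OF id])
  qed (use Ab in \<open>auto simp: N_def\<close>)
  also have "\<dots> = 0"
  proof -
    have "emeasure N K = 0" if "K \<subseteq> A" "compact K" for K
      using null[OF that(2,1)] N[of K] that sp by (auto simp: A_def compact_imp_closed)
    then show ?thesis by (auto simp: SUP_eq_iff intro!: antisym SUP_least)
  qed
  finally have "emeasure \<mu> A = 0" using N[OF Ab] sp by (auto simp: A_def)
  then have "AE x in \<mu>. x \<notin> A" using A by (intro AE_not_in) (auto simp: null_sets_def)
  then show ?thesis by (rule AE_mp) (auto simp: A_def)
qed

section \<open>Laminations by graphs\<close>

text \<open>An \<open>e/2\<close> argument: the parameter is moved at fixed \<open>z\<close>,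
  uniformly for \<open>z\<close> near \<open>z0\<close>, and then \<open>z\<close> is moved at the
  single parameter \<open>a0\<close>.\<close>

lemma continuous_on_Times_if_locally_uniform:
  fixes F :: "'a::metric_space \<Rightarrow> 'b::metric_space \<Rightarrow> 'c::metric_space"
  assumes cont: "\<And>a. a \<in> T \<Longrightarrow> continuous_on S (\<lambda>z. F z a)"
    and unif: "\<And>z0 e. z0 \<in> S \<Longrightarrow> e > 0 \<Longrightarrow> \<exists>d>0. \<forall>z\<in>S. dist z z0 < d \<longrightarrow>
      (\<forall>a\<in>T. \<forall>b\<in>T. dist a b < d \<longrightarrow> dist (F z a) (F z b) < e)"
  shows "continuous_on (S \<times> T) (\<lambda>x. F (fst x) (snd x))"
  unfolding continuous_on_iff
proof (intro ballI allI impI)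
  fix x0 and e :: real assume x0: "x0 \<in> S \<times> T" and e: "e > 0"
  obtain z0 a0 where za: "x0 = (z0, a0)" "z0 \<in> S" "a0 \<in> T" using x0 by auto
  obtain d1 where d1: "d1 > 0" "\<And>z a b. z \<in> S \<Longrightarrow> dist z z0 < d1 \<Longrightarrow> a \<in> T \<Longrightarrow> b \<in> T \<Longrightarrow> dist a b < d1 \<Longrightarrow> dist (F z a) (F z b) < e/2"
    using unif[OF za(2), of "e/2"] e by auto
  obtain d2 where d2: "d2 > 0" "\<And>z. z \<in> S \<Longrightarrow> dist z z0 < d2 \<Longrightarrow> dist (F z a0) (F z0 a0) < e/2"
    using cont[OF za(3)] za(2) e unfolding continuous_on_iff by (metis half_gt_zero)
  show "\<exists>d>0. \<forall>x\<in>S \<times> T. dist x x0 < d \<longrightarrow> dist (F (fst x) (snd x)) (F (fst x0) (snd x0)) < e"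
  proof (intro exI[of _ "min d1 d2"] conjI ballI impI)
    fix x assume x: "x \<in> S \<times> T" "dist x x0 < min d1 d2"
    have "dist (fst x) z0 < min d1 d2" "dist (snd x) a0 < min d1 d2"
      using x(2) dist_fst_le[of x x0] dist_snd_le[of x x0] za(1) by auto
    then have "dist (F (fst x) (snd x)) (F (fst x) a0) < e/2" "dist (F (fst x) a0) (F z0 a0) < e/2"
      using x(1) za d1 d2 by auto
    then show "dist (F (fst x) (snd x)) (F (fst x0) (snd x0)) < e"
      using dist_triangle[of "F (fst x) (snd x)" "F z0 a0" "F (fst x) a0"] za(1) by simp
  qed (use d1 d2 in auto)
qed

text \<open>\<open>f\<close> is the pointwise limit of its truncations to the \<open>L n\<close>.
  Meant for functions on the union of the leaves, a countable union of compact sets.\<close>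

lemma borel_measurable_piecewise_continuous:
  fixes f :: "'a::metric_space \<Rightarrow> 'b::real_normed_vector"
  assumes "\<And>n::nat. closed (L n)" "\<And>m n. m \<le> n \<Longrightarrow> L m \<subseteq> L n" "\<And>n. continuous_on (L n) f"
    "\<And>x. x \<notin> (\<Union>n. L n) \<Longrightarrow> f x = 0"
  shows "f \<in> borel_measurable borel"
proof (rule borel_measurable_LIMSEQ_metric)
  show "(\<lambda>x. indicator (L n) x *\<^sub>R f x) \<in> borel_measurable borel" for n
    using assms(1,3) by (intro borel_measurable_continuous_on_indicator) auto
  show "(\<lambda>n. indicator (L n) x *\<^sub>R f x) \<longlonglongrightarrow> f x" for x
  proof (cases "x \<in> (\<Union>n. L n)")
    case True
    then obtain m where "x \<in> L m" by auto
    then have "\<forall>n\<ge>m. f x = indicator (L n) x *\<^sub>R f x" using assms(2) by (auto simp: indicator_def)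
    then have "eventually (\<lambda>n. f x = indicator (L n) x *\<^sub>R f x) sequentially"
      unfolding eventually_sequentially by blast
    then show ?thesis by (rule Lim_transform_eventually[OF tendsto_const])
  next
    case False
    then show ?thesis using assms(4)[OF False] by simp
  qed
qed

definition disk_exhaustion :: "nat \<Rightarrow> complex set" where
  "disk_exhaustion n = cball 0 (1 - inverse (real (Suc n)))"

lemma compact_disk_exhaustion: "compact (disk_exhaustion n)"
  by (simp add: disk_exhaustion_def)

lemma disk_exhaustion_mono: "m \<le> n \<Longrightarrow> disk_exhaustion m \<subseteq> disk_exhaustion n"
proof -
  assume "m \<le> n"
  then have "inverse (real (Suc n)) \<le> inverse (real (Suc m))" by (intro le_imp_inverse_le) auto
  then show ?thesis unfolding disk_exhaustion_def by (intro subset_cball) linarith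
qed

lemma UN_disk_exhaustion: "(\<Union>n. disk_exhaustion n) = unit_disk"
proof (intro set_eqI iffI)
  fix z assume "z \<in> (\<Union>n. disk_exhaustion n)"
  then obtain n where "norm z \<le> 1 - inverse (real (Suc n))" by (auto simp: disk_exhaustion_def)
  moreover have "inverse (real (Suc n)) > 0" by simp
  ultimately show "z \<in> unit_disk" unfolding mem_ball_0 by linarith
next
  fix z assume "z \<in> unit_disk"
  then have "0 < 1 - norm z" by simp
  then obtain n where "inverse (real (Suc n)) < 1 - norm z" using reals_Archimedean by blast
  then have "z \<in> disk_exhaustion n" unfolding disk_exhaustion_def mem_cball_0 by linarith
  then show "z \<in> (\<Union>n. disk_exhaustion n)" by blast
qed

lemma disk_exhaustion_subset: "disk_exhaustion n \<subseteq> unit_disk"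
  using UN_disk_exhaustion by blast

section \<open>Distance between leaves\<close>

locale disk_lamination =
  fixes \<tau> :: "complex set" and \<phi> :: "complex \<Rightarrow> complex \<Rightarrow> complex"
  assumes lam: "lamination \<tau> \<phi>"
begin

lemma holomorphic_leaf: "a \<in> \<tau> \<Longrightarrow> \<phi> a holomorphic_on unit_disk"
  and leaf_at_0: "a \<in> \<tau> \<Longrightarrow> \<phi> a 0 = a"
  using lam by (auto simp: lamination_def)

definition height :: real where
  "height = (SOME s. 0 \<le> s \<and> s < 1 \<and> (\<forall>a\<in>\<tau>. \<forall>z\<in>unit_disk. norm (\<phi> a z) \<le> s))"

lemma height: "0 \<le> height" "height < 1" "\<And>a z. a \<in> \<tau> \<Longrightarrow> z \<in> unit_disk \<Longrightarrow> norm (\<phi> a z) \<le> height"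
proof -
  obtain \<eta> where "\<eta> > 0" "\<forall>a\<in>\<tau>. \<forall>z\<in>unit_disk. norm (\<phi> a z) \<le> 1 - \<eta>"
    using lam by (auto simp: lamination_def)
  \<comment> \<open>The maximum with 0 covers empty \<tau>, where \<open>1 - \<eta>\<close> may be
    negative.\<close>
  then have "0 \<le> max 0 (1 - \<eta>) \<and> max 0 (1 - \<eta>) < 1 \<and> (\<forall>a\<in>\<tau>. \<forall>z\<in>unit_disk. norm (\<phi> a z) \<le> max 0 (1 - \<eta>))"
    by (simp add: le_max_iff_disj)
  then have "0 \<le> height \<and> height < 1 \<and> (\<forall>a\<in>\<tau>. \<forall>z\<in>unit_disk. norm (\<phi> a z) \<le> height)"
    unfolding height_def by (rule someI)
  then show "0 \<le> height" "height < 1" "\<And>a z. a \<in> \<tau> \<Longrightarrow> z \<in> unit_disk \<Longrightarrow> norm (\<phi> a z) \<le> height"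
    by auto
qed

text \<open>\<tau> is closed in the open disk only, but \<open>\<phi> a 0 = a\<close> and the
  uniform bound on leaves keep it inside \<open>cball 0 height\<close>, away from the
  boundary.\<close>

lemma compact_\<tau>: "compact \<tau>"
proof -
  obtain C where C: "closed C" "\<tau> = unit_disk \<inter> C"
    using lam by (auto simp: lamination_def closedin_closed)
  have "norm a \<le> height" if "a \<in> \<tau>" for a
    using height(3)[OF that, of 0] leaf_at_0[OF that] by simp
  then have "\<tau> = cball 0 height \<inter> C" using C(2) height(2) by auto
  then show ?thesis using compact_Int_closed[OF compact_cball C(1), of 0 height] by simp
qed

lemma leaf_eq_iff:
  assumes "a \<in> \<tau>" "b \<in> \<tau>" "z \<in> unit_disk"
  shows "\<phi> a z = \<phi> b z \<longleftrightarrow> a = b"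
proof
  assume eq: "\<phi> a z = \<phi> b z"
  show "a = b"
  proof (rule ccontr)
    assume "a \<noteq> b"
    then have "graph (\<phi> a) \<inter> graph (\<phi> b) = {}"
      using lam assms by (auto simp: lamination_def disjoint_family_on_def)
    moreover have "(z, \<phi> a z) \<in> graph (\<phi> a)" "(z, \<phi> b z) \<in> graph (\<phi> b)"
      using assms(3) by (auto simp: graph_def)
    ultimately show False using eq by auto
  qed
qed simp

text \<open>The hypotheses of the half-plane estimates: disjointness of the leaves gives
  nonvanishing, \<open>height < 1\<close> gives the bound 2.\<close>

lemma leaf_difference:
  assumes "a \<in> \<tau>" "b \<in> \<tau>" "a \<noteq> b"
  shows "(\<lambda>z. \<phi> a z - \<phi> b z) holomorphic_on unit_disk"
    and "z \<in> unit_disk \<Longrightarrow> \<phi> a z - \<phi> b z \<noteq> 0"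
    and "z \<in> unit_disk \<Longrightarrow> norm (\<phi> a z - \<phi> b z) < 2"
proof -
  show "(\<lambda>z. \<phi> a z - \<phi> b z) holomorphic_on unit_disk"
    using assms by (intro holomorphic_intros holomorphic_leaf)
  show "\<phi> a z - \<phi> b z \<noteq> 0" if "z \<in> unit_disk" using leaf_eq_iff[OF assms(1,2) that] assms(3) by simp
  show "norm (\<phi> a z - \<phi> b z) < 2" if "z \<in> unit_disk"
    using norm_triangle_ineq4[of "\<phi> a z" "\<phi> b z"] height(2) height(3)[OF assms(1) that] height(3)[OF assms(2) that]
    by linarith
qed

text \<open>Harnack based at 0, where the difference of the leaves is \<open>a - b\<close>.
  Exponentiated, half the distance at \<open>z\<close> and half the distance at 0 bound each other
  up to powers, so holonomy and its inverse are Hoelder continuous.\<close>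

lemma leaf_distance:
  assumes "a \<in> \<tau>" "b \<in> \<tau>" "a \<noteq> b" "norm z \<le> r" "r < 1"
  shows "0 < ln (2 / norm (a - b))"
    and "exp (- (2 / (1 - r))) * ln (2 / norm (a - b)) \<le> ln (2 / norm (\<phi> a z - \<phi> b z))"
    and "ln (2 / norm (\<phi> a z - \<phi> b z)) \<le> exp (2 / (1 - r)) * ln (2 / norm (a - b))"
  using Harnack_nonvanishing[OF leaf_difference[OF assms(1-3)] assms(4,5)]
    leaf_at_0[OF assms(1)] leaf_at_0[OF assms(2)] by simp_all

lemma leaf_distance_uniform:
  fixes r e :: real
  assumes "r < 1" "e > 0"
  obtains d where "d > 0"
    "\<And>a b z :: complex. a \<in> \<tau> \<Longrightarrow> b \<in> \<tau> \<Longrightarrow> norm z \<le> r \<Longrightarrow> dist a b < d \<Longrightarrow> norm (\<phi> a z - \<phi> b z) < e"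
proof -
  define K where "K = exp (- (2 / (1 - r)))"
  \<comment> \<open>Solves \<open>K * ln (2 / d) = ln (2 / e)\<close>, so that Harnack turns
    distance below \<open>d\<close> at 0 into distance below \<open>e\<close> at
    \<open>z\<close>.\<close>
  define d where "d = 2 * exp (- (ln (2 / e) / K))"
  have K: "K > 0" by (simp add: K_def)
  show thesis
  proof
    show "d > 0" by (simp add: d_def)
    fix a b z :: complex assume *: "a \<in> \<tau>" "b \<in> \<tau>" "norm z \<le> r" "dist a b < d"
    show "norm (\<phi> a z - \<phi> b z) < e"
    proof (cases "a = b")
      case False
      have z: "z \<in> unit_disk" using * assms by simp
      have ab: "norm (a - b) > 0" using False by simp
      have "norm (a - b) < d" using *(4) by (simp add: dist_norm)
      then have "ln (norm (a - b)) < ln d" using ab by (subst ln_less_cancel_iff) (auto simp: d_def)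
      also have "ln d = ln 2 - ln (2 / e) / K" by (simp add: d_def ln_mult)
      finally have "ln (2 / e) / K < ln (2 / norm (a - b))" using ab by (simp add: ln_div)
      then have "ln (2 / e) < K * ln (2 / norm (a - b))" using K by (simp add: divide_simps mult.commute)
      also have "\<dots> \<le> ln (2 / norm (\<phi> a z - \<phi> b z))"
        unfolding K_def by (rule leaf_distance(2)[OF *(1,2) False *(3) assms(1)])
      finally have "2 / e < 2 / norm (\<phi> a z - \<phi> b z)"
        using assms(2) leaf_difference(2)[OF *(1,2) False z] by (subst (asm) ln_less_cancel_iff) auto
      then show ?thesis using assms(2) leaf_difference(2)[OF *(1,2) False z] by (simp add: divide_simps split: if_splits)
    qed (use assms in auto)
  qed
qed

lemma near_point_in_disk:
  fixes z0 :: complex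
  assumes "z0 \<in> unit_disk"
  obtains \<rho> where "\<rho> > 0" "norm z0 + 2 * \<rho> < 1"
  using assms that[of "(1 - norm z0) / 4"] by (auto simp: field_simps)

lemma continuous_on_leaves: "continuous_on (unit_disk \<times> \<tau>) (\<lambda>x. \<phi> (snd x) (fst x))"
proof (rule continuous_on_Times_if_locally_uniform)
  show "continuous_on unit_disk (\<phi> a)" if "a \<in> \<tau>" for a
    by (rule holomorphic_on_imp_continuous_on[OF holomorphic_leaf[OF that]])
  fix z0 and e :: real assume z0: "z0 \<in> unit_disk" and e: "e > 0"
  obtain \<rho> where \<rho>: "\<rho> > 0" "norm z0 + 2 * \<rho> < 1" by (rule near_point_in_disk[OF z0])
  obtain d where d: "d > 0" "\<And>a b z. a \<in> \<tau> \<Longrightarrow> b \<in> \<tau> \<Longrightarrow> norm z \<le> norm z0 + 2 * \<rho> \<Longrightarrow> dist a b < d \<Longrightarrow> norm (\<phi> a z - \<phi> b z) < e"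
    using leaf_distance_uniform[OF \<rho>(2) e] by blast
  show "\<exists>d>0. \<forall>z\<in>unit_disk. dist z z0 < d \<longrightarrow> (\<forall>a\<in>\<tau>. \<forall>b\<in>\<tau>. dist a b < d \<longrightarrow> dist (\<phi> a z) (\<phi> b z) < e)"
  proof (intro exI[of _ "min d \<rho>"] conjI ballI impI)
    fix z a b assume *: "dist z z0 < min d \<rho>" "a \<in> \<tau>" "b \<in> \<tau>" "dist a b < min d \<rho>"
    have "norm z \<le> norm z0 + 2 * \<rho>"
      using *(1) \<rho>(1) norm_triangle_ineq2[of z z0] by (simp add: dist_norm)
    then show "dist (\<phi> a z) (\<phi> b z) < e" using d(2)[of a b z] * by (simp add: dist_norm)
  qed (use d \<rho> in auto)
qed

text \<open>Cauchy's inequality on the disk of radius \<open>\<rho>\<close> about \<open>z\<close>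
  converts closeness of leaves into closeness of slopes; \<open>e * \<rho> / 2\<close> is what
  yields \<open>e / 2\<close>. The room \<open>2 * \<rho>\<close> holds both the move from
  \<open>z0\<close> to \<open>z\<close> and this disk.\<close>

lemma continuous_on_deriv_leaves: "continuous_on (unit_disk \<times> \<tau>) (\<lambda>x. deriv (\<phi> (snd x)) (fst x))"
proof (rule continuous_on_Times_if_locally_uniform)
  show "continuous_on unit_disk (deriv (\<phi> a))" if "a \<in> \<tau>" for a
    by (intro holomorphic_on_imp_continuous_on holomorphic_deriv holomorphic_leaf[OF that] open_ball)
  fix z0 and e :: real assume z0: "z0 \<in> unit_disk" and e: "e > 0"
  obtain \<rho> where \<rho>: "\<rho> > 0" "norm z0 + 2 * \<rho> < 1" by (rule near_point_in_disk[OF z0])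
  obtain d where d: "d > 0" "\<And>a b z. a \<in> \<tau> \<Longrightarrow> b \<in> \<tau> \<Longrightarrow> norm z \<le> norm z0 + 2 * \<rho> \<Longrightarrow> dist a b < d \<Longrightarrow> norm (\<phi> a z - \<phi> b z) < e * \<rho> / 2"
    using leaf_distance_uniform[OF \<rho>(2), of "e * \<rho> / 2"] e \<rho>(1) by auto
  show "\<exists>d>0. \<forall>z\<in>unit_disk. dist z z0 < d \<longrightarrow> (\<forall>a\<in>\<tau>. \<forall>b\<in>\<tau>. dist a b < d \<longrightarrow> dist (deriv (\<phi> a) z) (deriv (\<phi> b) z) < e)"
  proof (intro exI[of _ "min d \<rho>"] conjI ballI impI)
    fix z a b assume *: "z \<in> unit_disk" "dist z z0 < min d \<rho>" "a \<in> \<tau>" "b \<in> \<tau>" "dist a b < min d \<rho>"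
    have near: "norm w \<le> norm z0 + 2 * \<rho>" if "norm (w - z) \<le> \<rho>" for w
    proof -
      have "norm w \<le> norm z0 + norm (z - z0) + norm (w - z)"
        using norm_triangle_ineq[of z0 "z - z0"] norm_triangle_ineq[of z "w - z"] by simp
      then show ?thesis using *(2) that by (simp add: dist_norm)
    qed
    have sub: "cball z \<rho> \<subseteq> unit_disk"
    proof
      fix w assume "w \<in> cball z \<rho>"
      then have "norm (w - z) \<le> \<rho>" by (simp add: dist_norm norm_minus_commute)
      then show "w \<in> unit_disk" using near[of w] \<rho> by simp
    qed
    let ?g = "\<lambda>z. \<phi> a z - \<phi> b z"
    have hol: "?g holomorphic_on unit_disk"
      using * by (intro holomorphic_intros holomorphic_leaf)
    have "norm ((deriv ^^ 1) ?g z) \<le> fact 1 * (e * \<rho> / 2) / \<rho> ^ 1"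
    proof (rule Cauchy_inequality)
      show "?g holomorphic_on ball z \<rho>"
        by (rule holomorphic_on_subset[OF hol]) (use sub ball_subset_cball in blast)
      show "continuous_on (cball z \<rho>) ?g"
        by (rule continuous_on_subset[OF holomorphic_on_imp_continuous_on[OF hol] sub])
      show "norm (?g w) \<le> e * \<rho> / 2" if "norm (z - w) = \<rho>" for w
        using d(2)[of a b w] near[of w] that * by (simp add: norm_minus_commute)
    qed fact
    then have "norm (deriv ?g z) \<le> e / 2" using \<rho> by simp
    moreover have "deriv ?g z = deriv (\<phi> a) z - deriv (\<phi> b) z"
      using * by (intro deriv_diff holomorphic_on_imp_differentiable_at[OF holomorphic_leaf open_ball]) auto
    ultimately show "dist (deriv (\<phi> a) z) (deriv (\<phi> b) z) < e" using e by (simp add: dist_norm)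
  qed (use d \<rho> in auto)
qed

section \<open>The parametrization of the leaves and their slopes\<close>

definition leaf_map :: "complex \<times> complex \<Rightarrow> C2" where
  "leaf_map x = (fst x, \<phi> (snd x) (fst x))"

definition slope :: "complex \<times> complex \<Rightarrow> complex" where
  "slope x = deriv (\<phi> (snd x)) (fst x)"

lemma continuous_on_leaf_map: "continuous_on (unit_disk \<times> \<tau>) leaf_map"
  unfolding leaf_map_def by (intro continuous_intros continuous_on_leaves)

lemma continuous_on_slope: "continuous_on (unit_disk \<times> \<tau>) slope"
  unfolding slope_def by (rule continuous_on_deriv_leaves)

lemma inj_on_leaf_map: "inj_on leaf_map (unit_disk \<times> \<tau>)"
  by (auto simp: inj_on_def leaf_map_def leaf_eq_iff)

lemma leaf_map_bounds: "x \<in> unit_disk \<times> \<tau> \<Longrightarrow> fst (leaf_map x) \<in> unit_disk \<and> norm (snd (leaf_map x)) \<le> height"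
  using height(3) by (auto simp: leaf_map_def)

lemma leaf_map_in_bidisk: "x \<in> unit_disk \<times> \<tau> \<Longrightarrow> leaf_map x \<in> bidisk"
  using leaf_map_bounds[of x] height(2) by (auto simp: mem_Times_iff)

text \<open>The slope as a function of the point of C^2, the form that a 2-vector density requires.
  The value 0 off the leaves is a default.\<close>

definition leaf_slope :: "C2 \<Rightarrow> complex" where
  "leaf_slope p = (if p \<in> leaf_map ` (unit_disk \<times> \<tau>) then slope (inv_into (unit_disk \<times> \<tau>) leaf_map p) else 0)"

lemma leaf_slope_leaf_map: "x \<in> unit_disk \<times> \<tau> \<Longrightarrow> leaf_slope (leaf_map x) = slope x"
  by (simp add: leaf_slope_def inv_into_f_f[OF inj_on_leaf_map])

definition leaf_chunk :: "nat \<Rightarrow> C2 set" where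
  "leaf_chunk n = leaf_map ` (disk_exhaustion n \<times> \<tau>)"

lemma exhaustion_times_subset: "disk_exhaustion n \<times> \<tau> \<subseteq> unit_disk \<times> \<tau>"
  using disk_exhaustion_subset by auto

lemma compact_leaf_chunk: "compact (leaf_chunk n)"
  unfolding leaf_chunk_def
  by (intro compact_continuous_image continuous_on_subset[OF continuous_on_leaf_map] compact_Times
      compact_disk_exhaustion compact_\<tau> exhaustion_times_subset)

lemma leaf_chunk_mono: "m \<le> n \<Longrightarrow> leaf_chunk m \<subseteq> leaf_chunk n"
  unfolding leaf_chunk_def using disk_exhaustion_mono by blast

lemma UN_leaf_chunk: "(\<Union>n. leaf_chunk n) = leaf_map ` (unit_disk \<times> \<tau>)"
proof -
  have "(\<Union>n. leaf_chunk n) = leaf_map ` ((\<Union>n. disk_exhaustion n) \<times> \<tau>)"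
    unfolding leaf_chunk_def by auto
  then show ?thesis by (simp add: UN_disk_exhaustion)
qed

text \<open>A continuous injection on a compact set has a continuous inverse. The union of all
  leaves is not compact, so continuity is stated on each chunk, and measurability follows by
  exhaustion.\<close>

lemma continuous_on_leaf_slope: "continuous_on (leaf_chunk n) leaf_slope"
proof -
  let ?K = "disk_exhaustion n \<times> \<tau>"
  have K: "compact ?K" by (intro compact_Times compact_disk_exhaustion compact_\<tau>)
  have "continuous_on (leaf_map ` ?K) (inv_into (unit_disk \<times> \<tau>) leaf_map)"
    by (rule continuous_on_inv[OF continuous_on_subset[OF continuous_on_leaf_map exhaustion_times_subset] K])
       (use exhaustion_times_subset in \<open>auto intro!: inv_into_f_f[OF inj_on_leaf_map]\<close>)
  moreover have "inv_into (unit_disk \<times> \<tau>) leaf_map ` (leaf_map ` ?K) \<subseteq> unit_disk \<times> \<tau>"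
    using exhaustion_times_subset inv_into_f_f[OF inj_on_leaf_map] by (force simp: image_iff)
  ultimately have "continuous_on (leaf_map ` ?K) (\<lambda>p. slope (inv_into (unit_disk \<times> \<tau>) leaf_map p))"
    by (intro continuous_on_compose2[OF continuous_on_slope])
  then show ?thesis unfolding leaf_chunk_def
    by (rule continuous_on_eq) (use exhaustion_times_subset in \<open>auto simp: leaf_slope_def\<close>)
qed

lemma borel_measurable_comp_leaf_slope:
  fixes h :: "complex \<Rightarrow> complex"
  assumes "continuous_on UNIV h"
  shows "(\<lambda>p. if p \<in> leaf_map ` (unit_disk \<times> \<tau>) then h (leaf_slope p) else 0) \<in> borel_measurable borel"
proof (rule borel_measurable_piecewise_continuous[where L = leaf_chunk])
  show "continuous_on (leaf_chunk n) (\<lambda>p. if p \<in> leaf_map ` (unit_disk \<times> \<tau>) then h (leaf_slope p) else 0)" for n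
  proof (rule continuous_on_eq)
    show "continuous_on (leaf_chunk n) (\<lambda>p. h (leaf_slope p))"
      by (rule continuous_on_compose2[OF assms continuous_on_leaf_slope]) auto
  qed (use UN_leaf_chunk in auto)
qed (use compact_leaf_chunk compact_imp_closed leaf_chunk_mono UN_leaf_chunk in auto)

end

subsection \<open>Almost leafwise constant cutoff functions\<close>

text \<open>The functions \<open>q\<^sub>b = ln (16 / (\<bar>w - \<phi>\<^sub>b z\<bar>\<^sup>2 + d))\<close> satisfy \<open>\<bar>dq\<^sub>b\<bar> \<le> C q\<^sub>b\<close> along the leaves,
  with \<open>C\<close> independent of \<open>b\<close> and of the regularization \<open>d\<close>. So \<open>ln q\<^sub>b\<close> is uniformly Lipschitz
  on leaves, although it tends to infinity at the leaf of \<open>b\<close> as \<open>d \<longrightarrow> 0\<close>. Scaling the maximum over a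
  fine net of a compact set \<open>E\<close> (smoothed to an \<open>l\<^sup>p\<close> norm) by \<open>1 / N\<close> separates \<open>E\<close> from its
  complement by a function of leafwise derivative \<open>O(1 / N)\<close>.\<close>

lemma ln_ge_one: "(1::real) \<le> ln (16 / 5)"
proof -
  have "exp 1 \<le> (16 / 5 :: real)" using exp_le by simp
  then show ?thesis by (subst ln_ge_iff) auto
qed

text \<open>The derivative \<open>ln (16 / x) - 1\<close> is nonnegative up to 5. The constants fit
  together: a squared distance at most 4 and a regularization at most 1 give arguments at most 5,
  and 16 is large enough for \<open>ln (16 / 5) \<ge> 1\<close>.\<close>

lemma mult_ln_mono:
  fixes x y :: real
  assumes "0 < x" "x \<le> y" "y \<le> 5"
  shows "x * ln (16 / x) \<le> y * ln (16 / y)"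
proof -
  have y: "ln (16 / y) \<ge> 1"
  proof -
    have "ln (16 / 5) \<le> ln (16 / y)" using assms by (subst ln_le_cancel_iff) (auto simp: divide_simps)
    then show ?thesis using ln_ge_one by linarith
  qed
  have "ln (16 / x) = ln (16 / y) + ln (y / x)" using assms by (simp add: ln_div)
  also have "\<dots> \<le> ln (16 / y) + (y / x - 1)" using assms by (intro add_left_mono ln_le_minus_one) auto
  finally have "x * ln (16 / x) \<le> x * (ln (16 / y) + (y / x - 1))" using assms by (intro mult_left_mono) auto
  also have "\<dots> = x * ln (16 / y) + (y - x) * 1" using assms by (simp add: field_simps)
  also have "\<dots> \<le> x * ln (16 / y) + (y - x) * ln (16 / y)"
    using assms y by (intro add_left_mono mult_left_mono) auto
  finally show ?thesis by (simp add: algebra_simps)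
qed

text \<open>Here \<open>h\<close> is the derivative of \<open>g\<close> along a leaf. The assumption
  on \<open>h\<close> is the bound without regularization; replacing
  \<open>x = g \<bullet> g\<close> by \<open>x + d\<close> on the right is allowed because
  \<open>x * ln (16 / x)\<close> is increasing, so \<open>d\<close> does not enter the
  constant.\<close>

lemma regularized_log_derivative_bound:
  fixes g h :: complex
  assumes "0 < norm g" "norm g < 2" "0 < d" "d \<le> 1" and h: "norm h \<le> k * (norm g * ln (2 / norm g))" and k: "0 \<le> k"
  shows "\<bar>2 * (g \<bullet> h) / (g \<bullet> g + d)\<bar> \<le> k * (ln 16 - ln (g \<bullet> g + d))"
proof -
  define x where "x = g \<bullet> g"
  have xg: "x = (norm g)\<^sup>2" by (simp add: x_def power2_norm_eq_inner)
  have x: "0 < x" "x < 4" using assms(1,2) power_strict_mono[of "norm g" 2 2] by (auto simp: xg)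
  have ln4: "2 * ln (2 / norm g) = ln (4 / x)"
  proof -
    have "4 / x = (2 / norm g)\<^sup>2" by (simp add: xg power_divide)
    then show ?thesis using assms(1) ln_realpow[of "2 / norm g" 2] by simp
  qed
  have "\<bar>2 * (g \<bullet> h)\<bar> \<le> 2 * (norm g * norm h)" using Cauchy_Schwarz_ineq2[of g h] by (simp add: abs_mult)
  also have "\<dots> \<le> 2 * (norm g * (k * (norm g * ln (2 / norm g))))"
    using h by (intro mult_left_mono) auto
  also have "\<dots> = k * (x * (2 * ln (2 / norm g)))" by (simp add: xg power2_eq_square algebra_simps)
  also have "\<dots> = k * (x * ln (4 / x))" by (simp only: ln4)
  also have "\<dots> \<le> k * (x * ln (16 / x))"
    using x k by (intro mult_left_mono) (auto simp: divide_simps)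
  also have "\<dots> \<le> k * ((x + d) * ln (16 / (x + d)))"
    using x k assms(3,4) by (intro mult_left_mono mult_ln_mono) auto
  finally have "\<bar>2 * (g \<bullet> h)\<bar> / (x + d) \<le> k * ln (16 / (x + d))"
    using x assms(3) by (simp add: pos_divide_le_eq mult.assoc mult.commute[of "ln _"])
  moreover have "\<bar>2 * (g \<bullet> h) / (g \<bullet> g + d)\<bar> = \<bar>2 * (g \<bullet> h)\<bar> / (x + d)"
    using x assms(3) by (simp add: abs_divide x_def)
  moreover have "ln (16 / (x + d)) = ln 16 - ln (x + d)" using x assms(3) by (simp add: ln_div)
  ultimately show ?thesis by (simp only: x_def)
qed

text \<open>With \<open>s\<close> the sum of the \<open>J\<close>-th powers of \<open>J\<close>
  numbers, \<open>ln s / J\<close> is the logarithm \<open>y\<close> of their l^J norm, a smooth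
  substitute for the maximum. The outer \<open>exp (- exp (N - y / N))\<close> is a smooth step: for
  large \<open>N\<close> close to 1 when \<open>y \<ge> 2 * N\<^sup>2\<close> and close to 0 when
  \<open>y\<close> stays bounded.\<close>

definition smooth_separator :: "real \<Rightarrow> nat \<Rightarrow> real \<Rightarrow> real" where
  "smooth_separator N J s = exp (- exp (N - ln s / (real J * N)))"

lemma smooth_separator_bounds: "0 \<le> smooth_separator N J s" "smooth_separator N J s \<le> 1"
  by (auto simp: smooth_separator_def)

text \<open>The logarithm of the l^J norm has as derivative a weighted mean of the quotients of
  \<open>q'\<close> by \<open>q\<close>, hence at most \<open>C\<close> whatever the size of
  \<open>B\<close>. The division by \<open>N\<close> gives \<open>C / N\<close>, and the outer
  function contributes the factor \<open>y * exp (- y)\<close>, at most 1.\<close>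

lemma smooth_separator_derivative_bound:
  fixes q q' :: "'b \<Rightarrow> real \<Rightarrow> real"
  assumes B: "finite B" "B \<noteq> {}" and N: "N > 0" and C: "0 \<le> C"
    and q: "\<And>b. b \<in> B \<Longrightarrow> (q b has_real_derivative q' b t) (at t)" "\<And>b. b \<in> B \<Longrightarrow> 0 < q b t"
    and q': "\<And>b. b \<in> B \<Longrightarrow> \<bar>q' b t\<bar> \<le> C * q b t"
  obtains D where "((\<lambda>s. smooth_separator N (card B) (\<Sum>b\<in>B. q b s ^ card B)) has_real_derivative D) (at t)"
    "\<bar>D\<bar> \<le> C / N"
proof -
  define J where "J = card B"
  have J: "J > 0" using B by (simp add: J_def card_gt_0_iff)
  define S S' where "S = (\<lambda>s. \<Sum>b\<in>B. q b s ^ J)" and "S' = (\<Sum>b\<in>B. real J * (q' b t * q b t ^ (J - 1)))"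
  have S: "S t > 0" unfolding S_def using B q(2) by (intro sum_pos) auto
  have dS: "(S has_real_derivative S') (at t)"
    unfolding S_def S'_def
    by (rule DERIV_sum) (use q(1) DERIV_power[OF q(1), of _ J] in \<open>auto simp: mult.assoc\<close>)
  have "\<bar>S'\<bar> \<le> (\<Sum>b\<in>B. \<bar>real J * (q' b t * q b t ^ (J - 1))\<bar>)" unfolding S'_def by (rule sum_abs)
  also have "\<dots> \<le> (\<Sum>b\<in>B. real J * (C * q b t ^ J))"
  proof (rule sum_mono)
    fix b assume b: "b \<in> B"
    have "\<bar>q' b t\<bar> * q b t ^ (J - 1) \<le> (C * q b t) * q b t ^ (J - 1)"
      using q'[OF b] q(2)[OF b] by (intro mult_right_mono) auto
    also have "\<dots> = C * q b t ^ J" using J by (cases J) auto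
    finally show "\<bar>real J * (q' b t * q b t ^ (J - 1))\<bar> \<le> real J * (C * q b t ^ J)"
      using q(2)[OF b] by (simp add: abs_mult mult_left_mono)
  qed
  also have "\<dots> = real J * C * S t" by (simp add: S_def sum_distrib_left mult.assoc)
  finally have S'bound: "\<bar>S'\<bar> \<le> real J * C * S t" .
  define y where "y = exp (N - ln (S t) / (real J * N))"
  define D where "D = exp (- y) * (y * (S' / S t / (real J * N)))"
  have "((\<lambda>s. ln (S s)) has_real_derivative S' / S t) (at t)"
    using DERIV_chain2[OF DERIV_ln_divide[OF S] dS] by simp
  then have "((\<lambda>s. smooth_separator N J (S s)) has_real_derivative D) (at t)"
    unfolding smooth_separator_def D_def y_def using J N S dS
    by (auto intro!: derivative_eq_intros)
  moreover have "\<bar>D\<bar> \<le> C / N"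
  proof -
    have y: "y > 0" by (simp add: y_def)
    have ye: "y * exp (- y) \<le> 1"
    proof -
      have "y \<le> exp y" using exp_ge_add_one_self[of y] by linarith
      then have "y * exp (- y) \<le> exp y * exp (- y)" by (intro mult_right_mono) auto
      then show ?thesis by (simp add: exp_minus)
    qed
    have "\<bar>D\<bar> = (y * exp (- y)) * (\<bar>S'\<bar> / (S t * (real J * N)))"
      unfolding D_def using y S J N by (simp add: abs_mult abs_divide)
    also have "\<dots> \<le> 1 * ((real J * C * S t) / (S t * (real J * N)))"
      using y ye S'bound S J N by (intro mult_mono divide_right_mono) auto
    also have "\<dots> = C / N" using S J by simp
    finally show ?thesis .
  qed
  ultimately show thesis using that unfolding S_def J_def by blast
qed

text \<open>One large summand suffices. The threshold \<open>exp (2 * N\<^sup>2)\<close> becomes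
  \<open>2 * N\<close> once its logarithm is divided by \<open>N\<close>, which makes the inner
  exponent at most \<open>- N\<close>.\<close>

lemma smooth_separator_lower:
  fixes q :: "'b \<Rightarrow> real"
  assumes B: "finite B" "b \<in> B" and N: "N > 0" and q: "\<And>b. b \<in> B \<Longrightarrow> 0 < q b" and b: "exp (2 * N\<^sup>2) \<le> q b"
  shows "exp (- exp (- N)) \<le> smooth_separator N (card B) (\<Sum>b\<in>B. q b ^ card B)"
proof -
  let ?J = "card B" let ?S = "\<Sum>b\<in>B. q b ^ card B"
  have J: "?J > 0" using B by (auto simp: card_gt_0_iff)
  have "exp (2 * N\<^sup>2) ^ ?J \<le> q b ^ ?J" using b by (intro power_mono) auto
  also have "\<dots> \<le> ?S" using B q by (intro member_le_sum) (auto intro: less_imp_le)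
  finally have "ln (exp (2 * N\<^sup>2) ^ ?J) \<le> ln ?S" by (intro ln_mono) auto
  then have "real ?J * (2 * N\<^sup>2) \<le> ln ?S" by (simp add: ln_realpow)
  then have "2 * N \<le> ln ?S / (real ?J * N)"
    using J N by (simp add: pos_le_divide_eq power2_eq_square mult_ac)
  then show ?thesis by (simp add: smooth_separator_def)
qed

text \<open>As the exponent equals the number \<open>J\<close> of summands, the sum is at most
  \<open>J * Q ^ J\<close>, and \<open>ln J \<le> J\<close> reduces the price of a net of any size
  to the additive constant 1.\<close>

lemma smooth_separator_upper:
  fixes q :: "'b \<Rightarrow> real"
  assumes B: "finite B" "B \<noteq> {}" and N: "N \<ge> 1" and Q: "Q \<ge> 1"
    and q: "\<And>b. b \<in> B \<Longrightarrow> 0 < q b" "\<And>b. b \<in> B \<Longrightarrow> q b \<le> Q"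
  shows "smooth_separator N (card B) (\<Sum>b\<in>B. q b ^ card B) \<le> exp (- exp (N - (1 + ln Q)))"
proof -
  let ?J = "card B" let ?S = "\<Sum>b\<in>B. q b ^ card B"
  have J: "?J > 0" using B by (auto simp: card_gt_0_iff)
  have S: "?S > 0" using B q by (intro sum_pos) auto
  have "?S \<le> (\<Sum>b\<in>B. Q ^ ?J)" using q by (intro sum_mono power_mono) (auto intro: less_imp_le)
  also have "\<dots> = real ?J * Q ^ ?J" by simp
  finally have "ln ?S \<le> ln (real ?J * Q ^ ?J)" using S by (intro ln_mono)
  also have "\<dots> = ln (real ?J) + real ?J * ln Q" using J Q by (simp add: ln_mult ln_realpow)
  also have "\<dots> \<le> real ?J * (1 + ln Q)"
    using J ln_le_minus_one[of "real ?J"] by (simp add: algebra_simps)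
  finally have "ln ?S / (real ?J * N) \<le> real ?J * (1 + ln Q) / (real ?J * N)"
    using J N by (intro divide_right_mono) auto
  also have "\<dots> = (1 + ln Q) / N" using J by simp
  also have "\<dots> \<le> (1 + ln Q) / 1" using N Q by (intro divide_left_mono) auto
  finally show ?thesis by (simp add: smooth_separator_def)
qed

section \<open>Separators built from finitely many leaves\<close>

context disk_lamination
begin

definition leaf_log :: "complex \<Rightarrow> real \<Rightarrow> C2 \<Rightarrow> real" where
  "leaf_log b d p = ln 16 - ln ((snd p - \<phi> b (fst p)) \<bullet> (snd p - \<phi> b (fst p)) + d)"

lemma leaf_log_ge_1:
  assumes "b \<in> \<tau>" "p \<in> bidisk" "0 < d" "d \<le> 1"
  shows "1 \<le> leaf_log b d p"
proof -
  have "norm (snd p - \<phi> b (fst p)) \<le> norm (snd p) + norm (\<phi> b (fst p))" by (rule norm_triangle_ineq4)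
  also have "\<dots> \<le> 2" using assms(2) height(2) height(3)[OF assms(1), of "fst p"] by (auto simp: mem_Times_iff)
  finally have "(norm (snd p - \<phi> b (fst p)))\<^sup>2 \<le> 2\<^sup>2" by (intro power_mono) auto
  then have *: "(snd p - \<phi> b (fst p)) \<bullet> (snd p - \<phi> b (fst p)) + d \<le> 5"
    using assms(4) by (simp add: power2_norm_eq_inner)
  moreover have "0 < (snd p - \<phi> b (fst p)) \<bullet> (snd p - \<phi> b (fst p)) + d"
    using assms(3) inner_ge_zero[of "snd p - \<phi> b (fst p)"] by linarith
  ultimately have "ln ((snd p - \<phi> b (fst p)) \<bullet> (snd p - \<phi> b (fst p)) + d) \<le> ln 5"
    by (intro ln_mono) auto
  then show ?thesis using ln_ge_one by (simp add: leaf_log_def ln_div)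
qed

lemma smooth_on_leaf_log:
  assumes "b \<in> \<tau>" "0 < d"
  shows "smooth_on bidisk (leaf_log b d)"
proof -
  have o: "open bidisk" by (intro open_Times open_ball)
  have "smooth_on bidisk (\<lambda>p. \<phi> b (fst p))"
    by (rule smooth_on_compose[where g = "\<phi> b" and f = fst, OF o open_ball[of 0 1]])
       (auto intro: smooth_on_bounded_linear bounded_linear_fst o smooth_on_holomorphic holomorphic_leaf[OF assms(1)])
  then have "smooth_on bidisk (\<lambda>p. snd p - \<phi> b (fst p))"
    by (rule smooth_on_diff[OF o smooth_on_bounded_linear[OF bounded_linear_snd o]])
  then have "smooth_on bidisk (\<lambda>p. (snd p - \<phi> b (fst p)) \<bullet> (snd p - \<phi> b (fst p)) + d)"
    by (intro smooth_on_add smooth_on_inner smooth_on_const o)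
  moreover have "0 < (snd p - \<phi> b (fst p)) \<bullet> (snd p - \<phi> b (fst p)) + d" for p
    using assms(2) inner_ge_zero[of "snd p - \<phi> b (fst p)"] by linarith
  ultimately show ?thesis unfolding leaf_log_def
    by (intro smooth_on_diff smooth_on_ln smooth_on_const o)
qed

definition leaf_separator :: "complex set \<Rightarrow> real \<Rightarrow> real \<Rightarrow> C2 \<Rightarrow> real" where
  "leaf_separator B d N p = smooth_separator N (card B) (\<Sum>b\<in>B. leaf_log b d p ^ card B)"

lemma smooth_on_leaf_separator:
  assumes B: "finite B" "B \<noteq> {}" "B \<subseteq> \<tau>" and d: "0 < d" "d \<le> 1" and N: "N > 0"
  shows "smooth_on bidisk (leaf_separator B d N)"
proof -
  have o: "open bidisk" by (intro open_Times open_ball)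
  have "smooth_on bidisk (\<lambda>p. \<Sum>b\<in>B. leaf_log b d p ^ card B)"
    using B(3) d by (intro smooth_on_sum smooth_on_power smooth_on_leaf_log o) auto
  moreover have "0 < (\<Sum>b\<in>B. leaf_log b d p ^ card B)" if "p \<in> bidisk" for p
  proof (rule sum_pos[OF B(1,2)])
    show "0 < leaf_log b d p ^ card B" if "b \<in> B" for b
      using leaf_log_ge_1[of b p d] that \<open>p \<in> bidisk\<close> d B(3) by (intro zero_less_power) force
  qed
  ultimately have "smooth_on bidisk (\<lambda>p. ln (\<Sum>b\<in>B. leaf_log b d p ^ card B))"
    by (intro smooth_on_ln o)
  then have "smooth_on bidisk (\<lambda>p. exp (- exp (N - ln (\<Sum>b\<in>B. leaf_log b d p ^ card B) * inverse (real (card B) * N))))"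
    by (intro smooth_on_exp smooth_on_minus smooth_on_diff smooth_on_mult smooth_on_const o)
  then show ?thesis unfolding leaf_separator_def smooth_separator_def by (simp only: divide_inverse)
qed

text \<open>The path \<open>t \<mapsto> z + t * v\<close>, lifted to the leaf of \<open>a\<close>,
  reduces the claim to a derivative in one real variable. Along it each logarithm satisfies the
  inequality required by \<open>smooth_separator_derivative_bound\<close>, with one \<open>C\<close>
  for all \<open>b\<close> and \<open>d\<close>.\<close>

lemma leaf_separator_leafwise_derivative:
  assumes B: "finite B" "B \<noteq> {}" "B \<subseteq> \<tau>" and d: "0 < d" "d \<le> 1" and N: "N > 0"
    and a: "a \<in> \<tau>" and z: "norm z \<le> r" "r < 1"
  shows "\<bar>frechet_derivative (leaf_separator B d N) (at (z, \<phi> a z)) (v, deriv (\<phi> a) z * v)\<bar> \<le> 2 / (1 - r) * norm v / N"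
proof -
  have zD: "z \<in> unit_disk" using z by simp
  define \<gamma> where "\<gamma> = (\<lambda>t::real. (z + of_real t * v, \<phi> a (z + of_real t * v)))"
  have pD: "\<gamma> 0 \<in> bidisk" using leaf_map_in_bidisk[of "(z, a)"] zD a by (simp add: \<gamma>_def leaf_map_def)
  define C where "C = 2 / (1 - r) * norm v"
  have C: "0 \<le> C" using z by (simp add: C_def)
  have line: "((\<lambda>t. z + of_real t * v) has_vector_derivative v) (at t)" for t
    by (auto intro!: derivative_eq_intros)
  have leaf: "((\<lambda>t. \<phi> c (z + of_real t * v)) has_vector_derivative v * deriv (\<phi> c) z) (at 0)" if "c \<in> \<tau>" for c
    using field_vector_diff_chain_at[OF line[of 0], of "\<phi> c" "deriv (\<phi> c) z"]
      holomorphic_derivI[OF holomorphic_leaf[OF that] open_ball zD] by (simp add: o_def)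
  have \<gamma>': "(\<gamma> has_vector_derivative (v, deriv (\<phi> a) z * v)) (at 0)"
    unfolding \<gamma>_def using has_vector_derivative_Pair[OF line[of 0] leaf[OF a]] by (simp add: mult.commute)
  have q: "\<exists>q'. ((\<lambda>t. leaf_log b d (\<gamma> t)) has_real_derivative q') (at 0) \<and> \<bar>q'\<bar> \<le> C * leaf_log b d (\<gamma> 0)"
    if b: "b \<in> B" for b
  proof -
    have b\<tau>: "b \<in> \<tau>" using b B(3) by auto
    define g where "g = (\<lambda>t. \<phi> a (z + of_real t * v) - \<phi> b (z + of_real t * v))"
    define h where "h = v * deriv (\<phi> a) z - v * deriv (\<phi> b) z"
    have dg: "(g has_vector_derivative h) (at 0)"
      unfolding g_def h_def by (intro has_vector_derivative_diff leaf a b\<tau>)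
    have "((\<lambda>t. g t \<bullet> g t) has_vector_derivative g 0 \<bullet> h + h \<bullet> g 0) (at 0)"
      by (rule bounded_bilinear.has_vector_derivative[OF bounded_bilinear_inner dg dg])
    then have dx: "((\<lambda>t. g t \<bullet> g t + d) has_real_derivative 2 * (g 0 \<bullet> h)) (at 0)"
      by (auto intro!: derivative_eq_intros simp: has_real_derivative_iff_has_vector_derivative inner_commute)
    have pos: "0 < g 0 \<bullet> g 0 + d" using d(1) inner_ge_zero[of "g 0"] by linarith
    have "((\<lambda>t. ln 16 - ln (g t \<bullet> g t + d)) has_real_derivative 0 - 1 / (g 0 \<bullet> g 0 + d) * (2 * (g 0 \<bullet> h))) (at 0)"
      by (intro DERIV_diff DERIV_const DERIV_chain2[OF DERIV_ln_divide[OF pos] dx])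
    then have der: "((\<lambda>t. leaf_log b d (\<gamma> t)) has_real_derivative - (2 * (g 0 \<bullet> h) / (g 0 \<bullet> g 0 + d))) (at 0)"
      by (simp add: leaf_log_def \<gamma>_def g_def)
    have "\<bar>2 * (g 0 \<bullet> h) / (g 0 \<bullet> g 0 + d)\<bar> \<le> C * (ln 16 - ln (g 0 \<bullet> g 0 + d))"
    proof (cases "a = b")
      case True
      \<comment> \<open>On its own leaf the logarithm of \<open>b\<close> is constant; the
        half-plane estimate, which needs a nonvanishing difference, serves the other leaves.\<close>
      then have "h = 0" by (simp add: h_def)
      moreover have "0 \<le> leaf_log b d (\<gamma> 0)" using leaf_log_ge_1[OF b\<tau> pD d] by simp
      ultimately show ?thesis using C by (simp add: leaf_log_def \<gamma>_def g_def)
    next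
      case False
      note df = leaf_difference[OF a b\<tau> False]
      have g0: "g 0 = \<phi> a z - \<phi> b z" by (simp add: g_def)
      have "deriv (\<lambda>z. \<phi> a z - \<phi> b z) z = deriv (\<phi> a) z - deriv (\<phi> b) z"
        using zD by (intro deriv_diff holomorphic_on_imp_differentiable_at[OF holomorphic_leaf open_ball] a b\<tau>)
      then have nh: "norm h = norm v * norm (deriv (\<lambda>z. \<phi> a z - \<phi> b z) z)"
        by (simp add: h_def right_diff_distrib[symmetric] norm_mult)
      have lnpos: "0 \<le> ln (2 / norm (g 0))" using df(2,3)[OF zD] by (simp add: g0)
      have "norm (deriv (\<lambda>z. \<phi> a z - \<phi> b z) z) \<le> 2 * norm (g 0) * ln (2 / norm (g 0)) / (1 - norm z)"
        unfolding g0 by (rule deriv_bound_nonvanishing[OF df(1,2,3) zD])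
      also have "\<dots> \<le> 2 * norm (g 0) * ln (2 / norm (g 0)) / (1 - r)"
        using z lnpos by (intro divide_left_mono) auto
      finally have "norm h \<le> norm v * (2 * norm (g 0) * ln (2 / norm (g 0)) / (1 - r))"
        unfolding nh by (intro mult_left_mono) auto
      also have "\<dots> = C * (norm (g 0) * ln (2 / norm (g 0)))" by (simp add: C_def)
      finally show ?thesis
        using df(2,3)[OF zD] d C by (intro regularized_log_derivative_bound) (auto simp: g0)
    qed
    moreover have "leaf_log b d (\<gamma> 0) = ln 16 - ln (g 0 \<bullet> g 0 + d)"
      by (simp add: leaf_log_def \<gamma>_def g_def)
    ultimately show ?thesis using der by (metis abs_minus_cancel)
  qed
  then obtain q' where q': "\<And>b. b \<in> B \<Longrightarrow> ((\<lambda>t. leaf_log b d (\<gamma> t)) has_real_derivative q' b) (at 0)"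
    "\<And>b. b \<in> B \<Longrightarrow> \<bar>q' b\<bar> \<le> C * leaf_log b d (\<gamma> 0)" by metis
  have posq: "0 < leaf_log b d (\<gamma> 0)" if "b \<in> B" for b using leaf_log_ge_1[OF _ pD d] that B(3) by force
  obtain D where D: "((\<lambda>s. smooth_separator N (card B) (\<Sum>b\<in>B. leaf_log b d (\<gamma> s) ^ card B)) has_real_derivative D) (at 0)"
    "\<bar>D\<bar> \<le> C / N"
    by (rule smooth_separator_derivative_bound[OF B(1,2) N C, of "\<lambda>b s. leaf_log b d (\<gamma> s)" "\<lambda>b _. q' b" 0])
       (use q' posq in auto)
  have df: "(leaf_separator B d N has_derivative frechet_derivative (leaf_separator B d N) (at (\<gamma> 0))) (at (\<gamma> 0))"
    using smooth_on_leaf_separator[OF B d N] pD by (rule smooth_on_has_derivative)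
  have "((leaf_separator B d N \<circ> \<gamma>) has_vector_derivative
      frechet_derivative (leaf_separator B d N) (at (\<gamma> 0)) (v, deriv (\<phi> a) z * v)) (at 0)"
    by (rule vector_derivative_diff_chain_within[OF \<gamma>' has_derivative_at_withinI[OF df]])
  moreover have "leaf_separator B d N \<circ> \<gamma> = (\<lambda>s. smooth_separator N (card B) (\<Sum>b\<in>B. leaf_log b d (\<gamma> s) ^ card B))"
    by (simp add: leaf_separator_def o_def)
  ultimately have "frechet_derivative (leaf_separator B d N) (at (\<gamma> 0)) (v, deriv (\<phi> a) z * v) = D"
    using D(1) by (simp add: has_real_derivative_iff_has_vector_derivative vector_derivative_unique_at)
  then show ?thesis using D(2) by (simp add: \<gamma>_def C_def)
qed

lemma leaf_separator_bounds: "0 \<le> leaf_separator B d N p" "leaf_separator B d N p \<le> 1"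
  by (simp_all add: leaf_separator_def smooth_separator_bounds)

text \<open>\<open>d\<close> makes \<open>- ln d\<close> the threshold
  \<open>exp (2 * N\<^sup>2)\<close>. Within \<open>sqrt d\<close> of a net leaf the regularized
  argument is at most \<open>2 * d\<close>, which the constant 16 absorbs.\<close>

lemma leaf_separator_lower:
  assumes B: "finite B" "b \<in> B" "B \<subseteq> \<tau>" and N: "N > 0" and d: "d = exp (- exp (2 * N\<^sup>2))"
    and p: "p \<in> bidisk" and near: "(norm (snd p - \<phi> b (fst p)))\<^sup>2 \<le> d"
  shows "exp (- exp (- N)) \<le> leaf_separator B d N p"
  unfolding leaf_separator_def
proof (rule smooth_separator_lower[OF B(1,2) N])
  have d01: "0 < d" "d \<le> 1" by (auto simp: d)
  show "0 < leaf_log b d p" if "b \<in> B" for b using leaf_log_ge_1[OF _ p d01] that B(3) by force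
  have "(snd p - \<phi> b (fst p)) \<bullet> (snd p - \<phi> b (fst p)) + d \<le> 16 * d"
    using near d01 by (simp add: power2_norm_eq_inner)
  moreover have "0 < (snd p - \<phi> b (fst p)) \<bullet> (snd p - \<phi> b (fst p)) + d"
    using d01 inner_ge_zero[of "snd p - \<phi> b (fst p)"] by linarith
  ultimately have "ln ((snd p - \<phi> b (fst p)) \<bullet> (snd p - \<phi> b (fst p)) + d) \<le> ln (16 * d)"
    by (intro ln_mono) auto
  also have "\<dots> = ln 16 - exp (2 * N\<^sup>2)" using d01 by (simp add: ln_mult d)
  finally show "exp (2 * N\<^sup>2) \<le> leaf_log b d p" by (simp add: leaf_log_def)
qed

text \<open>Besides \<open>N\<close>, the bound involves only the distance \<open>c\<close>, neither
  the net nor \<open>d\<close>, so it survives the refinement of the net and the shrinking of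
  \<open>d\<close> as \<open>N\<close> grows.\<close>

lemma leaf_separator_upper:
  assumes B: "finite B" "B \<noteq> {}" "B \<subseteq> \<tau>" and N: "N \<ge> 1" and d: "0 < d" "d \<le> 1" and c: "0 < c"
    and p: "p \<in> bidisk" and far: "\<And>b. b \<in> B \<Longrightarrow> c \<le> norm (snd p - \<phi> b (fst p))"
  shows "leaf_separator B d N p \<le> exp (- exp (N - (1 + ln (max 1 (ln 16 - ln (c\<^sup>2))))))"
  unfolding leaf_separator_def
proof (rule smooth_separator_upper[OF B(1,2) N])
  show "0 < leaf_log b d p" if "b \<in> B" for b using leaf_log_ge_1[OF _ p d] that B(3) by force
  show "leaf_log b d p \<le> max 1 (ln 16 - ln (c\<^sup>2))" if "b \<in> B" for b
  proof -
    have "c\<^sup>2 \<le> (norm (snd p - \<phi> b (fst p)))\<^sup>2" using far[OF that] c by (intro power_mono) auto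
    then have "c\<^sup>2 \<le> (snd p - \<phi> b (fst p)) \<bullet> (snd p - \<phi> b (fst p)) + d"
      using d by (simp add: power2_norm_eq_inner)
    then have "ln (c\<^sup>2) \<le> ln ((snd p - \<phi> b (fst p)) \<bullet> (snd p - \<phi> b (fst p)) + d)"
      using c by (intro ln_mono) auto
    then show ?thesis by (simp add: leaf_log_def)
  qed
qed simp

text \<open>With \<open>N = n + 1\<close>, the lower bound dictates \<open>d n\<close>, and the net
  \<open>B n\<close> is so fine that each leaf of \<open>E\<close> stays within
  \<open>sqrt (d n)\<close> of a net leaf over \<open>norm z \<le> r\<close>. A leaf outside
  \<open>E\<close> keeps a distance from all net leaves that does not depend on \<open>n\<close>.
  Empty \<open>E\<close> is separate because the separator needs a nonempty net.\<close>

lemma leaf_cutoff_functions: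
  assumes E: "compact E" "E \<subseteq> \<tau>" and r: "r < 1"
  obtains G :: "nat \<Rightarrow> C2 \<Rightarrow> real" where
    "\<And>n. smooth_on bidisk (G n)" "\<And>n p. 0 \<le> G n p" "\<And>n p. G n p \<le> 1"
    "\<And>a z. a \<in> \<tau> \<Longrightarrow> norm z \<le> r \<Longrightarrow> (\<lambda>n. G n (z, \<phi> a z)) \<longlonglongrightarrow> indicator E a"
    "\<And>n a z v. a \<in> \<tau> \<Longrightarrow> norm z \<le> r \<Longrightarrow>
      \<bar>frechet_derivative (G n) (at (z, \<phi> a z)) (v, deriv (\<phi> a) z * v)\<bar> \<le> 2 / (1 - r) * norm v / real (Suc n)"
proof (cases "E = {}")
  case True
  have "frechet_derivative (\<lambda>p::C2. 0::real) (at p) = (\<lambda>v. 0)" for p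
    by (rule frechet_derivative_eqI) simp
  then show thesis
    using that[of "\<lambda>n p. 0"] r True by (simp add: smooth_on_const)
next
  case False
  define N where "N = (\<lambda>n. real (Suc n))"
  define d where "d = (\<lambda>n. exp (- exp (2 * (N n)\<^sup>2)))"
  have N: "N n \<ge> 1" "N n > 0" for n by (auto simp: N_def)
  have d: "0 < d n" "d n \<le> 1" for n by (auto simp: d_def)
  have "\<exists>B. finite B \<and> B \<noteq> {} \<and> B \<subseteq> E \<and>
      (\<forall>a\<in>E. \<exists>b\<in>B. \<forall>z. norm z \<le> r \<longrightarrow> (norm (\<phi> a z - \<phi> b z))\<^sup>2 \<le> d n)" for n
  proof -
    obtain \<delta> where \<delta>: "\<delta> > 0" "\<And>a b z. a \<in> \<tau> \<Longrightarrow> b \<in> \<tau> \<Longrightarrow> norm z \<le> r \<Longrightarrow> dist a b < \<delta> \<Longrightarrow> norm (\<phi> a z - \<phi> b z) < sqrt (d n)"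
      using leaf_distance_uniform[OF r, of "sqrt (d n)"] d[of n] by auto
    obtain B where B: "finite B" "B \<subseteq> E" "E \<subseteq> (\<Union>b\<in>B. ball b \<delta>)"
      by (rule compactE_image[OF E(1), of E "\<lambda>b. ball b \<delta>"]) (use \<delta>(1) in auto)
    have "\<exists>b\<in>B. \<forall>z. norm z \<le> r \<longrightarrow> (norm (\<phi> a z - \<phi> b z))\<^sup>2 \<le> d n" if a: "a \<in> E" for a
    proof -
      obtain b where b: "b \<in> B" "dist b a < \<delta>" using B(3) a by auto
      have "(norm (\<phi> a z - \<phi> b z))\<^sup>2 \<le> (sqrt (d n))\<^sup>2" if "norm z \<le> r" for z
        using \<delta>(2)[of a b z] that a b B(2) E(2) by (intro power_mono) (auto simp: dist_commute intro: less_imp_le)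
      then show ?thesis using b(1) d(1)[of n] by auto
    qed
    moreover have "B \<noteq> {}" using B(3) False by auto
    ultimately show ?thesis using B(1,2) by blast
  qed
  then obtain B where B: "\<And>n. finite (B n)" "\<And>n. B n \<noteq> {}" "\<And>n. B n \<subseteq> E"
    "\<And>n a. a \<in> E \<Longrightarrow> \<exists>b\<in>B n. \<forall>z. norm z \<le> r \<longrightarrow> (norm (\<phi> a z - \<phi> b z))\<^sup>2 \<le> d n"
    by metis
  have B\<tau>: "B n \<subseteq> \<tau>" for n using B(3) E(2) by blast
  define G where "G = (\<lambda>n. leaf_separator (B n) (d n) (N n))"
  have Ntop: "filterlim N at_top sequentially"
    unfolding N_def by (rule filterlim_compose[OF filterlim_real_sequentially filterlim_Suc])
  have G0: "0 \<le> G n p" and G1: "G n p \<le> 1" for n p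
    by (simp_all add: G_def leaf_separator_bounds)
  show thesis
  proof (rule that[of G])
    show "smooth_on bidisk (G n)" for n
      unfolding G_def by (rule smooth_on_leaf_separator[OF B(1,2) B\<tau> d N(2)])
    show "0 \<le> G n p" "G n p \<le> 1" for n p by (fact G0 G1)+
    show "\<bar>frechet_derivative (G n) (at (z, \<phi> a z)) (v, deriv (\<phi> a) z * v)\<bar> \<le> 2 / (1 - r) * norm v / real (Suc n)"
      if "a \<in> \<tau>" "norm z \<le> r" for n a z v
      using leaf_separator_leafwise_derivative[OF B(1,2) B\<tau> d N(2) that r, of n n n v]
      by (simp only: G_def N_def)
    show "(\<lambda>n. G n (z, \<phi> a z)) \<longlonglongrightarrow> indicator E a" if a: "a \<in> \<tau>" and z: "norm z \<le> r" for a z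
    proof -
      have p: "(z, \<phi> a z) \<in> bidisk" using leaf_map_in_bidisk[of "(z, a)"] a z r by (simp add: leaf_map_def)
      show ?thesis
      proof (cases "a \<in> E")
        case True
        have lb: "exp (- exp (- N n)) \<le> G n (z, \<phi> a z)" for n
        proof -
          obtain b where b: "b \<in> B n" "(norm (\<phi> a z - \<phi> b z))\<^sup>2 \<le> d n" using B(4)[OF True] z by blast
          show ?thesis unfolding G_def
            by (rule leaf_separator_lower[OF B(1) b(1) B\<tau> N(2) _ p]) (use b(2) in \<open>auto simp: d_def\<close>)
        qed
        have lim: "(\<lambda>n. exp (- exp (- N n))) \<longlonglongrightarrow> 1"
          by (rule filterlim_compose[OF _ Ntop]) real_asymp
        have "(\<lambda>n. G n (z, \<phi> a z)) \<longlonglongrightarrow> 1"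
          by (rule tendsto_sandwich[OF always_eventually[OF allI[OF lb]] always_eventually[OF allI[OF G1]] lim tendsto_const])
        then show ?thesis using True by simp
      next
        case outside: False
        define m where "m = infdist a E"
        have m: "m > 0" unfolding m_def
          using outside E(1) False by (metis compact_imp_closed in_closed_iff_infdist_zero infdist_nonneg less_eq_real_def)
        define K where "K = exp (2 / (1 - r))"
        \<comment> \<open>The upper Harnack inequality: leaves at least \<open>m\<close> apart at 0
          stay at least \<open>c\<close> apart over \<open>norm z \<le> r\<close>.\<close>
        define c where "c = 2 * exp (- (K * ln (2 / m)))"
        have c: "c > 0" by (simp add: c_def)
        have far: "c \<le> norm (\<phi> a z - \<phi> b z)" if b: "b \<in> B n" for b n
        proof -
          have bE: "b \<in> E" and b\<tau>: "b \<in> \<tau>" using b B(3) B\<tau> by auto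
          have ne: "a \<noteq> b" using outside bE by auto
          have pos: "0 < norm (\<phi> a z - \<phi> b z)" using leaf_difference(2)[OF a b\<tau> ne] z r by simp
          have "m \<le> norm (a - b)" unfolding m_def using infdist_le[OF bE, of a] by (simp add: dist_norm)
          then have "ln (2 / norm (a - b)) \<le> ln (2 / m)" using m by (intro ln_mono divide_left_mono mult_pos_pos) auto
          then have "ln (2 / norm (\<phi> a z - \<phi> b z)) \<le> K * ln (2 / m)"
            using leaf_distance(3)[OF a b\<tau> ne z r] unfolding K_def
            by (meson exp_ge_zero mult_left_mono order_trans)
          then have "ln c \<le> ln (norm (\<phi> a z - \<phi> b z))" using pos by (simp add: c_def ln_mult ln_div)
          then show ?thesis using c pos by simp
        qed
        define Q where "Q = 1 + ln (max 1 (ln 16 - ln (c\<^sup>2)))"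
        have ub: "G n (z, \<phi> a z) \<le> exp (- exp (N n - Q))" for n
          unfolding G_def Q_def
          by (rule leaf_separator_upper[OF B(1,2) B\<tau> N(1) d c p]) (use far in auto)
        have lim: "(\<lambda>n. exp (- exp (N n - Q))) \<longlonglongrightarrow> 0"
          by (rule filterlim_compose[OF _ Ntop]) real_asymp
        have "(\<lambda>n. G n (z, \<phi> a z)) \<longlonglongrightarrow> 0"
          by (rule tendsto_sandwich[OF always_eventually[OF allI[OF G0]] always_eventually[OF allI[OF ub]] tendsto_const lim])
        then show ?thesis using outside by simp
      qed
    qed
  qed
qed

end

section \<open>Uniformly laminar currents\<close>

lemma bilinear_expand_Basis:
  fixes B :: "'a::euclidean_space \<Rightarrow> 'a \<Rightarrow> complex"
  assumes "bilinear B"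
  shows "B u v = (\<Sum>a\<in>Basis. \<Sum>b\<in>Basis. of_real ((u \<bullet> a) * (v \<bullet> b)) * B a b)"
proof -
  have l1: "linear (\<lambda>x. B x y)" and l2: "linear (B x)" for x y
    using assms by (auto simp: bilinear_def)
  have "B u v = B (\<Sum>a\<in>Basis. (u \<bullet> a) *\<^sub>R a) (\<Sum>b\<in>Basis. (v \<bullet> b) *\<^sub>R b)"
    by (simp only: euclidean_representation)
  also have "\<dots> = (\<Sum>a\<in>Basis. (u \<bullet> a) *\<^sub>R B a (\<Sum>b\<in>Basis. (v \<bullet> b) *\<^sub>R b))"
    using linear_sum[OF l1, of "\<lambda>a. (u \<bullet> a) *\<^sub>R a" Basis] linear_cmul[OF l1] by simp
  also have "\<dots> = (\<Sum>a\<in>Basis. (u \<bullet> a) *\<^sub>R (\<Sum>b\<in>Basis. (v \<bullet> b) *\<^sub>R B a b))"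
    using linear_sum[OF l2, of _ "\<lambda>b. (v \<bullet> b) *\<^sub>R b" Basis] linear_cmul[OF l2] by simp
  finally show ?thesis by (simp add: scaleR_conv_of_real sum_distrib_left mult.assoc)
qed

text \<open>Only the first coordinate has to be kept from the boundary, since the leaves stay within
  \<open>height\<close> in the second.\<close>

lemma compact_subset_bidiskE:
  assumes "compact K" "K \<subseteq> bidisk"
  obtains r where "0 \<le> r" "r < 1" "K \<subseteq> cball 0 r \<times> unit_disk"
proof (cases "K = {}")
  case True
  then show thesis using that[of 0] by auto
next
  case False
  have "compact ((\<lambda>p. norm (fst p)) ` K)" using assms(1) by (intro compact_continuous_image continuous_intros)
  then obtain p where p: "p \<in> K" "\<And>q. q \<in> K \<Longrightarrow> norm (fst q) \<le> norm (fst p)"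
    using compact_attains_sup[of "(\<lambda>p. norm (fst p)) ` K"] False by auto
  show thesis
  proof (rule that[of "norm (fst p)"])
    show "norm (fst p) < 1" using p(1) assms(2) by (auto simp: mem_Times_iff)
    show "K \<subseteq> cball 0 (norm (fst p)) \<times> unit_disk" using p(2) assms(2) by (auto simp: mem_Times_iff subset_iff)
  qed simp
qed

lemma bilinear_kaehler_form:
  "bilinear (\<lambda>u v. c * complex_of_real (kaehler_form u v))" "kaehler_form u u = 0"
proof -
  have "kaehler_form (x + y) v = kaehler_form x v + kaehler_form y v"
    "kaehler_form u (x + y) = kaehler_form u x + kaehler_form u y"
    "kaehler_form (r *\<^sub>R x) v = r * kaehler_form x v" "kaehler_form u (r *\<^sub>R x) = r * kaehler_form u x"
    for x y u v r by (simp_all add: kaehler_form_def algebra_simps)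
  then show "bilinear (\<lambda>u v. c * complex_of_real (kaehler_form u v))"
    by (auto simp: bilinear_def linear_iff distrib_left mult.left_commute scaleR_conv_of_real)
  show "kaehler_form u u = 0" by (simp add: kaehler_form_def mult.commute)
qed

lemma test_form2_scale:
  assumes h: "test_function h" and \<omega>: "bilinear \<omega>" "\<And>u. \<omega> u u = 0"
  shows "test_form2 (\<lambda>p u v. h p * \<omega> u v)"
proof -
  obtain K where K: "compact K" "K \<subseteq> bidisk" "\<And>p. p \<notin> K \<Longrightarrow> h p = 0"
    using h by (auto simp: test_function_def)
  have "smooth (\<lambda>p. h p * \<omega> u v)" for u v
    using h unfolding test_function_def smooth_iff_smooth_on
    by (intro smooth_on_mult smooth_on_const) auto
  moreover have "bilinear (\<lambda>u v. h p * \<omega> u v)" for p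
    using \<omega>(1) by (auto simp: bilinear_def linear_iff distrib_left)
  ultimately show ?thesis unfolding test_form2_def using \<omega>(2) K by (auto intro!: exI[of _ K])
qed

lemma test_form2_continuous: "test_form2 \<psi> \<Longrightarrow> continuous_on UNIV (\<lambda>p. \<psi> p u v)"
proof -
  assume "test_form2 \<psi>"
  then have "smooth (\<lambda>p. \<psi> p u v)" unfolding test_form2_def by blast
  then show ?thesis unfolding smooth_iff_smooth_on by (rule smooth_on_imp_continuous_on)
qed

lemma test_function_box_bump:
  assumes "cbox a b \<subseteq> bidisk"
  shows "test_function (\<lambda>p. complex_of_real (box_bump a b n p))"
proof -
  have "smooth_on UNIV (\<lambda>p. complex_of_real (box_bump a b n p))"
    by (intro smooth_on_of_real smooth_on_box_bump open_UNIV)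
  then show ?thesis
    unfolding test_function_def smooth_iff_smooth_on
    using assms box_bump_zero[of _ a b n] box_subset_cbox[of a b] by (auto intro!: exI[of _ "cbox a b"])
qed

section \<open>Integration over the product of disk and transversal\<close>

locale laminar = disk_lamination +
  fixes \<mu> :: "complex measure"
  assumes finite_\<mu>: "finite_measure_on \<tau> \<mu>"
begin

definition leaf_measure :: "(complex \<times> complex) measure" where
  "leaf_measure = restrict_space lborel unit_disk \<Otimes>\<^sub>M \<mu>"

lemma sets_\<mu>: "sets \<mu> = sets (restrict_space borel \<tau>)"
  using finite_\<mu> by (simp add: finite_measure_on_def)

lemma space_\<mu>: "space \<mu> = \<tau>"
  using sets_eq_imp_space_eq[OF sets_\<mu>] by (simp add: space_restrict_space)

sublocale \<mu>: finite_measure \<mu>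
  using finite_\<mu> by (simp add: finite_measure_on_def)

sublocale disk: finite_measure "restrict_space lborel unit_disk"
proof (rule finite_measureI)
  have "emeasure lborel unit_disk < \<infinity>" using emeasure_lborel_ball_finite by blast
  then show "emeasure (restrict_space lborel unit_disk) (space (restrict_space lborel unit_disk)) \<noteq> \<infinity>"
    by (simp add: emeasure_restrict_space space_restrict_space)
qed

sublocale pair_sigma_finite "restrict_space lborel unit_disk" \<mu> ..

sublocale leaf_measure: finite_measure leaf_measure
  unfolding leaf_measure_def by (rule finite_measure_pair_measure) (unfold_locales)

lemma space_leaf_measure: "space leaf_measure = unit_disk \<times> \<tau>"
  by (simp add: leaf_measure_def space_pair_measure space_\<mu> space_restrict_space)

lemma borel_measurable_leaf_measure_continuous:
  fixes h :: "complex \<times> complex \<Rightarrow> 'c::topological_space"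
  assumes "continuous_on (unit_disk \<times> \<tau>) h"
  shows "h \<in> borel_measurable leaf_measure"
proof -
  have f: "fst \<in> leaf_measure \<rightarrow>\<^sub>M borel"
    unfolding leaf_measure_def
    by (rule measurable_compose[OF measurable_fst]) (auto intro: measurable_restrict_space1)
  have s: "snd \<in> leaf_measure \<rightarrow>\<^sub>M borel"
    unfolding leaf_measure_def
    by (rule measurable_compose[OF measurable_snd])
       (auto simp: measurable_cong_sets[OF sets_\<mu> refl] intro: measurable_restrict_space1)
  have "(\<lambda>x. (fst x, snd x)) \<in> leaf_measure \<rightarrow>\<^sub>M borel"
    unfolding borel_prod[symmetric] by (rule measurable_Pair[OF f s])
  then have "(\<lambda>x. x) \<in> leaf_measure \<rightarrow>\<^sub>M restrict_space borel (unit_disk \<times> \<tau>)"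
    by (intro measurable_restrict_space2) (auto simp: space_leaf_measure)
  from measurable_compose[OF this borel_measurable_continuous_on_restrict[OF assms]] show ?thesis by simp
qed

lemma measurable_leaf_map: "leaf_map \<in> leaf_measure \<rightarrow>\<^sub>M restrict_space borel bidisk"
  using leaf_map_in_bidisk
  by (intro measurable_restrict_space2 borel_measurable_leaf_measure_continuous continuous_on_leaf_map)
     (auto simp: space_leaf_measure)

text \<open>On the cylinder over \<open>cball 0 r\<close> the continuous \<open>g\<close> is bounded
  by compactness, so local integrability of \<open>F\<close> is enough. It is applied with
  \<open>F = 1\<close> and with the density of \<open>f T\<close>.\<close>

lemma integrable_leaf_cutoff:
  fixes F g :: "complex \<times> complex \<Rightarrow> complex"
  assumes F: "F \<in> borel_measurable leaf_measure" "set_integrable leaf_measure (cball 0 r \<times> \<tau>) F" and r: "r < 1"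
    and g: "continuous_on (unit_disk \<times> \<tau>) g" "\<And>x. x \<in> unit_disk \<times> \<tau> \<Longrightarrow> r < norm (fst x) \<Longrightarrow> g x = 0"
  shows "integrable leaf_measure (\<lambda>x. F x * g x)"
proof -
  have sub: "cball 0 r \<times> \<tau> \<subseteq> unit_disk \<times> \<tau>" using r by auto
  have "compact (g ` (cball 0 r \<times> \<tau>))"
    by (intro compact_continuous_image continuous_on_subset[OF g(1) sub] compact_Times compact_cball compact_\<tau>)
  then obtain C where C: "\<And>x. x \<in> cball 0 r \<times> \<tau> \<Longrightarrow> norm (g x) \<le> C"
    using compact_imp_bounded bounded_iff by (metis imageI)
  have int: "integrable leaf_measure (\<lambda>x. indicator (cball 0 r \<times> \<tau>) x *\<^sub>R F x)"
    using F(2) by (simp add: set_integrable_def)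
  show ?thesis
  proof (rule Bochner_Integration.integrable_bound[OF integrable_mult_right[OF integrable_norm[OF int], of C]])
    show "(\<lambda>x. F x * g x) \<in> borel_measurable leaf_measure"
      by (intro borel_measurable_times F(1) borel_measurable_leaf_measure_continuous g(1))
    show "AE x in leaf_measure. norm (F x * g x) \<le> norm (C * norm (indicator (cball 0 r \<times> \<tau>) x *\<^sub>R F x))"
    proof (rule AE_I2)
      fix x assume x: "x \<in> space leaf_measure"
      show "norm (F x * g x) \<le> norm (C * norm (indicator (cball 0 r \<times> \<tau>) x *\<^sub>R F x))"
      proof (cases "norm (fst x) \<le> r")
        case True
        then have "x \<in> cball 0 r \<times> \<tau>" using x by (auto simp: space_leaf_measure mem_Times_iff)
        then have "norm (g x) * norm (F x) \<le> \<bar>C\<bar> * norm (F x)"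
          using C[of x] by (intro mult_right_mono) auto
        then show ?thesis using \<open>x \<in> cball 0 r \<times> \<tau>\<close> by (simp add: norm_mult abs_mult mult.commute)
      next
        case False
        then show ?thesis using g(2)[of x] x by (simp add: space_leaf_measure)
      qed
    qed
  qed
qed

lemma sets_cylinder: "cball 0 r \<times> \<tau> \<in> sets leaf_measure" if "r < 1"
proof -
  have "cball 0 r \<in> sets (restrict_space lborel unit_disk)"
    using that by (auto simp: sets_restrict_space_iff)
  moreover have "\<tau> \<in> sets \<mu>" using sets.top[of \<mu>] by (simp add: space_\<mu>)
  ultimately show ?thesis unfolding leaf_measure_def by simp
qed

lemma set_integrable_one: "r < 1 \<Longrightarrow> set_integrable leaf_measure (cball 0 r \<times> \<tau>) (\<lambda>x. 1 :: complex)"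
  using sets_cylinder[of r] by (auto simp: set_integrable_def less_top[symmetric] leaf_measure.emeasure_finite)

definition pullback :: "form2 \<Rightarrow> complex \<times> complex \<Rightarrow> complex" where
  "pullback \<psi> x = \<psi> (leaf_map x) (1, slope x) (\<i>, \<i> * slope x)"

lemma continuous_on_comp_leaf_map:
  fixes h :: "C2 \<Rightarrow> 'c::topological_space"
  shows "continuous_on UNIV h \<Longrightarrow> continuous_on (unit_disk \<times> \<tau>) (\<lambda>x. h (leaf_map x))"
  by (rule continuous_on_compose2[OF _ continuous_on_leaf_map]) auto

lemma pullback_test_form:
  assumes "test_form2 \<psi>"
  shows "continuous_on (unit_disk \<times> \<tau>) (pullback \<psi>)"
    and "\<exists>r. 0 \<le> r \<and> r < 1 \<and> (\<forall>x\<in>unit_disk \<times> \<tau>. r < norm (fst x) \<longrightarrow> pullback \<psi> x = 0)"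
proof -
  have bil: "bilinear (\<psi> p)" for p using assms unfolding test_form2_def by blast
  have cont: "continuous_on UNIV (\<lambda>p. \<psi> p u v)" for u v
    by (rule test_form2_continuous[OF assms])
  have "continuous_on (unit_disk \<times> \<tau>) (\<lambda>x. \<Sum>a\<in>Basis. \<Sum>b\<in>Basis.
      of_real (((1, slope x) \<bullet> a) * ((\<i>, \<i> * slope x) \<bullet> b)) * \<psi> (leaf_map x) a b)"
    by (intro continuous_intros continuous_on_slope continuous_on_comp_leaf_map cont)
  then show "continuous_on (unit_disk \<times> \<tau>) (pullback \<psi>)"
    unfolding pullback_def bilinear_expand_Basis[OF bil, symmetric] .
  obtain K where K: "compact K" "K \<subseteq> bidisk" "\<And>p u v. p \<notin> K \<Longrightarrow> \<psi> p u v = 0"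
    using assms by (auto simp: test_form2_def)
  obtain r where r: "0 \<le> r" "r < 1" "K \<subseteq> cball 0 r \<times> unit_disk" by (rule compact_subset_bidiskE[OF K(1,2)])
  then show "\<exists>r. 0 \<le> r \<and> r < 1 \<and> (\<forall>x\<in>unit_disk \<times> \<tau>. r < norm (fst x) \<longrightarrow> pullback \<psi> x = 0)"
    using K(3) by (intro exI[of _ r]) (fastforce simp: pullback_def leaf_map_def)
qed

lemma integrable_pullback:
  assumes "test_form2 \<psi>"
  shows "integrable leaf_measure (pullback \<psi>)"
proof -
  obtain r where r: "r < 1" "\<And>x. x \<in> unit_disk \<times> \<tau> \<Longrightarrow> r < norm (fst x) \<Longrightarrow> pullback \<psi> x = 0"
    using pullback_test_form(2)[OF assms] by blast
  show ?thesis
    using integrable_leaf_cutoff[OF _ set_integrable_one[OF r(1)] r(1) pullback_test_form(1)[OF assms] r(2)] by simp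
qed

lemma integration_current_eq: "integration_current (\<phi> \<alpha>) \<psi> = (\<integral>z. pullback \<psi> (z, \<alpha>) \<partial>restrict_space lborel unit_disk)"
  unfolding integration_current_def set_lebesgue_integral_def pullback_def leaf_map_def slope_def
  by (subst integral_restrict_space) auto

lemma laminar_current_eq:
  assumes "test_form2 \<psi>"
  shows "laminar_current \<phi> \<mu> \<psi> = (\<integral>x. pullback \<psi> x \<partial>leaf_measure)"
  unfolding laminar_current_def integration_current_eq
  using integral_snd[of "\<lambda>z \<alpha>. pullback \<psi> (z, \<alpha>)"] integrable_pullback[OF assms]
  by (simp add: leaf_measure_def)

section \<open>The trace measure of a laminar current\<close>

definition jac :: "complex \<times> complex \<Rightarrow> real" where
  "jac x = 1 + (norm (slope x))\<^sup>2"

lemma jac_ge_1: "1 \<le> jac x"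
  by (simp add: jac_def)

lemma jac_nonneg: "0 \<le> jac x"
  by (simp add: jac_def)

lemma continuous_on_jac: "continuous_on (unit_disk \<times> \<tau>) jac"
  unfolding jac_def by (intro continuous_intros continuous_on_slope)

text \<open>\<open>jac\<close> is the area Jacobian of
  \<open>z \<mapsto> (z, \<phi> \<alpha> z)\<close>, which is also the pullback of the Kaehler form.
  Thus this push-forward adds up the areas of the leaves, weighted by \<mu>, and is the candidate
  for the trace measure.\<close>

definition area_measure :: "C2 measure" where
  "area_measure = distr (density leaf_measure (\<lambda>x. ennreal (jac x))) (restrict_space borel bidisk) leaf_map"

lemma sets_area_measure: "sets area_measure = sets (restrict_space borel bidisk)"
  by (simp add: area_measure_def)

lemma measurable_jac: "jac \<in> borel_measurable leaf_measure"
  by (rule borel_measurable_leaf_measure_continuous[OF continuous_on_jac])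

lemma integral_area_measure:
  fixes h :: "C2 \<Rightarrow> complex"
  assumes "h \<in> borel_measurable area_measure"
  shows "(\<integral>p. h p \<partial>area_measure) = (\<integral>x. of_real (jac x) * h (leaf_map x) \<partial>leaf_measure)"
proof -
  have h: "h \<in> borel_measurable (restrict_space borel bidisk)"
    using assms by (simp add: measurable_cong_sets[OF sets_area_measure refl])
  have "(\<integral>p. h p \<partial>area_measure) = (\<integral>x. h (leaf_map x) \<partial>density leaf_measure (\<lambda>x. ennreal (jac x)))"
    unfolding area_measure_def using measurable_leaf_map h by (intro integral_distr) simp_all
  also have "\<dots> = (\<integral>x. jac x *\<^sub>R h (leaf_map x) \<partial>leaf_measure)"
    using measurable_compose[OF measurable_leaf_map h] measurable_jac
    by (intro integral_density) (simp_all add: jac_nonneg)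
  finally show ?thesis by (simp add: scaleR_conv_of_real)
qed

lemma integrable_area_measure_iff:
  fixes h :: "C2 \<Rightarrow> complex"
  assumes "h \<in> borel_measurable area_measure"
  shows "integrable area_measure h \<longleftrightarrow> integrable leaf_measure (\<lambda>x. of_real (jac x) * h (leaf_map x))"
proof -
  have h: "h \<in> borel_measurable (restrict_space borel bidisk)"
    using assms by (simp add: measurable_cong_sets[OF sets_area_measure refl])
  have "integrable area_measure h \<longleftrightarrow> integrable (density leaf_measure (\<lambda>x. ennreal (jac x))) (\<lambda>x. h (leaf_map x))"
    unfolding area_measure_def using measurable_leaf_map h by (intro integrable_distr_eq) simp_all
  also have "\<dots> \<longleftrightarrow> integrable leaf_measure (\<lambda>x. jac x *\<^sub>R h (leaf_map x))"
    using measurable_compose[OF measurable_leaf_map h] measurable_jac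
    by (intro integrable_density) (simp_all add: jac_nonneg)
  finally show ?thesis by (simp add: scaleR_conv_of_real)
qed

text \<open>Slopes may be unbounded near the boundary of the disk, so finiteness is local: over a
  compact set \<open>jac\<close> is bounded by continuity on a smaller cylinder.\<close>

lemma emeasure_area_measure_compact:
  assumes K: "compact K" "K \<subseteq> bidisk"
  shows "emeasure area_measure K < \<infinity>"
proof -
  obtain r where r: "0 \<le> r" "r < 1" "K \<subseteq> cball 0 r \<times> unit_disk" by (rule compact_subset_bidiskE[OF K])
  have Ks: "K \<in> sets (restrict_space borel bidisk)"
    using K by (auto simp: sets_restrict_space_iff open_Times intro!: borel_closed compact_imp_closed)
  have sub: "cball 0 r \<times> \<tau> \<subseteq> unit_disk \<times> \<tau>" using r by auto
  have "compact (jac ` (cball 0 r \<times> \<tau>))"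
    by (intro compact_continuous_image continuous_on_subset[OF continuous_on_jac sub] compact_Times compact_cball compact_\<tau>)
  then obtain C where C: "\<And>x. x \<in> cball 0 r \<times> \<tau> \<Longrightarrow> norm (jac x) \<le> C"
    using compact_imp_bounded bounded_iff by (metis imageI)
  let ?A = "leaf_map -` K \<inter> space leaf_measure"
  have A: "?A \<in> sets leaf_measure" by (rule measurable_sets[OF measurable_leaf_map Ks])
  have "emeasure area_measure K = (\<integral>\<^sup>+x. ennreal (jac x) * indicator ?A x \<partial>leaf_measure)"
    unfolding area_measure_def using measurable_leaf_map Ks A measurable_jac
    by (subst emeasure_distr) (auto intro: emeasure_density)
  also have "\<dots> \<le> (\<integral>\<^sup>+x. ennreal C \<partial>leaf_measure)"
  proof (rule nn_integral_mono)
    fix x assume x: "x \<in> space leaf_measure"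
    show "ennreal (jac x) * indicator ?A x \<le> ennreal C"
    proof (cases "x \<in> ?A")
      case True
      then have "x \<in> cball 0 r \<times> \<tau>" using r(3) by (auto simp: leaf_map_def space_leaf_measure)
      then show ?thesis using C[of x] True by (auto intro!: ennreal_leI)
    qed auto
  qed
  also have "\<dots> < \<infinity>"
  proof -
    have "emeasure leaf_measure (space leaf_measure) < top"
      by (metis leaf_measure.emeasure_finite infinity_ennreal_def less_top)
    then show ?thesis by (simp add: ennreal_mult_less_top)
  qed
  finally show ?thesis .
qed

lemma borel_measurable_area_measure_continuous:
  "continuous_on UNIV h \<Longrightarrow> h \<in> borel_measurable area_measure" for h :: "C2 \<Rightarrow> complex"
  unfolding measurable_cong_sets[OF sets_area_measure refl]
  by (intro measurable_restrict_space1 borel_measurable_continuous_onI)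

lemma test_function_continuous: "test_function h \<Longrightarrow> continuous_on UNIV h"
  by (auto simp: test_function_def smooth_iff_smooth_on intro: smooth_on_imp_continuous_on)

lemma pullback_kaehler: "pullback (\<lambda>p u v. h p * of_real (kaehler_form u v)) x = of_real (jac x) * h (leaf_map x)"
proof -
  have "kaehler_form (1, m) (\<i>, \<i> * m) = 1 + (norm m)\<^sup>2" for m
    unfolding kaehler_form_def cmod_power2 by (simp add: power2_eq_square)
  then show ?thesis by (simp add: pullback_def jac_def)
qed

lemma integral_area_measure_test_function:
  assumes "test_function h"
  shows "(\<integral>p. h p \<partial>area_measure) = laminar_current \<phi> \<mu> (\<lambda>p u v. h p * of_real (kaehler_form u v))"
proof -
  have "test_form2 (\<lambda>p u v. h p * of_real (kaehler_form u v))"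
    using bilinear_kaehler_form(1)[of 1] by (intro test_form2_scale assms) (simp_all add: bilinear_kaehler_form(2))
  then show ?thesis
    by (simp add: laminar_current_eq pullback_kaehler integral_area_measure
        borel_measurable_area_measure_continuous test_function_continuous assms)
qed

text \<open>Bumps are test functions, so the defining property prescribes their integrals, and these
  determine a locally finite measure.\<close>

lemma trace_measure_eq: "trace_measure (laminar_current \<phi> \<mu>) = area_measure"
  unfolding trace_measure_def
proof (rule the_equality)
  show "sets area_measure = sets (restrict_space borel bidisk) \<and>
     (\<forall>K. compact K \<and> K \<subseteq> bidisk \<longrightarrow> emeasure area_measure K < \<infinity>) \<and>
     (\<forall>h. test_function h \<longrightarrow>
        (\<integral>p. h p \<partial>area_measure) = laminar_current \<phi> \<mu> (\<lambda>p u v. h p * of_real (kaehler_form u v)))"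
    using sets_area_measure emeasure_area_measure_compact integral_area_measure_test_function by blast
next
  fix \<sigma> :: "C2 measure"
  assume *: "sets \<sigma> = sets (restrict_space borel bidisk) \<and>
     (\<forall>K. compact K \<and> K \<subseteq> bidisk \<longrightarrow> emeasure \<sigma> K < \<infinity>) \<and>
     (\<forall>h. test_function h \<longrightarrow>
        (\<integral>p. h p \<partial>\<sigma>) = laminar_current \<phi> \<mu> (\<lambda>p u v. h p * of_real (kaehler_form u v)))"
  show "\<sigma> = area_measure"
  proof (rule measure_eqI_bump_integrals[of _ bidisk])
    show "open bidisk" by (intro open_Times open_ball)
    show "(\<integral>x. complex_of_real (box_bump a b n x) \<partial>\<sigma>) = (\<integral>x. complex_of_real (box_bump a b n x) \<partial>area_measure)"
      if "cbox a b \<subseteq> bidisk" for a b n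
      using * integral_area_measure_test_function test_function_box_bump[OF that] by metis
  qed (use * sets_area_measure emeasure_area_measure_compact in auto)
qed

end

section \<open>The density of 2-vectors and multiplication by a function\<close>

context laminar
begin

text \<open>Coordinates of the tensor of \<open>(1, m)\<close> and \<open>(\<i>, \<i> * m)\<close>,
  with \<open>m\<close> the leaf slope, divided by the area \<open>1 + (norm m)\<^sup>2\<close> so
  as to cancel \<open>jac\<close>. It is not antisymmetrized: by bilinearity its pairing with a form
  already is the value on these two vectors.\<close>

definition tangent_density :: "C2 \<Rightarrow> C2 \<Rightarrow> C2 \<Rightarrow> complex" where
  "tangent_density p a b = (if p \<in> leaf_map ` (unit_disk \<times> \<tau>)
     then of_real (((1, leaf_slope p) \<bullet> a) * ((\<i>, \<i> * leaf_slope p) \<bullet> b) / (1 + (norm (leaf_slope p))\<^sup>2)) else 0)"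

lemma measurable_tangent_density: "(\<lambda>p. tangent_density p a b) \<in> borel_measurable area_measure"
proof -
  have pos: "1 + (norm m)\<^sup>2 \<noteq> 0" for m :: complex
    by (metis add_pos_nonneg less_irrefl zero_le_power2 zero_less_one)
  have "continuous_on UNIV (\<lambda>m::complex. complex_of_real (((1, m) \<bullet> a) * ((\<i>, \<i> * m) \<bullet> b) / (1 + (norm m)\<^sup>2)))"
    by (intro continuous_intros ballI pos)
  from borel_measurable_comp_leaf_slope[OF this] show ?thesis
    unfolding measurable_cong_sets[OF sets_area_measure refl] tangent_density_def
    by (rule measurable_restrict_space1)
qed

lemma norm_tangent_density_le_1:
  assumes "a \<in> Basis" "b \<in> Basis"
  shows "norm (tangent_density p a b) \<le> 1"
proof -
  have "\<bar>((1, m) \<bullet> a) * ((\<i>, \<i> * m) \<bullet> b)\<bar> \<le> 1 + (norm m)\<^sup>2" for m :: complex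
  proof -
    have "\<bar>((1, m) \<bullet> a)\<bar> \<le> norm (1::complex, m)" "\<bar>((\<i>, \<i> * m) \<bullet> b)\<bar> \<le> norm (\<i>, \<i> * m)"
      using assms by (auto intro: Basis_le_norm)
    then have "\<bar>((1, m) \<bullet> a)\<bar> * \<bar>((\<i>, \<i> * m) \<bullet> b)\<bar> \<le> norm (1::complex, m) * norm (\<i>, \<i> * m)"
      by (intro mult_mono) auto
    also have "\<dots> = 1 + (norm m)\<^sup>2" by (simp add: norm_Pair norm_mult)
    finally show ?thesis by (simp add: abs_mult)
  qed
  note bound = this
  have pos: "0 < 1 + (norm m)\<^sup>2" for m :: complex by (simp add: add_pos_nonneg)
  show ?thesis
  proof (cases "p \<in> leaf_map ` (unit_disk \<times> \<tau>)")
    case True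
    then have "norm (tangent_density p a b)
        = \<bar>((1, leaf_slope p) \<bullet> a) * ((\<i>, \<i> * leaf_slope p) \<bullet> b)\<bar> / (1 + (norm (leaf_slope p))\<^sup>2)"
      by (simp only: tangent_density_def if_True norm_of_real abs_divide abs_of_pos[OF pos])
    then show ?thesis using bound[of "leaf_slope p"] pos[of "leaf_slope p"] by (simp only: divide_le_eq_1_pos)
  qed (simp add: tangent_density_def)
qed

lemma vec_pairing_tangent_density:
  assumes "bilinear \<omega>" "x \<in> unit_disk \<times> \<tau>"
  shows "of_real (jac x) * vec_pairing (tangent_density (leaf_map x)) \<omega> = \<omega> (1, slope x) (\<i>, \<i> * slope x)"
proof -
  have j: "complex_of_real (jac x) \<noteq> 0" using jac_ge_1[of x] by (metis not_one_le_zero of_real_eq_0_iff)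
  have "of_real (jac x) * (tangent_density (leaf_map x) a b * \<omega> a b)
      = of_real (((1, slope x) \<bullet> a) * ((\<i>, \<i> * slope x) \<bullet> b)) * \<omega> a b" for a b
  proof -
    have "tangent_density (leaf_map x) a b = of_real (((1, slope x) \<bullet> a) * ((\<i>, \<i> * slope x) \<bullet> b)) / of_real (jac x)"
      using assms(2) unfolding tangent_density_def leaf_slope_leaf_map[OF assms(2)] jac_def by simp
    then show ?thesis using j by simp
  qed
  note eq = this
  show ?thesis
    unfolding bilinear_expand_Basis[OF assms(1), of "(1, slope x)"] vec_pairing_def sum_distrib_left
    by (intro sum.cong refl eq)
qed

lemma test_form2_bilinear: "test_form2 \<psi> \<Longrightarrow> bilinear (\<psi> p)"
  unfolding test_form2_def by blast

lemma test_form2_measurable: "test_form2 \<psi> \<Longrightarrow> (\<lambda>p. \<psi> p u v) \<in> borel_measurable area_measure"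
  by (intro borel_measurable_area_measure_continuous test_form2_continuous)

lemma integral_tangent_density:
  assumes \<psi>: "test_form2 \<psi>" and f: "f \<in> borel_measurable area_measure"
  shows "(\<integral>p. f p * vec_pairing (tangent_density p) (\<psi> p) \<partial>area_measure) = (\<integral>x. f (leaf_map x) * pullback \<psi> x \<partial>leaf_measure)"
proof -
  have "(\<lambda>p. f p * vec_pairing (tangent_density p) (\<psi> p)) \<in> borel_measurable area_measure"
    unfolding vec_pairing_def
    by (intro borel_measurable_times f borel_measurable_sum measurable_tangent_density test_form2_measurable[OF \<psi>])
  then have "(\<integral>p. f p * vec_pairing (tangent_density p) (\<psi> p) \<partial>area_measure)
      = (\<integral>x. of_real (jac x) * (f (leaf_map x) * vec_pairing (tangent_density (leaf_map x)) (\<psi> (leaf_map x))) \<partial>leaf_measure)"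
    by (rule integral_area_measure)
  also have "\<dots> = (\<integral>x. f (leaf_map x) * pullback \<psi> x \<partial>leaf_measure)"
  proof (rule Bochner_Integration.integral_cong[OF refl])
    fix x assume "x \<in> space leaf_measure"
    then have "of_real (jac x) * vec_pairing (tangent_density (leaf_map x)) (\<psi> (leaf_map x)) = pullback \<psi> x"
      unfolding pullback_def space_leaf_measure
      by (intro vec_pairing_tangent_density test_form2_bilinear[OF \<psi>])
    then show "of_real (jac x) * (f (leaf_map x) * vec_pairing (tangent_density (leaf_map x)) (\<psi> (leaf_map x)))
        = f (leaf_map x) * pullback \<psi> x" by (simp add: mult.left_commute)
  qed
  finally show ?thesis .
qed

lemma vec_density_tangent_density: "vec_density (laminar_current \<phi> \<mu>) tangent_density"
  unfolding vec_density_def trace_measure_eq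
proof (intro conjI ballI allI impI)
  show "(\<lambda>p. tangent_density p a b) \<in> borel_measurable area_measure" for a b
    by (rule measurable_tangent_density)
  show "\<exists>C. \<forall>p. \<forall>a\<in>Basis. \<forall>b\<in>Basis. norm (tangent_density p a b) \<le> C"
    using norm_tangent_density_le_1 by blast
  show "laminar_current \<phi> \<mu> \<psi> = (\<integral>p. vec_pairing (tangent_density p) (\<psi> p) \<partial>area_measure)" if "test_form2 \<psi>" for \<psi>
    using integral_tangent_density[OF that, of "\<lambda>_. 1"] laminar_current_eq[OF that] by simp
qed

text \<open>Only the antisymmetric part of a density is determined, which is all that forms see.\<close>

lemma vec_density_unique:
  assumes t: "vec_density (laminar_current \<phi> \<mu>) t" and a: "a \<in> Basis" and b: "b \<in> Basis"
  shows "AE p in area_measure. t p a b - t p b a = tangent_density p a b - tangent_density p b a"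
proof -
  \<comment> \<open>The constant form dual to \<open>a\<close> and \<open>b\<close>: its pairing
    with \<open>s\<close> extracts \<open>s a b - s b a\<close>, and bumps times it are test
    forms.\<close>
  define \<omega> where "\<omega> = (\<lambda>u v :: C2. complex_of_real ((u \<bullet> a) * (v \<bullet> b) - (u \<bullet> b) * (v \<bullet> a)))"
  have bil: "bilinear \<omega>" and alt: "\<omega> u u = 0" for u
    by (auto simp: \<omega>_def bilinear_def linear_iff inner_add_left inner_diff_left algebra_simps scaleR_conv_of_real)
  have pair: "vec_pairing s \<omega> = s a b - s b a" for s
  proof -
    have d: "(c \<bullet> e) = (if c = e then 1 else 0)" if "c \<in> Basis" "e \<in> Basis" for c e :: C2
      using that by (simp add: inner_Basis)
    have "vec_pairing s \<omega> = (\<Sum>c\<in>Basis. \<Sum>e\<in>Basis. (if c = a then if e = b then s c e else 0 else 0) - (if c = b then if e = a then s c e else 0 else 0))"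
      unfolding vec_pairing_def
    proof (intro sum.cong refl)
      fix c e :: C2 assume ce: "c \<in> Basis" "e \<in> Basis"
      show "s c e * \<omega> c e = (if c = a then if e = b then s c e else 0 else 0) - (if c = b then if e = a then s c e else 0 else 0)"
        unfolding \<omega>_def d[OF ce(1) a] d[OF ce(1) b] d[OF ce(2) a] d[OF ce(2) b] by auto
    qed
    also have "\<dots> = s a b - s b a"
      using a b by (simp add: sum_subtractf sum.If_cases if_distrib[of "sum _"] sum.delta cong: if_cong)
    finally show ?thesis .
  qed
  define X where "X = (\<lambda>p. (t p a b - t p b a) - (tangent_density p a b - tangent_density p b a))"
  have tm: "(\<lambda>p. t p c e) \<in> borel_measurable area_measure" if "c \<in> Basis" "e \<in> Basis" for c e
    using t that by (auto simp: vec_density_def trace_measure_eq)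
  have Xm: "X \<in> borel_measurable area_measure"
    unfolding X_def by (intro borel_measurable_diff tm measurable_tangent_density a b)
  obtain C where C: "\<And>p c e. c \<in> Basis \<Longrightarrow> e \<in> Basis \<Longrightarrow> norm (t p c e) \<le> C"
    using t unfolding vec_density_def by blast
  have Xb: "norm (X p) \<le> 2 * C + 2" for p
  proof -
    have "norm (X p) \<le> (norm (t p a b) + norm (t p b a)) + (norm (tangent_density p a b) + norm (tangent_density p b a))"
      unfolding X_def by (intro order_trans[OF norm_triangle_ineq4] add_mono norm_triangle_ineq4)
    then show ?thesis
      using C[OF a b, of p] C[OF b a, of p] norm_tangent_density_le_1[OF a b, of p] norm_tangent_density_le_1[OF b a, of p]
      by linarith
  qed
  have o: "open bidisk" by (intro open_Times open_ball)
  have intK: "integrable area_measure (\<lambda>p. indicator (cbox c e) p *\<^sub>R h p)"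
    if ce: "cbox c e \<subseteq> bidisk" and h: "h \<in> borel_measurable area_measure" "\<And>p. norm (h p) \<le> D" for c e and h :: "C2 \<Rightarrow> complex" and D
  proof (rule integrableI_bounded_set_indicator[where B = D])
    show "cbox c e \<in> sets area_measure"
      using ce by (auto simp: sets_area_measure sets_restrict_space_iff o)
    show "emeasure area_measure (cbox c e) < \<infinity>" using emeasure_area_measure_compact[OF compact_cbox ce] .
  qed (use h in auto)
  have "AE p in area_measure. X p = 0"
  proof (rule AE_zero_if_bump_integrals_zero[OF sets_area_measure o])
    show "emeasure area_measure K < \<infinity>" if "compact K" "K \<subseteq> bidisk" for K
      using emeasure_area_measure_compact that .
    show "set_integrable area_measure (cbox c e) X" if "cbox c e \<subseteq> bidisk" for c e
      unfolding set_integrable_def by (rule intK[OF that Xm Xb])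
    fix c e n assume ce: "cbox c e \<subseteq> bidisk"
    define h where "h = (\<lambda>p. complex_of_real (box_bump c e n p))"
    have h: "test_function h" unfolding h_def by (rule test_function_box_bump[OF ce])
    have \<psi>: "test_form2 (\<lambda>p u v. h p * \<omega> u v)" by (rule test_form2_scale[OF h bil alt])
    have hs: "vec_pairing s (\<lambda>u v. h p * \<omega> u v) = h p * (s a b - s b a)" for s p
      unfolding pair[symmetric] vec_pairing_def by (simp add: sum_distrib_left mult.left_commute)
    have hm: "h \<in> borel_measurable area_measure"
      by (intro borel_measurable_area_measure_continuous test_function_continuous h)
    have int: "integrable area_measure (\<lambda>p. h p * (s p a b - s p b a))"
      if "\<And>c e. c \<in> Basis \<Longrightarrow> e \<in> Basis \<Longrightarrow> (\<lambda>p. s p c e) \<in> borel_measurable area_measure"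
        "\<And>p c e. c \<in> Basis \<Longrightarrow> e \<in> Basis \<Longrightarrow> norm (s p c e) \<le> D" for s D
    proof -
      have "norm (h p * (s p a b - s p b a)) \<le> 1 * (D + D)" for p
        unfolding norm_mult
      proof (rule mult_mono)
        show "norm (h p) \<le> 1" using box_bump_nonneg[of c e n p] box_bump_le_1[of c e n p] by (simp add: h_def)
        show "norm (s p a b - s p b a) \<le> D + D"
          by (intro order_trans[OF norm_triangle_ineq4] add_mono that(2) a b)
      qed auto
      then have "integrable area_measure (\<lambda>p. indicator (cbox c e) p *\<^sub>R (h p * (s p a b - s p b a)))"
        by (intro intK[OF ce, of _ "1 * (D + D)"] borel_measurable_times hm borel_measurable_diff that(1) a b)
      moreover have "indicator (cbox c e) p *\<^sub>R (h p * (s p a b - s p b a)) = h p * (s p a b - s p b a)" for p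
        using box_bump_zero[of p c e n] box_subset_cbox[of c e] by (cases "p \<in> cbox c e") (auto simp: h_def)
      ultimately show ?thesis by simp
    qed
    have "(\<integral>p. h p * (t p a b - t p b a) \<partial>area_measure) = laminar_current \<phi> \<mu> (\<lambda>p u v. h p * \<omega> u v)"
      using t \<psi> by (simp add: vec_density_def trace_measure_eq hs)
    moreover have "(\<integral>p. h p * (tangent_density p a b - tangent_density p b a) \<partial>area_measure) = laminar_current \<phi> \<mu> (\<lambda>p u v. h p * \<omega> u v)"
      using vec_density_tangent_density \<psi> by (simp add: vec_density_def trace_measure_eq hs)
    moreover have "(\<integral>p. h p * X p \<partial>area_measure) = (\<integral>p. h p * (t p a b - t p b a) \<partial>area_measure)
        - (\<integral>p. h p * (tangent_density p a b - tangent_density p b a) \<partial>area_measure)"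
      unfolding X_def right_diff_distrib[of _ "_ - _" "_ - _"]
      by (rule Bochner_Integration.integral_diff[OF int[of t C] int[of tangent_density 1]])
         (use tm C measurable_tangent_density norm_tangent_density_le_1 in auto)
    ultimately show "(\<integral>p. of_real (box_bump c e n p) * X p \<partial>area_measure) = 0" by (simp add: h_def)
  qed
  then show ?thesis by (rule AE_mp) (auto simp: X_def)
qed

lemma vec_pairing_antisym:
  assumes "\<And>u v. \<omega> u v = - \<omega> v u"
  shows "vec_pairing s \<omega> = (\<Sum>a\<in>Basis. \<Sum>b\<in>Basis. (s a b - s b a) * \<omega> a b) / 2"
proof -
  have "(\<Sum>a\<in>Basis. \<Sum>b\<in>Basis. s b a * \<omega> a b) = (\<Sum>b\<in>Basis. \<Sum>a\<in>Basis. s b a * \<omega> a b)" by (rule sum.swap)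
  also have "\<dots> = - vec_pairing s \<omega>"
    unfolding vec_pairing_def sum_negf[symmetric] by (intro sum.cong refl) (metis assms mult_minus_right)
  finally have "(\<Sum>a\<in>Basis. \<Sum>b\<in>Basis. (s a b - s b a) * \<omega> a b) = vec_pairing s \<omega> + vec_pairing s \<omega>"
    unfolding left_diff_distrib sum_subtractf by (simp add: vec_pairing_def)
  then show ?thesis by simp
qed

lemma test_form2_antisym: "test_form2 \<psi> \<Longrightarrow> \<psi> p u v = - \<psi> p v u"
proof -
  assume \<psi>: "test_form2 \<psi>"
  have z: "\<psi> p w w = 0" for w using \<psi> unfolding test_form2_def by blast
  have l: "linear (\<lambda>x. \<psi> p x y)" "linear (\<psi> p y)" for y
    using test_form2_bilinear[OF \<psi>, of p] unfolding bilinear_def by blast+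
  have "\<psi> p (u + v) (u + v) = \<psi> p u u + \<psi> p u v + (\<psi> p v u + \<psi> p v v)"
    using linear_add[OF l(1)] linear_add[OF l(2)] by simp
  then show ?thesis using z by (simp add: eq_neg_iff_add_eq_0)
qed

text \<open>The density chosen by \<open>SOME\<close> is known to agree with
  \<open>tangent_density\<close> only almost everywhere and in its antisymmetric part; forms are
  alternating, so the pairing and its integral are the same.\<close>

lemma mult_current_eq:
  assumes f: "f \<in> borel_measurable (trace_measure (laminar_current \<phi> \<mu>))" and \<psi>: "test_form2 \<psi>"
  shows "mult_current f (laminar_current \<phi> \<mu>) \<psi> = (\<integral>x. f (leaf_map x) * pullback \<psi> x \<partial>leaf_measure)"
proof -
  define t where "t = (SOME t. vec_density (laminar_current \<phi> \<mu>) t)"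
  have t: "vec_density (laminar_current \<phi> \<mu>) t"
    unfolding t_def by (rule someI[of _ tangent_density]) (rule vec_density_tangent_density)
  have fm: "f \<in> borel_measurable area_measure" using f by (simp add: trace_measure_eq)
  have tm: "(\<lambda>p. t p c e) \<in> borel_measurable area_measure" if "c \<in> Basis" "e \<in> Basis" for c e
    using t that by (auto simp: vec_density_def trace_measure_eq)
  have "AE p in area_measure. \<forall>a\<in>Basis. \<forall>b\<in>Basis. t p a b - t p b a = tangent_density p a b - tangent_density p b a"
    using vec_density_unique[OF t] by (intro AE_finite_allI finite_Basis)
  then have AE: "AE p in area_measure. f p * vec_pairing (t p) (\<psi> p) = f p * vec_pairing (tangent_density p) (\<psi> p)"
    by (rule AE_mp) (auto intro!: AE_I2 simp: vec_pairing_antisym[OF test_form2_antisym[OF \<psi>]])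
  have "mult_current f (laminar_current \<phi> \<mu>) \<psi> = (\<integral>p. f p * vec_pairing (t p) (\<psi> p) \<partial>area_measure)"
    by (simp add: mult_current_def t_def trace_measure_eq)
  also have "\<dots> = (\<integral>p. f p * vec_pairing (tangent_density p) (\<psi> p) \<partial>area_measure)"
  proof (rule integral_cong_AE[OF _ _ AE])
    show "(\<lambda>p. f p * vec_pairing (t p) (\<psi> p)) \<in> borel_measurable area_measure"
      unfolding vec_pairing_def
      by (intro borel_measurable_times fm borel_measurable_sum tm test_form2_measurable[OF \<psi>])
    show "(\<lambda>p. f p * vec_pairing (tangent_density p) (\<psi> p)) \<in> borel_measurable area_measure"
      unfolding vec_pairing_def
      by (intro borel_measurable_times fm borel_measurable_sum measurable_tangent_density test_form2_measurable[OF \<psi>])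
  qed
  finally show ?thesis by (simp add: integral_tangent_density[OF \<psi> fm])
qed

end

section \<open>Closed currents with measurable density\<close>

lemma frechet_derivative_eq_0:
  assumes "closed K" "\<forall>x. x \<notin> K \<longrightarrow> f x = 0" "x \<notin> K"
  shows "frechet_derivative f (at x) v = 0"
proof -
  have "((\<lambda>_. 0) has_derivative (\<lambda>_. 0)) (at x)" by simp
  then have "(f has_derivative (\<lambda>_. 0)) (at x)"
    by (rule has_derivative_transform_within_open[where s = "- K"])
       (use assms in \<open>auto simp: open_Compl\<close>)
  then show ?thesis by (simp add: frechet_derivative_eqI)
qed

text \<open>\<open>mult_current\<close> is identified on test forms; this is what allows closedness
  to be rewritten as an integral over the product.\<close>

lemma test_form2_ext_deriv:
  assumes \<theta>: "test_form1 \<theta>"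
  shows "test_form2 (ext_deriv \<theta>)"
proof -
  have lin: "linear (\<theta> p)" for p using \<theta> unfolding test_form1_def by blast
  have sm: "smooth_on UNIV (\<lambda>p. \<theta> p w)" for w
    using \<theta> unfolding test_form1_def smooth_iff_smooth_on by blast
  obtain K where K: "compact K" "K \<subseteq> bidisk" "\<And>p u. p \<notin> K \<Longrightarrow> \<theta> p u = 0"
    using \<theta> unfolding test_form1_def by blast
  let ?D = "\<lambda>w p. frechet_derivative (\<lambda>q. \<theta> q w) (at p)"
  have d: "((\<lambda>q. \<theta> q w) has_derivative ?D w p) (at p)" for w p
    by (rule smooth_on_has_derivative[OF sm]) simp
  have linD: "linear (?D w p)" for w p by (rule has_derivative_linear[OF d])
  have add: "?D (w + w') p = (\<lambda>u. ?D w p u + ?D w' p u)" for w w' p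
    using has_derivative_add[OF d[of w p] d[of w' p]]
    by (intro frechet_derivative_eqI) (simp add: linear_add[OF lin])
  have cmul: "?D (c *\<^sub>R w) p = (\<lambda>u. c *\<^sub>R ?D w p u)" for c w p
    using has_derivative_scaleR_right[OF d[of w p], of c]
    by (intro frechet_derivative_eqI) (simp add: linear_cmul[OF lin])
  show ?thesis unfolding test_form2_def
  proof (intro conjI allI)
    show "bilinear (ext_deriv \<theta> p)" for p
      unfolding bilinear_def linear_iff ext_deriv_def add cmul linear_add[OF linD] linear_cmul[OF linD]
      by (simp add: scaleR_diff_right)
    show "ext_deriv \<theta> p u u = 0" for p u by (simp add: ext_deriv_def)
    show "smooth (\<lambda>p. ext_deriv \<theta> p u w)" for u w
      unfolding ext_deriv_def smooth_iff_smooth_on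
      by (rule smooth_on_diff[OF open_UNIV smooth_on_frechet_derivative[OF sm] smooth_on_frechet_derivative[OF sm]])
    have "ext_deriv \<theta> p u w = 0" if "p \<notin> K" for p u w
      unfolding ext_deriv_def using K(3) that
      by (simp add: frechet_derivative_eq_0[OF compact_imp_closed[OF K(1)]])
    then show "\<exists>K. compact K \<and> K \<subseteq> bidisk \<and> (\<forall>p u w. p \<notin> K \<longrightarrow> ext_deriv \<theta> p u w = 0)"
      using K(1,2) by blast
  qed
qed

section \<open>Leafwise consequences of closedness and positivity\<close>

locale closed_laminar = laminar +
  fixes F :: "complex \<times> complex \<Rightarrow> complex"
  assumes F_measurable: "F \<in> borel_measurable leaf_measure"
    and F_integrable: "\<And>r. r < 1 \<Longrightarrow> set_integrable leaf_measure (cball 0 r \<times> \<tau>) F"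
    and F_closed: "\<And>\<theta>. test_form1 \<theta> \<Longrightarrow> (\<integral>x. F x * pullback (ext_deriv \<theta>) x \<partial>leaf_measure) = 0"
    and F_positive: "\<And>\<psi>. test_form2 \<psi> \<Longrightarrow> positive_form \<psi> \<Longrightarrow> (\<integral>x. F x * pullback \<psi> x \<partial>leaf_measure) \<in> \<real>\<^sub>\<ge>\<^sub>0"
begin

lemma integrable_F_continuous:
  fixes g :: "complex \<Rightarrow> real"
  assumes "continuous_on UNIV g" "\<And>z. r < norm z \<Longrightarrow> g z = 0" "r < 1"
  shows "integrable leaf_measure (\<lambda>x. F x * of_real (g (fst x)))"
proof (rule integrable_leaf_cutoff[OF F_measurable F_integrable[OF assms(3)] assms(3)])
  show "continuous_on (unit_disk \<times> \<tau>) (\<lambda>x. complex_of_real (g (fst x)))"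
    by (intro continuous_intros continuous_on_compose2[OF assms(1)]) auto
qed (use assms(2) in auto)

text \<open>The cutoff \<open>\<kappa>\<close> is 1 near the leaves, so that it does not contribute to derivatives there.\<close>

lemma cutoff_product:
  fixes \<rho> :: "complex \<Rightarrow> real" and G :: "C2 \<Rightarrow> real"
  assumes \<rho>: "smooth_on UNIV \<rho>" "\<forall>z. r < norm z \<longrightarrow> \<rho> z = 0" "r < 1" and G: "smooth_on bidisk G" "\<And>p. 0 \<le> G p"
  shows "\<exists>h K. smooth h \<and> compact K \<and> K \<subseteq> bidisk \<and> (\<forall>p. p \<notin> K \<longrightarrow> h p = 0) \<and>
    (\<forall>p. 0 \<le> \<rho> (fst p) \<longrightarrow> 0 \<le> h p) \<and>
    (\<forall>p \<in> unit_disk \<times> cball 0 height. h p = \<rho> (fst p) * G p) \<and>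
    (\<forall>p \<in> unit_disk \<times> cball 0 height. (h has_derivative
        (\<lambda>u. \<rho> (fst p) * frechet_derivative G (at p) u + frechet_derivative \<rho> (at (fst p)) (fst u) * G p)) (at p))"
proof -
  \<comment> \<open>They cut the interval from \<open>height\<close> to 1 into thirds:
    \<open>\<kappa>\<close> is 1 on a neighbourhood of the leaves, with support in the open
    disk.\<close>
  define s s' where "s = (2 * height + 1) / 3" and "s' = (height + 2) / 3"
  have s: "0 \<le> s" "height < s" "s < s'" "s' < 1" using height(1,2) by (auto simp: s_def s'_def)
  obtain \<kappa> :: "complex \<Rightarrow> real" where \<kappa>: "smooth_on UNIV \<kappa>" "\<And>x. 0 \<le> \<kappa> x"
    "\<And>x. norm x \<le> s \<Longrightarrow> \<kappa> x = 1" "\<And>x. norm x \<ge> s' \<Longrightarrow> \<kappa> x = 0"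
    using smooth_cutoff_exists[OF s(1,3)] by metis
  define h where "h = (\<lambda>p. \<rho> (fst p) * \<kappa> (snd p) * G p)"
  define K where "K = cball (0::complex) r \<times> cball (0::complex) s'"
  have K: "compact K" "K \<subseteq> bidisk" using \<rho>(3) s(4) by (auto simp: K_def compact_Times)
  have o: "open bidisk" by (intro open_Times open_ball)
  have off: "h p = 0" if "p \<notin> K" for p
    using that \<rho>(2)[rule_format, of "fst p"] \<kappa>(4)[of "snd p"] by (auto simp: h_def K_def mem_Times_iff)
  have fstsm: "smooth_on bidisk (\<lambda>p. \<rho> (fst p))"
    by (rule smooth_on_compose[where g = \<rho> and f = fst, OF o open_UNIV _ smooth_on_bounded_linear[OF bounded_linear_fst o] \<rho>(1)]) simp
  have sndsm: "smooth_on bidisk (\<lambda>p. \<kappa> (snd p))"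
    by (rule smooth_on_compose[where g = \<kappa> and f = snd, OF o open_UNIV _ smooth_on_bounded_linear[OF bounded_linear_snd o] \<kappa>(1)]) simp
  have "smooth_on bidisk h" unfolding h_def by (intro smooth_on_mult o fstsm sndsm G(1))
  then have "smooth h" using smooth_on_zero_extension[OF o compact_imp_closed[OF K(1)] K(2)] off by blast
  moreover have eq: "h p = \<rho> (fst p) * G p" if "p \<in> unit_disk \<times> ball 0 s" for p
    using that \<kappa>(3)[of "snd p"] by (auto simp: h_def mem_Times_iff)
  moreover have sub: "p \<in> unit_disk \<times> ball 0 s" if "p \<in> unit_disk \<times> cball 0 height" for p
    using that s by (auto simp: mem_Times_iff)
  moreover have "(h has_derivative
        (\<lambda>u. \<rho> (fst p) * frechet_derivative G (at p) u + frechet_derivative \<rho> (at (fst p)) (fst u) * G p)) (at p)"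
    if p: "p \<in> unit_disk \<times> ball 0 s" for p
  proof -
    have pb: "p \<in> bidisk" using p s by (auto simp: mem_Times_iff)
    have d\<rho>: "(\<rho> has_derivative frechet_derivative \<rho> (at (fst p))) (at (fst p))"
      by (rule smooth_on_has_derivative[OF \<rho>(1)]) simp
    have "((\<lambda>p. \<rho> (fst p)) has_derivative (\<lambda>u. frechet_derivative \<rho> (at (fst p)) (fst u))) (at p)"
      by (rule diff_chain_at[OF bounded_linear_imp_has_derivative[OF bounded_linear_fst] d\<rho>, unfolded o_def])
    then have "((\<lambda>p. \<rho> (fst p) * G p) has_derivative
        (\<lambda>u. \<rho> (fst p) * frechet_derivative G (at p) u + frechet_derivative \<rho> (at (fst p)) (fst u) * G p)) (at p)"
      by (rule has_derivative_mult[OF _ smooth_on_has_derivative[OF G(1) pb]])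
    then show ?thesis
      by (rule has_derivative_transform_within_open[OF _ _ p]) (use eq in \<open>auto intro: open_Times\<close>)
  qed
  moreover have "0 \<le> h p" if "0 \<le> \<rho> (fst p)" for p
    using that \<kappa>(2) G(2) by (simp add: h_def)
  ultimately show ?thesis using K off by (intro exI[of _ h] exI[of _ K]) blast
qed

lemma leaf_map_in_strip: "x \<in> unit_disk \<times> \<tau> \<Longrightarrow> leaf_map x \<in> unit_disk \<times> cball 0 height"
  using leaf_map_bounds[of x] by (auto simp: mem_Times_iff)

text \<open>On a leaf with coordinate \<open>z = x + \<i> y\<close>, the 1-form is
  \<open>h (Re v dy - Im v dx)\<close>, and its differential is the derivative of \<open>h\<close>
  along the leaf in direction \<open>v\<close>, times \<open>dx \<and> dy\<close>.\<close>

lemma ext_deriv_test_form: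
  fixes h :: "C2 \<Rightarrow> real" and v :: complex
  assumes h: "smooth h" "compact K" "K \<subseteq> bidisk" "\<forall>p. p \<notin> K \<longrightarrow> h p = 0"
  defines "\<theta> \<equiv> \<lambda>p u. complex_of_real (h p * Im (cnj v * fst u))"
  shows "test_form1 \<theta>" "test_form2 (ext_deriv \<theta>)"
    "pullback (ext_deriv \<theta>) x = of_real (frechet_derivative h (at (leaf_map x)) (v, slope x * v))"
proof -
  have smh: "smooth_on UNIV h" using h(1) by (simp add: smooth_iff_smooth_on)
  let ?D = "\<lambda>p. frechet_derivative h (at p)"
  have dh: "(h has_derivative ?D p) (at p)" for p by (rule smooth_on_has_derivative[OF smh]) simp
  have lin: "linear (?D p)" for p by (rule has_derivative_linear[OF dh])
  define l where "l = (\<lambda>u::C2. Im (cnj v * fst u))"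
  have l: "l (x + y) = l x + l y" "l (r *\<^sub>R x) = r * l x" for x y r
    by (simp_all add: l_def algebra_simps)
  have \<theta>: "\<theta> p u = of_real (h p * l u)" for p u by (simp add: \<theta>_def l_def)
  have ext: "ext_deriv \<theta> p u w = of_real (?D p u * l w - ?D p w * l u)" for p u w
  proof -
    have "((\<lambda>q. \<theta> q w) has_derivative (\<lambda>u. of_real (?D p u * l w))) (at p)" for w
      unfolding \<theta> by (auto intro!: derivative_eq_intros dh)
    then have "frechet_derivative (\<lambda>q. \<theta> q w) (at p) = (\<lambda>u. of_real (?D p u * l w))" for w
      by (rule frechet_derivative_eqI)
    then show ?thesis unfolding ext_deriv_def by simp
  qed
  show t1: "test_form1 \<theta>" unfolding test_form1_def
  proof (intro conjI allI)
    show "linear (\<theta> p)" for p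
      by (simp add: \<theta> linear_iff l distrib_left scaleR_conv_of_real mult_ac)
    show "smooth (\<lambda>p. \<theta> p u)" for u
      unfolding \<theta> smooth_iff_smooth_on by (intro smooth_on_of_real smooth_on_mult smooth_on_const smh open_UNIV)
    show "\<exists>K. compact K \<and> K \<subseteq> bidisk \<and> (\<forall>p u. p \<notin> K \<longrightarrow> \<theta> p u = 0)"
      using h by (intro exI[of _ K]) (auto simp: \<theta>)
  qed
  show "test_form2 (ext_deriv \<theta>)" by (rule test_form2_ext_deriv[OF t1])
  have "(v, slope x * v) = Re v *\<^sub>R (1, slope x) + Im v *\<^sub>R (\<i>, \<i> * slope x)"
    by (simp add: complex_eq_iff algebra_simps)
  then have "?D p (v, slope x * v) = ?D p (Re v *\<^sub>R (1, slope x) + Im v *\<^sub>R (\<i>, \<i> * slope x))" for p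
    by (simp only:)
  then have "?D p (v, slope x * v) = Re v * ?D p (1, slope x) + Im v * ?D p (\<i>, \<i> * slope x)" for p
    by (simp only: linear_add[OF lin] linear_cmul[OF lin] real_scaleR_def)
  then show "pullback (ext_deriv \<theta>) x = of_real (?D (leaf_map x) (v, slope x * v))"
    by (simp add: pullback_def ext l_def mult.commute)
qed

text \<open>On a leaf the differential of the test form has two terms. The one with the derivative
  of \<open>\<rho>\<close> converges to the integrand, since \<open>G n\<close> tends to the
  indicator of \<open>E\<close>; the one with the derivative of \<open>G n\<close> is of order
  \<open>1 / n\<close>. \<open>C\<close> bounds the leafwise derivatives of all \<open>G n\<close>
  and so provides an integrable majorant.\<close>

lemma leafwise_closed:
  fixes \<rho> :: "complex \<Rightarrow> real"
  assumes \<rho>: "smooth_on UNIV \<rho>" "\<And>z. r < norm z \<Longrightarrow> \<rho> z = 0" "r < 1" and E: "compact E" "E \<subseteq> \<tau>"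
  shows "(\<integral>x. F x * of_real (frechet_derivative \<rho> (at (fst x)) v * indicator E (snd x)) \<partial>leaf_measure) = 0"
proof -
  obtain G :: "nat \<Rightarrow> C2 \<Rightarrow> real" where G:
    "\<And>n. smooth_on bidisk (G n)" "\<And>n p. 0 \<le> G n p" "\<And>n p. G n p \<le> 1"
    "\<And>a z. a \<in> \<tau> \<Longrightarrow> norm z \<le> r \<Longrightarrow> (\<lambda>n. G n (z, \<phi> a z)) \<longlonglongrightarrow> indicator E a"
    "\<And>n a z v. a \<in> \<tau> \<Longrightarrow> norm z \<le> r \<Longrightarrow>
      \<bar>frechet_derivative (G n) (at (z, \<phi> a z)) (v, deriv (\<phi> a) z * v)\<bar> \<le> 2 / (1 - r) * norm v / real (Suc n)"
    using leaf_cutoff_functions[OF E \<rho>(3)] by metis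
  define C where "C = 2 / (1 - r) * norm v"
  have C: "0 \<le> C" using \<rho>(3) by (simp add: C_def)
  let ?A = "\<lambda>z. frechet_derivative \<rho> (at z) v"
  let ?B = "\<lambda>n x. frechet_derivative (G n) (at (leaf_map x)) (v, slope x * v)"
  have A0: "?A z = 0" if "r < norm z" for z
    by (rule frechet_derivative_eq_0[of "cball 0 r"]) (use that \<rho>(2) in auto)
  have Acont: "continuous_on UNIV ?A"
    by (rule smooth_on_imp_continuous_on[OF smooth_on_frechet_derivative[OF \<rho>(1)]])
  have \<rho>0: "\<forall>z. r < norm z \<longrightarrow> \<rho> z = 0" using \<rho>(2) by blast
  have \<rho>cont: "continuous_on UNIV \<rho>" by (rule smooth_on_imp_continuous_on[OF \<rho>(1)])
  define I where "I = (\<lambda>n x. F x * of_real (?A (fst x) * G n (leaf_map x) + \<rho> (fst x) * ?B n x))"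
  have I: "I n \<in> borel_measurable leaf_measure \<and> integral\<^sup>L leaf_measure (I n) = 0" for n
  proof -
    obtain h K where h0: "smooth h" "compact K" "K \<subseteq> bidisk" "\<forall>p. p \<notin> K \<longrightarrow> h p = 0"
      and hpos: "\<forall>p. 0 \<le> \<rho> (fst p) \<longrightarrow> 0 \<le> h p"
      and hG: "\<forall>p \<in> unit_disk \<times> cball 0 height. h p = \<rho> (fst p) * G n p"
      and dh: "\<forall>p \<in> unit_disk \<times> cball 0 height. (h has_derivative
        (\<lambda>u. \<rho> (fst p) * frechet_derivative (G n) (at p) u + frechet_derivative \<rho> (at (fst p)) (fst u) * G n p)) (at p)"
      using cutoff_product[OF \<rho>(1) \<rho>0 \<rho>(3) G(1)[of n] G(2)[of n]] by (elim exE conjE) (rule that)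
    define \<theta> where "\<theta> = (\<lambda>p (u::C2). complex_of_real (h p * Im (cnj v * fst u)))"
    note ext = ext_deriv_test_form[OF h0, of v, folded \<theta>_def]
    have eq: "F x * pullback (ext_deriv \<theta>) x = I n x" if x: "x \<in> space leaf_measure" for x
      using frechet_derivative_eqI[OF dh[rule_format, OF leaf_map_in_strip]] x
      unfolding I_def ext(3) by (simp add: space_leaf_measure leaf_map_def add.commute)
    have "(\<lambda>x. F x * pullback (ext_deriv \<theta>) x) \<in> borel_measurable leaf_measure"
      by (intro borel_measurable_times F_measurable borel_measurable_leaf_measure_continuous pullback_test_form(1) ext(2))
    moreover have "integral\<^sup>L leaf_measure (I n) = (\<integral>x. F x * pullback (ext_deriv \<theta>) x \<partial>leaf_measure)"
      by (rule Bochner_Integration.integral_cong[OF refl]) (simp add: eq)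
    ultimately show ?thesis using F_closed[OF ext(1)] measurable_cong[of leaf_measure "\<lambda>x. F x * pullback (ext_deriv \<theta>) x" "I n" borel] eq by simp
  qed
  have "(\<lambda>n. integral\<^sup>L leaf_measure (I n)) \<longlonglongrightarrow>
      (\<integral>x. F x * of_real (?A (fst x) * indicator E (snd x)) \<partial>leaf_measure)"
  proof (rule integral_dominated_convergence)
    show "integrable leaf_measure (\<lambda>x. norm (F x * of_real (\<bar>?A (fst x)\<bar> + \<bar>\<rho> (fst x)\<bar> * C)))"
      by (intro integrable_norm integrable_F_continuous[where g = "\<lambda>z. \<bar>?A z\<bar> + \<bar>\<rho> z\<bar> * C", OF _ _ \<rho>(3)] continuous_intros Acont \<rho>cont)
         (simp add: A0 \<rho>(2))
    have lim: "(\<lambda>n. I n x) \<longlonglongrightarrow> F x * of_real (?A (fst x) * indicator E (snd x))"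
      if x: "x \<in> unit_disk \<times> \<tau>" for x
    proof (cases "norm (fst x) \<le> r")
      case True
      have g: "(\<lambda>n. G n (leaf_map x)) \<longlonglongrightarrow> indicator E (snd x)"
        using G(4)[OF _ True, of "snd x"] x by (simp add: leaf_map_def mem_Times_iff)
      have b: "(\<lambda>n. ?B n x) \<longlonglongrightarrow> 0"
      proof (rule Lim_null_comparison)
        show "\<forall>\<^sub>F n in sequentially. norm (?B n x) \<le> C / real (Suc n)"
          using G(5)[OF _ True, of "snd x"] x
          by (intro always_eventually allI) (simp add: leaf_map_def slope_def mem_Times_iff C_def)
        show "(\<lambda>n. C / real (Suc n)) \<longlonglongrightarrow> 0"
          by (rule LIMSEQ_Suc[OF lim_const_over_n])
      qed
      have "(\<lambda>n. I n x) \<longlonglongrightarrow> F x * of_real (?A (fst x) * indicator E (snd x) + \<rho> (fst x) * 0)"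
        unfolding I_def by (intro tendsto_intros g b)
      then show ?thesis by simp
    qed (simp add: I_def A0 \<rho>(2))
    then show "AE x in leaf_measure. (\<lambda>n. I n x) \<longlonglongrightarrow> F x * of_real (?A (fst x) * indicator E (snd x))"
      by (intro AE_I2) (simp add: space_leaf_measure)
    show "I n \<in> borel_measurable leaf_measure" for n using I by blast
    show "(\<lambda>x. F x * of_real (?A (fst x) * indicator E (snd x))) \<in> borel_measurable leaf_measure"
      by (rule borel_measurable_LIMSEQ_metric[of I]) (use I lim in \<open>auto simp: space_leaf_measure\<close>)
    show "AE x in leaf_measure. norm (I n x) \<le> norm (F x * of_real (\<bar>?A (fst x)\<bar> + \<bar>\<rho> (fst x)\<bar> * C))" for n
    proof (rule AE_I2)
      fix x assume "x \<in> space leaf_measure"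
      then have x: "x \<in> unit_disk \<times> \<tau>" by (simp add: space_leaf_measure)
      show "norm (I n x) \<le> norm (F x * of_real (\<bar>?A (fst x)\<bar> + \<bar>\<rho> (fst x)\<bar> * C))"
      proof (cases "norm (fst x) \<le> r")
        case True
        have "\<bar>?B n x\<bar> \<le> C / real (Suc n)"
          using G(5)[OF _ True, of "snd x"] x by (simp add: leaf_map_def slope_def mem_Times_iff C_def)
        also have "\<dots> \<le> C / 1" using C by (intro divide_left_mono) auto
        finally have B: "\<bar>?B n x\<bar> \<le> C" by simp
        have "\<bar>?A (fst x) * G n (leaf_map x) + \<rho> (fst x) * ?B n x\<bar> \<le> \<bar>?A (fst x)\<bar> * \<bar>G n (leaf_map x)\<bar> + \<bar>\<rho> (fst x)\<bar> * \<bar>?B n x\<bar>"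
          by (metis abs_mult abs_triangle_ineq)
        also have "\<dots> \<le> \<bar>?A (fst x)\<bar> * 1 + \<bar>\<rho> (fst x)\<bar> * C"
          using G(2,3)[of n "leaf_map x"] B by (intro add_mono mult_left_mono) auto
        finally have "norm (complex_of_real (?A (fst x) * G n (leaf_map x) + \<rho> (fst x) * ?B n x))
            \<le> norm (complex_of_real (\<bar>?A (fst x)\<bar> + \<bar>\<rho> (fst x)\<bar> * C))"
          using C unfolding norm_of_real by (simp only: mult_1_right abs_ge_self order_trans[OF _ abs_ge_self])
        then show ?thesis unfolding I_def norm_mult by (rule mult_left_mono) simp
      qed (simp add: I_def A0 \<rho>(2))
    qed
  qed
  then show ?thesis using I by (simp add: LIMSEQ_const_iff)
qed

text \<open>The test form is \<open>h\<close> times \<open>dx \<and> dy\<close> of the first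
  coordinate. Its value on \<open>v, \<i> v\<close> is \<open>h\<close> times
  \<open>(norm (fst v))\<^sup>2\<close>, so it is positive for \<open>h \<ge> 0\<close>, and its
  pullback to a leaf is \<open>h\<close> itself. Nonnegativity passes to the limit because the
  nonnegative reals are closed in the complex plane.\<close>

lemma leafwise_positive:
  fixes \<rho> :: "complex \<Rightarrow> real"
  assumes \<rho>: "smooth_on UNIV \<rho>" "\<And>z. r < norm z \<Longrightarrow> \<rho> z = 0" "r < 1" "\<And>z. 0 \<le> \<rho> z" and E: "compact E" "E \<subseteq> \<tau>"
  shows "(\<integral>x. F x * of_real (\<rho> (fst x) * indicator E (snd x)) \<partial>leaf_measure) \<in> \<real>\<^sub>\<ge>\<^sub>0"
proof -
  obtain G :: "nat \<Rightarrow> C2 \<Rightarrow> real" where G: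
    "\<And>n. smooth_on bidisk (G n)" "\<And>n p. 0 \<le> G n p" "\<And>n p. G n p \<le> 1"
    "\<And>a z. a \<in> \<tau> \<Longrightarrow> norm z \<le> r \<Longrightarrow> (\<lambda>n. G n (z, \<phi> a z)) \<longlonglongrightarrow> indicator E a"
    using leaf_cutoff_functions[OF E \<rho>(3)] by metis
  have \<rho>0: "\<forall>z. r < norm z \<longrightarrow> \<rho> z = 0" using \<rho>(2) by blast
  have \<rho>cont: "continuous_on UNIV \<rho>" by (rule smooth_on_imp_continuous_on[OF \<rho>(1)])
  define I where "I = (\<lambda>n x. F x * of_real (\<rho> (fst x) * G n (leaf_map x)))"
  have I: "I n \<in> borel_measurable leaf_measure \<and> integral\<^sup>L leaf_measure (I n) \<in> \<real>\<^sub>\<ge>\<^sub>0" for n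
  proof -
    obtain h K where h0: "smooth h" "compact K" "K \<subseteq> bidisk" "\<forall>p. p \<notin> K \<longrightarrow> h p = 0"
      and hpos: "\<forall>p. 0 \<le> \<rho> (fst p) \<longrightarrow> 0 \<le> h p"
      and hG: "\<forall>p \<in> unit_disk \<times> cball 0 height. h p = \<rho> (fst p) * G n p"
      and dh: "\<forall>p \<in> unit_disk \<times> cball 0 height. (h has_derivative
        (\<lambda>u. \<rho> (fst p) * frechet_derivative (G n) (at p) u + frechet_derivative \<rho> (at (fst p)) (fst u) * G n p)) (at p)"
      using cutoff_product[OF \<rho>(1) \<rho>0 \<rho>(3) G(1)[of n] G(2)[of n]] by (elim exE conjE) (rule that)
    define \<omega> where "\<omega> = (\<lambda>(u::C2) (v::C2). complex_of_real (Im (cnj (fst u) * fst v)))"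
    define \<psi> where "\<psi> = (\<lambda>p u v. complex_of_real (h p) * \<omega> u v)"
    have "smooth (\<lambda>p. complex_of_real (h p))"
      using h0(1) unfolding smooth_iff_smooth_on by (intro smooth_on_of_real open_UNIV)
    then have "test_function (\<lambda>p. complex_of_real (h p))"
      using h0 unfolding test_function_def by (auto intro!: exI[of _ K])
    moreover have "bilinear \<omega>" "\<omega> u u = 0" for u
      by (auto simp: \<omega>_def bilinear_def linear_iff algebra_simps scaleR_conv_of_real)
    ultimately have t: "test_form2 \<psi>" unfolding \<psi>_def by (intro test_form2_scale) auto
    have pos: "positive_form \<psi>" unfolding positive_form_def
    proof (intro conjI allI)
      have Im_of_real_mult: "Im (complex_of_real r * z) = r * Im z" for r z by simp
      have "\<omega> (cscale c u) (cscale c v) = c * cnj c * \<omega> u v" for c u v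
      proof -
        have "cnj (c * fst u) * (c * fst v) = of_real ((norm c)\<^sup>2) * (cnj (fst u) * fst v)"
          by (simp add: complex_norm_square mult_ac del: of_real_power)
        then have "Im (cnj (c * fst u) * (c * fst v)) = (norm c)\<^sup>2 * Im (cnj (fst u) * fst v)"
          by (simp only: Im_of_real_mult)
        then show ?thesis unfolding \<omega>_def cscale_def fst_conv complex_norm_square[symmetric] by simp
      qed
      then show "bidegree 1 1 \<psi>" by (simp add: bidegree_def \<psi>_def mult.left_commute)
      have "\<omega> v (cscale \<i> v) = of_real ((norm (fst v))\<^sup>2)" for v
        unfolding \<omega>_def cscale_def cmod_power2 by (simp add: power2_eq_square)
      then show "\<psi> p v (cscale \<i> v) \<in> \<real>\<^sub>\<ge>\<^sub>0" for p v
        using hpos[rule_format, of p] \<rho>(4) by (simp add: \<psi>_def nonneg_Reals_mult_I)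
    qed
    have eq: "F x * pullback \<psi> x = I n x" if x: "x \<in> space leaf_measure" for x
      using hG[rule_format, OF leaf_map_in_strip, of x] x
      by (simp add: I_def pullback_def \<psi>_def \<omega>_def space_leaf_measure leaf_map_def)
    have "(\<lambda>x. F x * pullback \<psi> x) \<in> borel_measurable leaf_measure"
      by (intro borel_measurable_times F_measurable borel_measurable_leaf_measure_continuous pullback_test_form(1) t)
    moreover have "integral\<^sup>L leaf_measure (I n) = (\<integral>x. F x * pullback \<psi> x \<partial>leaf_measure)"
      by (rule Bochner_Integration.integral_cong[OF refl]) (simp add: eq)
    ultimately show ?thesis using F_positive[OF t pos] measurable_cong[of leaf_measure "\<lambda>x. F x * pullback \<psi> x" "I n" borel] eq by simp
  qed
  have "(\<lambda>n. integral\<^sup>L leaf_measure (I n)) \<longlonglongrightarrow>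
      (\<integral>x. F x * of_real (\<rho> (fst x) * indicator E (snd x)) \<partial>leaf_measure)"
  proof (rule integral_dominated_convergence)
    show "integrable leaf_measure (\<lambda>x. norm (F x * of_real (\<rho> (fst x))))"
      by (intro integrable_norm integrable_F_continuous[OF \<rho>cont \<rho>(2,3)])
    have lim: "(\<lambda>n. I n x) \<longlonglongrightarrow> F x * of_real (\<rho> (fst x) * indicator E (snd x))"
      if x: "x \<in> unit_disk \<times> \<tau>" for x
    proof (cases "norm (fst x) \<le> r")
      case True
      have g: "(\<lambda>n. G n (leaf_map x)) \<longlonglongrightarrow> indicator E (snd x)"
        using G(4)[OF _ True, of "snd x"] x by (simp add: leaf_map_def mem_Times_iff)
      then show ?thesis unfolding I_def by (intro tendsto_intros)
    qed (simp add: I_def \<rho>(2))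
    then show "AE x in leaf_measure. (\<lambda>n. I n x) \<longlonglongrightarrow> F x * of_real (\<rho> (fst x) * indicator E (snd x))"
      by (intro AE_I2) (simp add: space_leaf_measure)
    show "I n \<in> borel_measurable leaf_measure" for n using I by blast
    show "(\<lambda>x. F x * of_real (\<rho> (fst x) * indicator E (snd x))) \<in> borel_measurable leaf_measure"
      by (rule borel_measurable_LIMSEQ_metric[of I]) (use I lim in \<open>auto simp: space_leaf_measure\<close>)
    show "AE x in leaf_measure. norm (I n x) \<le> norm (F x * of_real (\<rho> (fst x)))" for n
    proof (rule AE_I2)
      fix x
      have "\<bar>\<rho> (fst x)\<bar> * \<bar>G n (leaf_map x)\<bar> \<le> \<bar>\<rho> (fst x)\<bar> * 1"
        using G(2,3)[of n "leaf_map x"] by (intro mult_left_mono) auto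
      then have "norm (complex_of_real (\<rho> (fst x) * G n (leaf_map x))) \<le> norm (complex_of_real (\<rho> (fst x)))"
        unfolding norm_of_real abs_mult by simp
      then show "norm (I n x) \<le> norm (F x * of_real (\<rho> (fst x)))"
        unfolding I_def norm_mult by (rule mult_left_mono) simp
    qed
  qed
  then show ?thesis
    by (rule Lim_in_closed_set[OF closed_nonneg_Reals_complex, rotated 2]) (use I in auto)
qed

end

subsection \<open>Constancy along the leaves\<close>

definition bump_mass :: "real \<Rightarrow> real \<Rightarrow> nat \<Rightarrow> real" where
  "bump_mass a b n = (\<integral>x. box_bump a b n x \<partial>lborel)"

lemma continuous_on_box_bump: "continuous_on UNIV (box_bump a b n)"
  by (rule smooth_on_imp_continuous_on[OF smooth_on_box_bump])

lemma borel_measurable_box_bump: "box_bump a b n \<in> borel_measurable borel"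
  by (rule borel_measurable_continuous_onI[OF continuous_on_box_bump])

lemma box_bump_le_indicator: "norm (box_bump a b n x) \<le> indicator (cbox a b) x"
  using box_bump_nonneg[of a b n x] box_bump_le_1[of a b n x] box_bump_zero[of x a b n] box_subset_cbox[of a b]
  by (cases "x \<in> box a b") (auto simp: indicator_def)

lemma integrable_box_bump: "integrable lborel (box_bump a b n)"
  by (rule Bochner_Integration.integrable_bound[where f = "indicator (cbox a b) :: _ \<Rightarrow> real"])
     (use borel_measurable_box_bump[of a b n] box_bump_le_indicator[of a b n] in \<open>auto simp: emeasure_lborel_cbox_eq\<close>)

lemma bump_mass_tendsto:
  assumes "a \<le> b"
  shows "(\<lambda>n. bump_mass a b n) \<longlonglongrightarrow> b - a"
proof -
  have "(\<lambda>n. \<integral>x. box_bump a b n x \<partial>lborel) \<longlonglongrightarrow> (\<integral>x. indicator (box a b) x \<partial>lborel)"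
  proof (rule integral_dominated_convergence[where w = "indicator (cbox a b)"])
    show "AE x in lborel. (\<lambda>n. box_bump a b n x) \<longlonglongrightarrow> indicator (box a b) x"
      by (intro AE_I2 box_bump_tendsto)
    show "AE x in lborel. norm (box_bump a b n x) \<le> indicator (cbox a b) x" for n
      by (intro AE_I2 box_bump_le_indicator)
  qed (use borel_measurable_box_bump[of a b] in \<open>auto intro!: integrable_real_indicator simp: emeasure_lborel_Icc_eq\<close>)
  then show ?thesis using assms by (simp add: bump_mass_def)
qed

text \<open>Weighting each bump with the mass of the other makes the total integral 0, and so the
  antiderivative compactly supported. These are the test functions of the du Bois-Reymond
  argument.\<close>

lemma bump_antiderivative:
  fixes lo hi :: real and n :: nat
  assumes "lo \<le> a1" "b1 \<le> hi" "lo \<le> a2" "b2 \<le> hi" "lo \<le> hi"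
  defines "g \<equiv> \<lambda>x. bump_mass a2 b2 n * box_bump a1 b1 n x - bump_mass a1 b1 n * box_bump a2 b2 n x"
  obtains A where "smooth_on UNIV A" "\<forall>x. x \<notin> {lo..hi} \<longrightarrow> A x = 0" "\<forall>x. (A has_real_derivative g x) (at x)"
proof -
  have g0: "g x = 0" if "x \<notin> {lo..hi}" for x
    using that assms(1-4) box_bump_zero[of x a1 b1 n] box_bump_zero[of x a2 b2 n] by (auto simp: g_def)
  have smg: "smooth_on UNIV g" unfolding g_def
    by (intro smooth_on_diff smooth_on_mult smooth_on_const smooth_on_box_bump open_UNIV)
  then have contg: "continuous_on UNIV g" by (rule smooth_on_imp_continuous_on)
  have intg: "g integrable_on {s..t}" for s t
    by (rule integrable_continuous_real[OF continuous_on_subset[OF contg]]) simp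
  \<comment> \<open>Starting at \<open>lo - 1\<close>, and likewise ending at \<open>hi + 1\<close>,
    makes \<open>lo\<close> and \<open>hi\<close> interior points, where the derivative is
    two-sided.\<close>
  define P where "P = (\<lambda>x. integral {lo - 1..x} g)"
  have zero_int: "integral {s..t} g = 0" if "{s..t} \<inter> {lo<..<hi} = {}" for s t
  proof -
    have "g x = 0" if "x \<in> {s..t}" for x
    proof (cases "x \<in> {lo..hi}")
      case True
      then have "x = lo \<or> x = hi" using that \<open>{s..t} \<inter> {lo<..<hi} = {}\<close> by force
      then have "x \<notin> box a1 b1" "x \<notin> box a2 b2" using assms(1-4) by auto
      then show ?thesis by (simp add: g_def box_bump_zero)
    qed (rule g0)
    then have "integral {s..t} g = integral {s..t} (\<lambda>_. 0)" by (intro Henstock_Kurzweil_Integration.integral_cong) auto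
    then show ?thesis by simp
  qed
  have total: "integral {lo - 1..hi + 1} g = 0"
  proof -
    have intL: "integrable lborel g" unfolding g_def
      by (intro Bochner_Integration.integrable_diff integrable_mult_right integrable_box_bump)
    have "set_integrable lborel {lo - 1..hi + 1} g"
      unfolding set_integrable_def by (rule integrable_mult_indicator[OF _ intL]) simp
    then have "integral {lo - 1..hi + 1} g = (LINT x:{lo - 1..hi + 1}|lborel. g x)"
      using set_borel_integral_eq_integral(2) by metis
    also have "\<dots> = (\<integral>x. g x \<partial>lborel)"
      unfolding set_lebesgue_integral_def
    proof (rule Bochner_Integration.integral_cong[OF refl])
      show "indicator {lo - 1..hi + 1} x *\<^sub>R g x = g x" for x
        by (cases "x \<in> {lo..hi}") (use g0[of x] in auto)
    qed
    also have "\<dots> = bump_mass a2 b2 n * bump_mass a1 b1 n - bump_mass a1 b1 n * bump_mass a2 b2 n"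
      unfolding g_def by (subst Bochner_Integration.integral_diff)
        (auto intro!: integrable_mult_right integrable_box_bump simp: bump_mass_def)
    finally show ?thesis by simp
  qed
  define A where "A = (\<lambda>x. if x \<in> {lo..hi} then P x else 0)"
  let ?S = "{lo - 1<..<hi + 1}"
  have AP: "A x = P x" if x: "x \<in> ?S" for x
  proof (cases "x \<in> {lo..hi}")
    case False
    then consider "x < lo" | "x > hi" by force
    then have "P x = 0"
    proof cases
      case 1
      then show ?thesis unfolding P_def by (intro zero_int) auto
    next
      case 2
      have "integral {lo - 1..x} g + integral {x..hi + 1} g = integral {lo - 1..hi + 1} g"
        using x assms(5) by (intro Henstock_Kurzweil_Integration.integral_combine intg) auto
      moreover have "integral {x..hi + 1} g = 0" using 2 by (intro zero_int) auto
      ultimately show ?thesis using total by (simp add: P_def)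
    qed
    then show ?thesis unfolding A_def using False by auto
  qed (simp add: A_def)
  have dA: "(A has_real_derivative g x) (at x)" if x: "x \<in> ?S" for x
  proof -
    have "(P has_real_derivative g x) (at x within {lo - 1..hi + 1})"
      unfolding P_def
      by (rule integral_has_real_derivative[OF continuous_on_subset[OF contg]]) (use x in auto)
    then have "(P has_real_derivative g x) (at x)" using x by (simp add: at_within_Icc_at)
    then show ?thesis
      by (rule has_field_derivative_transform_within_open[OF _ _ x]) (auto simp: AP)
  qed
  have "Ck_on n ?S A" for n
  proof (rule Ck_on_SucD, rule Ck_on_real_SucI[OF _ dA])
    show "Ck_on n ?S g" using smooth_on_subset[OF smg, of ?S] by (simp add: smooth_on_def)
  qed auto
  then have "smooth A"
    by (intro smooth_on_zero_extension[of ?S "{lo..hi}"]) (auto simp: smooth_on_def A_def)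
  moreover have "(A has_real_derivative g x) (at x)" for x
  proof (cases "x \<in> ?S")
    case False
    then have x: "x \<in> - {lo..hi}" by auto
    have "((\<lambda>_. 0) has_real_derivative g x) (at x)" using g0[of x] x by simp
    then show ?thesis
      by (rule has_field_derivative_transform_within_open[OF _ _ x]) (auto simp: A_def open_Compl)
  qed (rule dA)
  ultimately show thesis using that[of A] by (auto simp: smooth_iff_smooth_on A_def)
qed

text \<open>For a unit vector \<open>e\<close>, the open rectangle with sides along \<open>e\<close>
  and \<open>\<i> * e\<close>; one sliding argument then serves both coordinate directions.\<close>

definition strip :: "complex \<Rightarrow> real \<Rightarrow> real \<Rightarrow> real \<Rightarrow> real \<Rightarrow> complex set" where
  "strip e a b c d = {z. a < z \<bullet> e \<and> z \<bullet> e < b \<and> c < z \<bullet> (\<i> * e) \<and> z \<bullet> (\<i> * e) < d}"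

context closed_laminar
begin

definition mass :: "complex set \<Rightarrow> complex set \<Rightarrow> complex" where
  "mass R E = (\<integral>x. F x * of_real (indicator R (fst x) * indicator E (snd x)) \<partial>leaf_measure)"

lemma borel_measurable_indicator_snd:
  assumes "compact E" "E \<subseteq> \<tau>"
  shows "(\<lambda>x. indicator E (snd x) :: real) \<in> borel_measurable leaf_measure"
proof -
  have "E \<in> sets \<mu>"
    using assms compact_\<tau> by (auto simp: sets_\<mu> sets_restrict_space_iff compact_imp_closed)
  then show ?thesis
    unfolding leaf_measure_def by (intro measurable_compose[OF measurable_snd]) simp
qed

lemma integrable_F_cutoff:
  fixes g :: "complex \<Rightarrow> real"
  assumes g: "continuous_on UNIV g" "\<And>z. r < norm z \<Longrightarrow> g z = 0" "r < 1" and E: "compact E" "E \<subseteq> \<tau>"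
  shows "integrable leaf_measure (\<lambda>x. F x * of_real (g (fst x) * indicator E (snd x)))"
proof -
  have gi: "integrable leaf_measure (\<lambda>x. F x * of_real (g (fst x)))"
    by (rule integrable_F_continuous[OF g])
  have "(\<lambda>x. F x * of_real (g (fst x)) * of_real (indicator E (snd x))) \<in> borel_measurable leaf_measure"
    by (rule borel_measurable_times[OF borel_measurable_integrable[OF gi]
          measurable_compose[OF borel_measurable_indicator_snd[OF E] borel_measurable_of_real]])
  then have m: "(\<lambda>x. F x * of_real (g (fst x) * indicator E (snd x))) \<in> borel_measurable leaf_measure"
    by (simp add: mult.assoc)
  show ?thesis
    by (rule Bochner_Integration.integrable_bound[OF gi m]) (auto simp: norm_mult indicator_def)
qed

text \<open>The integrands with \<open>g n\<close> are dominated by \<open>F\<close> on a cylinder.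
  Measurability of the integrand with the indicator of \<open>R\<close> is inherited from the
  limit.\<close>

lemma mass_limit:
  fixes g :: "nat \<Rightarrow> complex \<Rightarrow> real"
  assumes g: "\<And>n. continuous_on UNIV (g n)" "\<And>n z. r < norm z \<Longrightarrow> g n z = 0" "\<And>n z. \<bar>g n z\<bar> \<le> 1"
    and lim: "\<And>z. (\<lambda>n. g n z) \<longlonglongrightarrow> indicator R z" and r: "r < 1" and E: "compact E" "E \<subseteq> \<tau>"
  shows "(\<lambda>n. \<integral>x. F x * of_real (g n (fst x) * indicator E (snd x)) \<partial>leaf_measure) \<longlonglongrightarrow> mass R E"
    and "integrable leaf_measure (\<lambda>x. F x * of_real (indicator R (fst x) * indicator E (snd x)))"
proof -
  let ?f = "\<lambda>x. F x * of_real (indicator R (fst x) * indicator E (snd x))"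
  let ?s = "\<lambda>n x. F x * of_real (g n (fst x) * indicator E (snd x))"
  let ?w = "\<lambda>x. norm (indicator (cball 0 r \<times> \<tau>) x *\<^sub>R F x)"
  have w: "integrable leaf_measure ?w"
    using F_integrable[OF r] by (intro integrable_norm) (simp add: set_integrable_def)
  have s: "?s n \<in> borel_measurable leaf_measure" for n
    using integrable_F_cutoff[OF g(1,2) r E] by (rule borel_measurable_integrable)
  have lim': "(\<lambda>n. ?s n x) \<longlonglongrightarrow> ?f x" for x
    by (intro tendsto_mult tendsto_const tendsto_of_real lim)
  have f: "?f \<in> borel_measurable leaf_measure"
    by (rule borel_measurable_LIMSEQ_metric[OF s lim'])
  have bound: "norm (?s n x) \<le> ?w x" if x: "x \<in> space leaf_measure" for n x
  proof (cases "norm (fst x) \<le> r")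
    case True
    then have "x \<in> cball 0 r \<times> \<tau>" using x by (auto simp: space_leaf_measure mem_Times_iff)
    moreover have "\<bar>g n (fst x) * indicator E (snd x)\<bar> \<le> 1"
      using g(3)[of n "fst x"] by (simp add: indicator_def)
    then have "norm (F x) * \<bar>g n (fst x) * indicator E (snd x)\<bar> \<le> norm (F x) * 1"
      by (intro mult_left_mono) auto
    ultimately show ?thesis by (simp add: norm_mult abs_mult)
  qed (use g(2)[of "fst x" n] in simp)
  show "(\<lambda>n. integral\<^sup>L leaf_measure (?s n)) \<longlonglongrightarrow> mass R E"
    unfolding mass_def
    by (rule integral_dominated_convergence[OF f s w]) (use lim' bound in \<open>auto intro!: AE_I2\<close>)
  show "integrable leaf_measure ?f"
    by (rule integrable_dominated_convergence[OF f s w]) (use lim' bound in \<open>auto intro!: AE_I2\<close>)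
qed

text \<open>Closedness is tested in direction \<open>e\<close> with \<open>\<rho>\<close> a product
  of a compactly supported antiderivative in the \<open>e\<close> coordinate and a bump in the
  orthogonal one. Its derivative is the weighted difference of the bumps of the two rectangles; in
  the limit their masses are in the ratio of their widths. \<open>inside\<close> keeps the support
  of \<open>\<rho>\<close> in \<open>cball 0 r\<close>.\<close>

lemma mass_slide:
  assumes e: "norm e = 1" and E: "compact E" "E \<subseteq> \<tau>" and r: "r < 1"
    and inside: "\<And>z. lo \<le> z \<bullet> e \<Longrightarrow> z \<bullet> e \<le> hi \<Longrightarrow> c \<le> z \<bullet> (\<i> * e) \<Longrightarrow> z \<bullet> (\<i> * e) \<le> d \<Longrightarrow> norm z \<le> r"
    and le: "lo \<le> a1" "a1 \<le> b1" "b1 \<le> hi" "lo \<le> a2" "a2 \<le> b2" "b2 \<le> hi"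
  shows "of_real (b2 - a2) * mass (strip e a1 b1 c d) E = of_real (b1 - a1) * mass (strip e a2 b2 c d) E"
proof -
  have lohi: "lo \<le> hi" using le by linarith
  define B where "B = (\<lambda>n z. box_bump c d n (z \<bullet> (\<i> * e)))"
  define \<alpha> where "\<alpha> = (\<lambda>a b n z. box_bump a b n (z \<bullet> e) * B n z)"
  have smcomp: "smooth_on UNIV (\<lambda>z::complex. h (z \<bullet> w))" if "smooth_on UNIV h" for h :: "real \<Rightarrow> real" and w
    by (rule smooth_on_compose[where f = "\<lambda>z. z \<bullet> w" and g = h, OF open_UNIV open_UNIV _ smooth_on_bounded_linear[OF bounded_linear_inner_left open_UNIV] that]) simp
  have smB: "smooth_on UNIV (B n)" for n unfolding B_def by (rule smcomp[OF smooth_on_box_bump])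
  have sm\<alpha>: "smooth_on UNIV (\<alpha> a b n)" for a b n
    unfolding \<alpha>_def by (intro smooth_on_mult open_UNIV smB smcomp[OF smooth_on_box_bump])
  have \<alpha>0: "\<alpha> a b n z = 0" if "lo \<le> a" "b \<le> hi" "r < norm z" for a b n z
  proof -
    have "z \<bullet> e \<notin> box a b \<or> z \<bullet> (\<i> * e) \<notin> box c d" using inside[of z] that by force
    then show ?thesis by (auto simp: \<alpha>_def B_def box_bump_zero)
  qed
  have \<alpha>lim: "(\<lambda>n. \<integral>x. F x * of_real (\<alpha> a b n (fst x) * indicator E (snd x)) \<partial>leaf_measure) \<longlonglongrightarrow> mass (strip e a b c d) E"
    if "lo \<le> a" "b \<le> hi" for a b
  proof (rule mass_limit(1)[OF _ \<alpha>0[OF that] _ _ r E])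
    show "continuous_on UNIV (\<alpha> a b n)" for n by (rule smooth_on_imp_continuous_on[OF sm\<alpha>])
    show "\<bar>\<alpha> a b n z\<bar> \<le> 1" for n z
      unfolding \<alpha>_def B_def abs_mult
      by (intro mult_le_one) (simp_all add: abs_of_nonneg box_bump_nonneg box_bump_le_1)
    have "(\<lambda>n. \<alpha> a b n z) \<longlonglongrightarrow> indicator (box a b) (z \<bullet> e) * indicator (box c d) (z \<bullet> (\<i> * e))" for z
      unfolding \<alpha>_def B_def by (intro tendsto_mult box_bump_tendsto)
    moreover have "indicator (box a b) (z \<bullet> e) * indicator (box c d) (z \<bullet> (\<i> * e)) = (indicator (strip e a b c d) z :: real)" for z
      by (auto simp: strip_def indicator_def)
    ultimately show "(\<lambda>n. \<alpha> a b n z) \<longlonglongrightarrow> indicator (strip e a b c d) z" for z by simp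
  qed assumption
  have eq: "of_real (bump_mass a2 b2 n) * (\<integral>x. F x * of_real (\<alpha> a1 b1 n (fst x) * indicator E (snd x)) \<partial>leaf_measure)
      = of_real (bump_mass a1 b1 n) * (\<integral>x. F x * of_real (\<alpha> a2 b2 n (fst x) * indicator E (snd x)) \<partial>leaf_measure)" for n
  proof -
    obtain A where A: "smooth_on UNIV A" "\<forall>x. x \<notin> {lo..hi} \<longrightarrow> A x = 0"
      "\<forall>x. (A has_real_derivative (bump_mass a2 b2 n * box_bump a1 b1 n x - bump_mass a1 b1 n * box_bump a2 b2 n x)) (at x)"
      by (rule bump_antiderivative[OF le(1,3,4,6) lohi, of n])
    define \<rho> where "\<rho> = (\<lambda>z. A (z \<bullet> e) * B n z)"
    have sm\<rho>: "smooth_on UNIV \<rho>"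
      unfolding \<rho>_def by (intro smooth_on_mult open_UNIV smB smcomp[OF A(1)])
    have \<rho>0: "\<rho> z = 0" if "r < norm z" for z
    proof -
      have "z \<bullet> e \<notin> {lo..hi} \<or> z \<bullet> (\<i> * e) \<notin> box c d" using inside[of z] that by force
      then show ?thesis using A(2) by (auto simp: \<rho>_def B_def box_bump_zero)
    qed
    have D: "frechet_derivative \<rho> (at z) e = bump_mass a2 b2 n * \<alpha> a1 b1 n z - bump_mass a1 b1 n * \<alpha> a2 b2 n z" for z
    proof -
      let ?A' = "bump_mass a2 b2 n * box_bump a1 b1 n (z \<bullet> e) - bump_mass a1 b1 n * box_bump a2 b2 n (z \<bullet> e)"
      let ?B' = "frechet_derivative (box_bump c d n) (at (z \<bullet> (\<i> * e)))"
      have dB: "(box_bump c d n has_derivative ?B') (at (z \<bullet> (\<i> * e)))"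
        by (rule smooth_on_has_derivative[OF smooth_on_box_bump]) simp
      have inn: "((\<lambda>z. z \<bullet> w) has_derivative (\<lambda>h. h \<bullet> w)) (at z)" for w
        by (rule bounded_linear_imp_has_derivative[OF bounded_linear_inner_left])
      have dA: "(A has_derivative (\<lambda>h. ?A' * h)) (at (z \<bullet> e))"
        using A(3) unfolding has_field_derivative_def by blast
      have "((\<lambda>z. A (z \<bullet> e)) has_derivative (\<lambda>h. ?A' * (h \<bullet> e))) (at z)"
        by (rule diff_chain_at[OF inn dA, unfolded o_def])
      moreover have "(B n has_derivative (\<lambda>h. ?B' (h \<bullet> (\<i> * e)))) (at z)"
        unfolding B_def by (rule diff_chain_at[OF inn dB, unfolded o_def])
      ultimately have "(\<rho> has_derivative (\<lambda>h. A (z \<bullet> e) * ?B' (h \<bullet> (\<i> * e)) + ?A' * (h \<bullet> e) * B n z)) (at z)"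
        unfolding \<rho>_def by (rule has_derivative_mult)
      then have "frechet_derivative \<rho> (at z) e = A (z \<bullet> e) * ?B' (e \<bullet> (\<i> * e)) + ?A' * (e \<bullet> e) * B n z"
        by (simp add: frechet_derivative_eqI)
      moreover have "e \<bullet> e = 1" using e by (simp add: power2_norm_eq_inner[symmetric])
      \<comment> \<open>\<open>B n\<close> depends only on the coordinate orthogonal to
        \<open>e\<close>, so its derivative does not contribute.\<close>
      moreover have "e \<bullet> (\<i> * e) = 0" by (simp add: inner_complex_def)
      moreover have "?B' 0 = 0" by (rule linear_0[OF has_derivative_linear[OF dB]])
      ultimately show ?thesis by (simp add: \<alpha>_def algebra_simps)
    qed
    have int: "integrable leaf_measure (\<lambda>x. F x * of_real (\<alpha> a b n (fst x) * indicator E (snd x)))"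
      if "lo \<le> a" "b \<le> hi" for a b
      by (rule integrable_F_cutoff[OF smooth_on_imp_continuous_on[OF sm\<alpha>] \<alpha>0[OF that] r E])
    have "0 = (\<integral>x. F x * of_real (frechet_derivative \<rho> (at (fst x)) e * indicator E (snd x)) \<partial>leaf_measure)"
      using leafwise_closed[OF sm\<rho> \<rho>0 r E] by simp
    also have "\<dots> = (\<integral>x. of_real (bump_mass a2 b2 n) * (F x * of_real (\<alpha> a1 b1 n (fst x) * indicator E (snd x)))
        - of_real (bump_mass a1 b1 n) * (F x * of_real (\<alpha> a2 b2 n (fst x) * indicator E (snd x))) \<partial>leaf_measure)"
      by (rule Bochner_Integration.integral_cong) (simp_all add: D algebra_simps)
    also have "\<dots> = of_real (bump_mass a2 b2 n) * (\<integral>x. F x * of_real (\<alpha> a1 b1 n (fst x) * indicator E (snd x)) \<partial>leaf_measure)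
      - of_real (bump_mass a1 b1 n) * (\<integral>x. F x * of_real (\<alpha> a2 b2 n (fst x) * indicator E (snd x)) \<partial>leaf_measure)"
      using int[OF le(1,3)] int[OF le(4,6)] by (subst Bochner_Integration.integral_diff) auto
    finally show ?thesis by simp
  qed
  have l1: "(\<lambda>n. of_real (bump_mass a2 b2 n) * (\<integral>x. F x * of_real (\<alpha> a1 b1 n (fst x) * indicator E (snd x)) \<partial>leaf_measure))
      \<longlonglongrightarrow> of_real (b2 - a2) * mass (strip e a1 b1 c d) E"
    by (intro tendsto_mult tendsto_of_real bump_mass_tendsto le \<alpha>lim)
  have l2: "(\<lambda>n. of_real (bump_mass a1 b1 n) * (\<integral>x. F x * of_real (\<alpha> a2 b2 n (fst x) * indicator E (snd x)) \<partial>leaf_measure))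
      \<longlonglongrightarrow> of_real (b1 - a1) * mass (strip e a2 b2 c d) E"
    by (intro tendsto_mult tendsto_of_real bump_mass_tendsto le \<alpha>lim)
  show ?thesis by (rule LIMSEQ_unique[OF l1[unfolded eq] l2])
qed

section \<open>Masses of rectangles are proportional to their areas\<close>

abbreviation rect :: "real \<Rightarrow> real \<Rightarrow> real \<Rightarrow> real \<Rightarrow> complex set" where
  "rect a b c d \<equiv> box (Complex a c) (Complex b d)"

lemma mem_rect: "z \<in> rect a b c d \<longleftrightarrow> a < Re z \<and> Re z < b \<and> c < Im z \<and> Im z < d"
  by (auto simp: mem_box Basis_complex_def)

lemma norm_le_rect: "\<bar>Re z\<bar> \<le> X \<Longrightarrow> \<bar>Im z\<bar> \<le> Y \<Longrightarrow> norm z \<le> sqrt (X\<^sup>2 + Y\<^sup>2)"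
  unfolding cmod_def by (intro real_sqrt_le_mono add_mono) (metis abs_ge_zero power2_abs power_mono)+

text \<open>\<open>X\<^sup>2 + Y\<^sup>2 < 1\<close> puts the closed symmetric rectangle with
  half-sides \<open>X\<close> and \<open>Y\<close> into the disk, and the slide stays within
  it.\<close>

lemma mass_slide_Re:
  assumes E: "compact E" "E \<subseteq> \<tau>" and XY: "X\<^sup>2 + Y\<^sup>2 < 1"
    and le: "-X \<le> a1" "a1 \<le> b1" "b1 \<le> X" "-X \<le> a2" "a2 \<le> b2" "b2 \<le> X" "-Y \<le> c" "d \<le> Y"
  shows "of_real (b2 - a2) * mass (rect a1 b1 c d) E = of_real (b1 - a1) * mass (rect a2 b2 c d) E"
proof -
  have s: "strip 1 a b c d = rect a b c d" for a b
    by (auto simp: strip_def mem_rect inner_complex_def)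
  have "of_real (b2 - a2) * mass (strip 1 a1 b1 c d) E = of_real (b1 - a1) * mass (strip 1 a2 b2 c d) E"
  proof (rule mass_slide[OF _ E, where r = "sqrt (X\<^sup>2 + Y\<^sup>2)" and lo = "-X" and hi = X])
    show "norm z \<le> sqrt (X\<^sup>2 + Y\<^sup>2)"
      if "-X \<le> z \<bullet> 1" "z \<bullet> 1 \<le> X" "c \<le> z \<bullet> (\<i> * 1)" "z \<bullet> (\<i> * 1) \<le> d" for z :: complex
      using that le(7,8) by (intro norm_le_rect) (auto simp: inner_complex_def)
  qed (use le XY in auto)
  then show ?thesis by (simp only: s)
qed

lemma mass_slide_Im:
  assumes E: "compact E" "E \<subseteq> \<tau>" and XY: "X\<^sup>2 + Y\<^sup>2 < 1"
    and le: "-Y \<le> c1" "c1 \<le> d1" "d1 \<le> Y" "-Y \<le> c2" "c2 \<le> d2" "d2 \<le> Y" "-X \<le> a" "b \<le> X"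
  shows "of_real (d2 - c2) * mass (rect a b c1 d1) E = of_real (d1 - c1) * mass (rect a b c2 d2) E"
proof -
  \<comment> \<open>The second axis of the strip is \<open>\<i> * \<i> = -1\<close>, so the bounds
    on the real part change sign and order.\<close>
  have s: "strip \<i> c d (-b) (-a) = rect a b c d" for c d
    by (auto simp: strip_def mem_rect inner_complex_def)
  have "of_real (d2 - c2) * mass (strip \<i> c1 d1 (-b) (-a)) E = of_real (d1 - c1) * mass (strip \<i> c2 d2 (-b) (-a)) E"
  proof (rule mass_slide[OF _ E, where r = "sqrt (X\<^sup>2 + Y\<^sup>2)" and lo = "-Y" and hi = Y])
    show "norm z \<le> sqrt (X\<^sup>2 + Y\<^sup>2)"
      if "-Y \<le> z \<bullet> \<i>" "z \<bullet> \<i> \<le> Y" "-b \<le> z \<bullet> (\<i> * \<i>)" "z \<bullet> (\<i> * \<i>) \<le> -a" for z :: complex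
      using that le(7,8) by (intro norm_le_rect) (auto simp: inner_complex_def)
  qed (use le XY in auto)
  then show ?thesis by (simp only: s)
qed

text \<open>A reference square inside the disk; its area 1/4 is the origin of the factors 4
  below.\<close>

abbreviation "central_square \<equiv> rect (-1/4) (1/4) (-1/4) (1/4)"

text \<open>Three slides: to width \<open>2 * t\<close> at the given height, then to height 1/2,
  then to width 1/2. The detour through a narrow rectangle is needed because the sweep must stay in
  the disk, which a change of height at the original width may not do.\<close>

lemma mass_rect:
  assumes E: "compact E" "E \<subseteq> \<tau>" and R: "cbox (Complex a c) (Complex b d) \<subseteq> unit_disk" "a < b" "c < d"
  shows "mass (rect a b c d) E = of_real (4 * ((b - a) * (d - c))) * mass central_square E"
proof -
  \<comment> \<open>Half-sides of the smallest symmetric rectangle around the given one. It lies in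
    the disk because \<open>(X, Y)\<close> is the reflection of a corner of the given
    rectangle.\<close>
  define X Y where "X = max \<bar>a\<bar> \<bar>b\<bar>" and "Y = max \<bar>c\<bar> \<bar>d\<bar>"
  have corner: "x\<^sup>2 + y\<^sup>2 < 1" if "x = a \<or> x = b" "y = c \<or> y = d" for x y
  proof -
    have "Complex x y \<in> cbox (Complex a c) (Complex b d)"
      using that R(2,3) by (auto simp: mem_box Basis_complex_def)
    then have "norm (Complex x y) < 1" using R(1) by auto
    then show ?thesis by (simp add: complex_norm)
  qed
  have "X\<^sup>2 = a\<^sup>2 \<or> X\<^sup>2 = b\<^sup>2" "Y\<^sup>2 = c\<^sup>2 \<or> Y\<^sup>2 = d\<^sup>2" by (auto simp: X_def Y_def max_def)
  then have XY: "X\<^sup>2 + Y\<^sup>2 < 1" using corner by metis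
  have X: "0 \<le> X" "-X \<le> a" "b \<le> X" and Y: "0 \<le> Y" "-Y \<le> c" "d \<le> Y" by (auto simp: X_def Y_def)
  define W where "W = max Y (1/4)"
  have Y1: "Y\<^sup>2 < 1" using XY by (smt (verit) zero_le_power2)
  have W2: "W\<^sup>2 < 1" using Y1 by (auto simp: W_def max_def power2_eq_square)
  have W: "1/4 \<le> W" "Y \<le> W" by (auto simp: W_def)
  \<comment> \<open>\<open>t\<close> is so small that a rectangle of half-width \<open>t\<close>
    fits into the disk at both the given height and that of the central square.\<close>
  obtain t where t: "0 < t" "t \<le> 1/4" "t\<^sup>2 + W\<^sup>2 < 1"
  proof
    define t where "t = min (1/4) ((1 - W\<^sup>2) / 2)"
    show "0 < t" "t \<le> 1/4" using W2 by (auto simp: t_def)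
    have "t * t \<le> t * 1" using \<open>0 < t\<close> \<open>t \<le> 1/4\<close> by (intro mult_left_mono) auto
    also have "t * 1 \<le> (1 - W\<^sup>2) / 2" unfolding t_def mult_1_right by (rule min.cobounded2)
    finally show "t\<^sup>2 + W\<^sup>2 < 1" using W2 by (simp add: power2_eq_square)
  qed
  have "Y\<^sup>2 \<le> W\<^sup>2" using W Y by (intro power_mono) auto
  then have "(max X t)\<^sup>2 + Y\<^sup>2 < 1" using XY t(3) by (auto simp: max_def)
  then have 1: "of_real (t - (-t)) * mass (rect a b c d) E = of_real (b - a) * mass (rect (-t) t c d) E"
    by (rule mass_slide_Re[OF E]) (use X Y R t in auto)
  have 2: "of_real (1/4 - (-1/4)) * mass (rect (-t) t c d) E = of_real (d - c) * mass (rect (-t) t (-1/4) (1/4)) E"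
    by (rule mass_slide_Im[OF E t(3)]) (use Y R t W in auto)
  have 3: "of_real (1/4 - (-1/4)) * mass (rect (-t) t (-1/4) (1/4)) E = of_real (t - (-t)) * mass central_square E"
    by (rule mass_slide_Re[OF E, of "1/4" "1/4"]) (use t in \<open>auto simp: power2_eq_square\<close>)
  have t0: "complex_of_real t \<noteq> 0" using t by simp
  have m3: "mass (rect (-t) t (-1/4) (1/4)) E = 4 * of_real t * mass central_square E" using 3 by simp
  have m2: "mass (rect (-t) t c d) E = 2 * of_real (d - c) * mass (rect (-t) t (-1/4) (1/4)) E" using 2 by simp
  have m1: "2 * of_real t * mass (rect a b c d) E = of_real (b - a) * mass (rect (-t) t c d) E" using 1 by simp
  have "2 * of_real t * mass (rect a b c d) E = 2 * of_real t * (of_real (4 * ((b - a) * (d - c))) * mass central_square E)"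
    unfolding m1 m2 m3 by simp
  then show ?thesis using t0 by (simp only: mult_cancel_left) auto
qed

end

lemma compact_subset_diskE:
  assumes "compact S" "S \<subseteq> unit_disk"
  obtains r where "r < 1" "S \<subseteq> cball 0 r"
proof -
  have "compact (S \<times> {0::complex})" "S \<times> {0::complex} \<subseteq> bidisk" using assms by (auto intro: compact_Times)
  then obtain r where "r < 1" "S \<times> {0::complex} \<subseteq> cball 0 r \<times> unit_disk" by (rule compact_subset_bidiskE)
  then show thesis using that[of r] by auto
qed

section \<open>The leafwise mean and the new transverse measure\<close>

context closed_laminar
begin

lemma mass_box:
  assumes B: "cbox p q \<subseteq> unit_disk" and E: "compact E" "E \<subseteq> \<tau>"
  shows "(\<lambda>n. \<integral>x. F x * of_real (box_bump p q n (fst x) * indicator E (snd x)) \<partial>leaf_measure) \<longlonglongrightarrow> mass (box p q) E"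
    and "integrable leaf_measure (\<lambda>x. F x * of_real (indicator (box p q) (fst x) * indicator E (snd x)))"
proof -
  obtain r where r: "r < 1" "cbox p q \<subseteq> cball 0 r" by (rule compact_subset_diskE[OF compact_cbox B])
  have z: "box_bump p q n z = 0" if "r < norm z" for n z
    using that r(2) box_subset_cbox[of p q] by (intro box_bump_zero) auto
  have le: "\<bar>box_bump p q n z\<bar> \<le> 1" for n z by (simp add: abs_of_nonneg box_bump_nonneg box_bump_le_1)
  show "(\<lambda>n. \<integral>x. F x * of_real (box_bump p q n (fst x) * indicator E (snd x)) \<partial>leaf_measure) \<longlonglongrightarrow> mass (box p q) E"
    by (rule mass_limit(1)[OF continuous_on_box_bump z le box_bump_tendsto r(1) E])
  show "integrable leaf_measure (\<lambda>x. F x * of_real (indicator (box p q) (fst x) * indicator E (snd x)))"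
    by (rule mass_limit(2)[OF continuous_on_box_bump z le box_bump_tendsto r(1) E])
qed

lemma central_square_subset: "cbox (Complex (-1/4) (-1/4)) (Complex (1/4) (1/4)) \<subseteq> unit_disk"
proof
  fix z assume "z \<in> cbox (Complex (-1/4) (-1/4)) (Complex (1/4) (1/4))"
  then have "\<bar>Re z\<bar> \<le> 1/4" "\<bar>Im z\<bar> \<le> 1/4" by (auto simp: mem_box Basis_complex_def)
  then have "norm z \<le> 1/4 + 1/4" using cmod_le[of z] by linarith
  then show "z \<in> unit_disk" by simp
qed

text \<open>The mean of \<open>F\<close> over the reference square in the leaf, 4 being the
  reciprocal of its area: the candidate for the constant value of \<open>F\<close> on the
  leaf.\<close>

definition leaf_mean :: "complex \<Rightarrow> complex" where
  "leaf_mean \<alpha> = 4 * (\<integral>z. F (z, \<alpha>) * of_real (indicator central_square z) \<partial>restrict_space lborel unit_disk)"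

lemma integrable_leaf_mean: "integrable \<mu> leaf_mean"
proof -
  have "integrable leaf_measure (\<lambda>x. F x * of_real (indicator central_square (fst x)))"
    using mass_box(2)[OF central_square_subset compact_\<tau> subset_refl]
    by (rule Bochner_Integration.integrable_cong[THEN iffD1, OF refl, rotated]) (auto simp: space_leaf_measure)
  then have "integrable \<mu> (\<lambda>\<alpha>. \<integral>z. F (z, \<alpha>) * of_real (indicator central_square z) \<partial>restrict_space lborel unit_disk)"
    using integrable_snd[of "\<lambda>z \<alpha>. F (z, \<alpha>) * of_real (indicator central_square z)"]
    by (simp add: leaf_measure_def case_prod_beta')
  then show ?thesis unfolding leaf_mean_def by (rule integrable_mult_right)
qed

lemma integral_leaf_mean:
  assumes E: "compact E" "E \<subseteq> \<tau>"
  shows "(\<integral>\<alpha>. indicator E \<alpha> *\<^sub>R leaf_mean \<alpha> \<partial>\<mu>) = 4 * mass central_square E"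
proof -
  have int: "integrable (restrict_space lborel unit_disk \<Otimes>\<^sub>M \<mu>)
      (\<lambda>(z, \<alpha>). F (z, \<alpha>) * of_real (indicator central_square z * indicator E \<alpha>))"
    using mass_box(2)[OF central_square_subset E] by (simp add: leaf_measure_def case_prod_beta')
  have "(\<integral>\<alpha>. indicator E \<alpha> *\<^sub>R leaf_mean \<alpha> \<partial>\<mu>)
      = (\<integral>\<alpha>. 4 * (\<integral>z. F (z, \<alpha>) * of_real (indicator central_square z * indicator E \<alpha>) \<partial>restrict_space lborel unit_disk) \<partial>\<mu>)"
    by (rule Bochner_Integration.integral_cong) (auto simp: leaf_mean_def indicator_def)
  also have "\<dots> = 4 * (\<integral>\<alpha>. \<integral>z. F (z, \<alpha>) * of_real (indicator central_square z * indicator E \<alpha>) \<partial>restrict_space lborel unit_disk \<partial>\<mu>)"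
    by simp
  also have "\<dots> = 4 * mass central_square E"
    unfolding mass_def leaf_measure_def using integral_snd[OF int] by (simp add: case_prod_beta')
  finally show ?thesis .
qed

text \<open>Fubini, the disk having finite area.\<close>

lemma integrable_leaf_mean_snd: "integrable leaf_measure (\<lambda>x. leaf_mean (snd x))"
proof -
  have m: "leaf_mean \<in> borel_measurable \<mu>" by (rule borel_measurable_integrable[OF integrable_leaf_mean])
  have "(\<lambda>x. leaf_mean (snd x)) \<in> borel_measurable leaf_measure"
    unfolding leaf_measure_def by (rule measurable_compose[OF measurable_snd m])
  then show ?thesis
    unfolding leaf_measure_def
    by (intro Fubini_integrable) (use integrable_leaf_mean in auto)
qed

lemma measure_rect:
  assumes "a \<le> b" "c \<le> d" "rect a b c d \<subseteq> unit_disk"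
  shows "(\<integral>z. indicator (rect a b c d) z \<partial>restrict_space lborel unit_disk) = (b - a) * (d - c)"
proof -
  have "(\<integral>z. indicat_real (rect a b c d) z \<partial>restrict_space lborel unit_disk)
      = (\<integral>z. indicator unit_disk z *\<^sub>R indicat_real (rect a b c d) z \<partial>lborel)"
    by (subst integral_restrict_space) auto
  also have "\<dots> = (\<integral>z. indicat_real (rect a b c d) z \<partial>lborel)"
    by (rule Bochner_Integration.integral_cong) (use assms(3) in \<open>auto simp: indicator_def\<close>)
  also have "\<dots> = (b - a) * (d - c)"
    using assms(1,2) by (simp add: measure_lborel_box_eq Basis_complex_def)
  finally show ?thesis .
qed

text \<open>Both sides are proportional to the area of \<open>A\<close>, the left by
  \<open>mass_rect\<close>, the right by Fubini, and \<open>integral_leaf_mean\<close> matches the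
  constants. A degenerate box is empty.\<close>

lemma mass_eq_leaf_mean:
  assumes A: "A \<in> inner_boxes unit_disk" and E: "compact E" "E \<subseteq> \<tau>"
  shows "mass A E = (\<integral>x. leaf_mean (snd x) * of_real (indicator A (fst x) * indicator E (snd x)) \<partial>leaf_measure)"
    and "integrable leaf_measure (\<lambda>x. leaf_mean (snd x) * of_real (indicator A (fst x) * indicator E (snd x)))"
proof -
  obtain p q where pq: "A = box p q" "cbox p q \<subseteq> unit_disk" using A by (auto simp: inner_boxes_def)
  define a b c d where "a = Re p" and "b = Re q" and "c = Im p" and "d = Im q"
  have A': "A = rect a b c d" by (simp add: pq(1) a_def b_def c_def d_def)
  have sub: "cbox (Complex a c) (Complex b d) \<subseteq> unit_disk" using pq(2) by (simp add: a_def b_def c_def d_def)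
  have AD: "A \<subseteq> unit_disk" using pq box_subset_cbox by blast
  have As: "A \<in> sets (restrict_space lborel unit_disk)"
    using AD pq(1) by (auto simp: sets_restrict_space_iff)
  have Es: "E \<in> sets \<mu>"
    using E compact_\<tau> by (auto simp: sets_\<mu> sets_restrict_space_iff compact_imp_closed)
  have "integrable leaf_measure (\<lambda>x. indicator (A \<times> E) x *\<^sub>R leaf_mean (snd x))"
    by (rule integrable_mult_indicator[OF _ integrable_leaf_mean_snd]) (use As Es in \<open>simp add: leaf_measure_def\<close>)
  moreover have "indicator (A \<times> E) x *\<^sub>R leaf_mean (snd x) = leaf_mean (snd x) * of_real (indicator A (fst x) * indicator E (snd x))" for x
    by (auto simp: indicator_def mem_Times_iff)
  ultimately show int: "integrable leaf_measure (\<lambda>x. leaf_mean (snd x) * of_real (indicator A (fst x) * indicator E (snd x)))"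
    by simp
  show "mass A E = (\<integral>x. leaf_mean (snd x) * of_real (indicator A (fst x) * indicator E (snd x)) \<partial>leaf_measure)"
  proof (cases "a < b \<and> c < d")
    case True
    have "(\<integral>x. leaf_mean (snd x) * of_real (indicator A (fst x) * indicator E (snd x)) \<partial>leaf_measure)
        = (\<integral>\<alpha>. \<integral>z. leaf_mean \<alpha> * of_real (indicator A z * indicator E \<alpha>) \<partial>restrict_space lborel unit_disk \<partial>\<mu>)"
      using integral_snd[of "\<lambda>z \<alpha>. leaf_mean \<alpha> * of_real (indicator A z * indicator E \<alpha>)"] int
      by (simp add: leaf_measure_def case_prod_beta')
    also have "\<dots> = (\<integral>\<alpha>. of_real ((b - a) * (d - c)) * (indicator E \<alpha> *\<^sub>R leaf_mean \<alpha>) \<partial>\<mu>)"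
    proof (rule Bochner_Integration.integral_cong[OF refl])
      fix \<alpha>
      have "(\<integral>z. leaf_mean \<alpha> * of_real (indicator A z * indicator E \<alpha>) \<partial>restrict_space lborel unit_disk)
          = (\<integral>z. (leaf_mean \<alpha> * of_real (indicator E \<alpha>)) * of_real (indicator A z) \<partial>restrict_space lborel unit_disk)"
        by (rule Bochner_Integration.integral_cong) (auto simp: indicator_def)
      also have "\<dots> = leaf_mean \<alpha> * of_real (indicator E \<alpha>) * of_real (\<integral>z. indicator A z \<partial>restrict_space lborel unit_disk)"
        by (simp del: of_real_mult)
      also have "(\<integral>z. indicator A z \<partial>restrict_space lborel unit_disk) = (b - a) * (d - c)"
        unfolding A' by (rule measure_rect) (use True AD A' in auto)
      finally show "(\<integral>z. leaf_mean \<alpha> * of_real (indicator A z * indicator E \<alpha>) \<partial>restrict_space lborel unit_disk)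
          = of_real ((b - a) * (d - c)) * (indicator E \<alpha> *\<^sub>R leaf_mean \<alpha>)"
        by (simp add: scaleR_conv_of_real mult_ac)
    qed
    also have "\<dots> = of_real ((b - a) * (d - c)) * (\<integral>\<alpha>. indicator E \<alpha> *\<^sub>R leaf_mean \<alpha> \<partial>\<mu>)"
      by (rule integral_mult_right_zero)
    also have "\<dots> = of_real ((b - a) * (d - c)) * (4 * mass central_square E)"
      by (simp only: integral_leaf_mean[OF E])
    also have "\<dots> = mass A E"
      unfolding A' by (subst mass_rect[OF E sub]) (use True in auto)
    finally show ?thesis by simp
  next
    case False
    then have "A = {}" unfolding A' using mem_rect by fastforce
    then show ?thesis by (simp add: mass_def)
  qed
qed

text \<open>Products of boxes and compact sets form an intersection-stable generator, on which
  \<open>F\<close> and \<open>leaf_mean\<close> have equal integrals. As \<open>F\<close> is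
  integrable only locally in \<open>z\<close>, the comparison is made over one inner box
  \<open>B\<close> at a time, and countably many of them cover the disk.\<close>

lemma AE_eq_leaf_mean: "AE x in leaf_measure. F x = leaf_mean (snd x)"
proof -
  let ?D = "restrict_space lborel unit_disk"
  \<comment> \<open>The whole disk is added since generators of a product must contain the full
    spaces. It does no harm to integrability, as every \<open>A\<close> is intersected with
    \<open>B\<close> below.\<close>
  let ?GA = "insert unit_disk (inner_boxes unit_disk)" and ?GB = "{E. compact E \<and> E \<subseteq> \<tau>}"
  define G where "G = {A \<times> E |A E. A \<in> ?GA \<and> E \<in> ?GB}"
  have sub: "inner_boxes unit_disk \<subseteq> Pow unit_disk" using box_subset_cbox by (fastforce simp: inner_boxes_def)
  have "sigma_sets unit_disk (inner_boxes unit_disk) = sigma_sets unit_disk ?GA"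
    by (rule sigma_sets_eqI) (auto intro: sigma_sets.Basic sigma_sets_top)
  then have GA: "sets ?D = sigma_sets unit_disk ?GA"
    using sets_restrict_borel_inner_boxes[of unit_disk] by (simp add: sets_restrict_space)
  have GB: "sets \<mu> = sigma_sets \<tau> ?GB"
    unfolding sets_\<mu> by (rule sets_restrict_borel_compacts[OF compact_\<tau>])
  have spD: "space ?D = unit_disk" by (simp add: space_restrict_space)
  have setsG: "sets leaf_measure = sigma_sets (space leaf_measure) G"
    unfolding leaf_measure_def G_def space_pair_measure
    by (rule sets_pair_measure_generator) (use GA GB sub compact_\<tau> in \<open>auto simp: spD space_\<mu>\<close>)
  have GP: "G \<subseteq> Pow (space leaf_measure)"
    unfolding G_def space_leaf_measure using sub by blast
  have IntGA: "A \<inter> B \<in> inner_boxes unit_disk" if "A \<in> ?GA" "B \<in> inner_boxes unit_disk" for A B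
    using that Int_stableD[OF Int_stable_inner_boxes, of A unit_disk B] sub by (auto simp: Int_absorb1)
  have stable: "Int_stable G"
  proof (rule Int_stableI)
    fix X Y assume "X \<in> G" "Y \<in> G"
    then obtain A E A' E' where *: "X = A \<times> E" "Y = A' \<times> E'" "A \<in> ?GA" "A' \<in> ?GA" "E \<in> ?GB" "E' \<in> ?GB"
      unfolding G_def by blast
    have "A \<inter> A' \<in> ?GA"
      using IntGA[OF *(3), of A'] IntGA[OF *(4), of A] *(3,4) by (auto simp: Int_commute)
    moreover have "E \<inter> E' \<in> ?GB" using *(5,6) by (auto intro: compact_Int)
    moreover have "X \<inter> Y = (A \<inter> A') \<times> (E \<inter> E')" using *(1,2) by auto
    ultimately show "X \<inter> Y \<in> G" unfolding G_def by blast
  qed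
  have loc: "AE x in leaf_measure. fst x \<in> B \<longrightarrow> F x = leaf_mean (snd x)" if B: "B \<in> inner_boxes unit_disk" for B
  proof -
    define Y where "Y = (\<lambda>x. (F x - leaf_mean (snd x)) * of_real (indicator B (fst x)))"
    have zero: "(\<integral>x. indicator (A \<times> E) x *\<^sub>R Y x \<partial>leaf_measure) = 0 \<and> integrable leaf_measure (\<lambda>x. indicator (A \<times> E) x *\<^sub>R Y x)"
      if "A \<in> ?GA" "E \<in> ?GB" for A E
    proof -
      have AB: "A \<inter> B \<in> inner_boxes unit_disk" by (rule IntGA[OF that(1) B])
      then obtain p q where pq: "A \<inter> B = box p q" "cbox p q \<subseteq> unit_disk" by (auto simp: inner_boxes_def)
      have E: "compact E" "E \<subseteq> \<tau>" using that(2) by auto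
      have eq: "indicator (A \<times> E) x *\<^sub>R Y x = F x * of_real (indicator (A \<inter> B) (fst x) * indicator E (snd x))
          - leaf_mean (snd x) * of_real (indicator (A \<inter> B) (fst x) * indicator E (snd x))" for x
        by (auto simp: Y_def indicator_def mem_Times_iff)
      have i1: "integrable leaf_measure (\<lambda>x. F x * of_real (indicator (A \<inter> B) (fst x) * indicator E (snd x)))"
        unfolding pq(1) by (rule mass_box(2)[OF pq(2) E])
      note i2 = mass_eq_leaf_mean(2)[OF AB E]
      have "(\<integral>x. indicator (A \<times> E) x *\<^sub>R Y x \<partial>leaf_measure) = mass (A \<inter> B) E - mass (A \<inter> B) E"
        unfolding eq Bochner_Integration.integral_diff[OF i1 i2]
        by (simp only: mass_eq_leaf_mean(1)[OF AB E, symmetric] mass_def[symmetric])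
      then show ?thesis unfolding eq using Bochner_Integration.integrable_diff[OF i1 i2] by simp
    qed
    have full: "indicator (unit_disk \<times> \<tau>) x *\<^sub>R Y x = Y x" if "x \<in> space leaf_measure" for x
      using that by (simp add: space_leaf_measure)
    have z: "(\<integral>x. indicator (unit_disk \<times> \<tau>) x *\<^sub>R Y x \<partial>leaf_measure) = 0" "integrable leaf_measure (\<lambda>x. indicator (unit_disk \<times> \<tau>) x *\<^sub>R Y x)"
      using zero[of unit_disk \<tau>] compact_\<tau> by auto
    have "AE x in leaf_measure. Y x = 0"
    proof (rule AE_zero_if_integral_zero_on_generator[OF _ _ stable GP setsG])
      show "sigma_finite_measure leaf_measure" by unfold_locales
      show "integrable leaf_measure Y"
        using z(2) by (subst (asm) Bochner_Integration.integrable_cong[OF refl full]) auto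
      show "integral\<^sup>L leaf_measure Y = 0"
        using z(1) by (subst (asm) Bochner_Integration.integral_cong[OF refl full]) auto
      show "set_lebesgue_integral leaf_measure X Y = 0" if "X \<in> G" for X
        using that zero unfolding G_def set_lebesgue_integral_def by blast
    qed
    then show ?thesis by (rule AE_mp) (auto simp: Y_def intro!: AE_I2)
  qed
  obtain C where C: "countable C" "C \<subseteq> inner_boxes unit_disk" "\<Union>C = unit_disk"
    by (rule inner_boxes_countable_cover[OF open_ball])
  have "AE x in leaf_measure. \<forall>B\<in>C. fst x \<in> B \<longrightarrow> F x = leaf_mean (snd x)"
    using loc C by (subst AE_ball_countable) auto
  then show ?thesis
  proof (rule AE_mp)
    show "AE x in leaf_measure. (\<forall>B\<in>C. fst x \<in> B \<longrightarrow> F x = leaf_mean (snd x)) \<longrightarrow> F x = leaf_mean (snd x)"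
    proof (intro AE_I2 impI)
      fix x assume x: "x \<in> space leaf_measure" "\<forall>B\<in>C. fst x \<in> B \<longrightarrow> F x = leaf_mean (snd x)"
      then have "fst x \<in> \<Union>C" unfolding C(3) space_leaf_measure by auto
      then show "F x = leaf_mean (snd x)" using x(2) by blast
    qed
  qed
qed

text \<open>Over the leaves of a compact \<open>E\<close> the mean has a nonnegative real integral,
  as a limit of positive tests with bumps of the central square. The real criterion is then applied
  to the real part and to both signs of the imaginary part.\<close>

lemma AE_leaf_mean_nonneg: "AE \<alpha> in \<mu>. leaf_mean \<alpha> = of_real (Re (leaf_mean \<alpha>)) \<and> 0 \<le> Re (leaf_mean \<alpha>)"
proof -
  have pos: "(\<integral>\<alpha>. indicator E \<alpha> *\<^sub>R leaf_mean \<alpha> \<partial>\<mu>) \<in> \<real>\<^sub>\<ge>\<^sub>0" if E: "compact E" "E \<subseteq> \<tau>" for E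
  proof -
    obtain r where r: "r < 1" "cbox (Complex (-1/4) (-1/4)) (Complex (1/4) (1/4)) \<subseteq> cball 0 r"
      by (rule compact_subset_diskE[OF compact_cbox central_square_subset])
    have z: "box_bump (Complex (-1/4) (-1/4)) (Complex (1/4) (1/4)) n z = 0" if "r < norm z" for n z
      using that r(2) box_subset_cbox[of "Complex (-1/4) (-1/4)" "Complex (1/4) (1/4)"] by (intro box_bump_zero) auto
    have "mass central_square E \<in> \<real>\<^sub>\<ge>\<^sub>0"
    proof (rule Lim_in_closed_set[OF closed_nonneg_Reals_complex _ _ mass_box(1)[OF central_square_subset E]])
      show "\<forall>\<^sub>F n in sequentially. (\<integral>x. F x * of_real (box_bump (Complex (-1/4) (-1/4)) (Complex (1/4) (1/4)) n (fst x) * indicator E (snd x)) \<partial>leaf_measure) \<in> \<real>\<^sub>\<ge>\<^sub>0"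
        by (intro always_eventually allI leafwise_positive[OF smooth_on_box_bump z r(1) box_bump_nonneg E])
    qed simp
    then show ?thesis unfolding integral_leaf_mean[OF E] by (intro nonneg_Reals_mult_I) auto
  qed
  have ind: "integrable \<mu> (\<lambda>\<alpha>. indicator E \<alpha> *\<^sub>R leaf_mean \<alpha>)" if E: "compact E" "E \<subseteq> \<tau>" for E
    by (rule integrable_mult_indicator[OF _ integrable_leaf_mean])
       (use E compact_\<tau> in \<open>auto simp: sets_\<mu> sets_restrict_space_iff compact_imp_closed\<close>)
  have Re: "(\<integral>\<alpha>. indicator E \<alpha> *\<^sub>R Re (leaf_mean \<alpha>) \<partial>\<mu>) = Re (\<integral>\<alpha>. indicator E \<alpha> *\<^sub>R leaf_mean \<alpha> \<partial>\<mu>)"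
    and Im: "(\<integral>\<alpha>. indicator E \<alpha> *\<^sub>R Im (leaf_mean \<alpha>) \<partial>\<mu>) = Im (\<integral>\<alpha>. indicator E \<alpha> *\<^sub>R leaf_mean \<alpha> \<partial>\<mu>)"
    if E: "compact E" "E \<subseteq> \<tau>" for E
    using integral_Re[OF ind[OF E]] integral_Im[OF ind[OF E]] by simp_all
  note AE = AE_nonneg_if_integral_nonneg_on_compacts[OF compact_\<tau> \<mu>.finite_measure_axioms sets_\<mu>]
  have "AE \<alpha> in \<mu>. 0 \<le> Re (leaf_mean \<alpha>)"
  proof (rule AE)
    show "integrable \<mu> (\<lambda>\<alpha>. Re (leaf_mean \<alpha>))" using integrable_leaf_mean by simp
    show "0 \<le> (\<integral>\<alpha>. indicator E \<alpha> *\<^sub>R Re (leaf_mean \<alpha>) \<partial>\<mu>)" if "compact E" "E \<subseteq> \<tau>" for E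
      unfolding Re[OF that] using pos[OF that] by (simp add: complex_nonneg_Reals_iff)
  qed
  moreover have "AE \<alpha> in \<mu>. 0 \<le> Im (leaf_mean \<alpha>)"
  proof (rule AE)
    show "integrable \<mu> (\<lambda>\<alpha>. Im (leaf_mean \<alpha>))" using integrable_leaf_mean by simp
    show "0 \<le> (\<integral>\<alpha>. indicator E \<alpha> *\<^sub>R Im (leaf_mean \<alpha>) \<partial>\<mu>)" if "compact E" "E \<subseteq> \<tau>" for E
      unfolding Im[OF that] using pos[OF that] by (simp add: complex_nonneg_Reals_iff)
  qed
  moreover have "AE \<alpha> in \<mu>. 0 \<le> - Im (leaf_mean \<alpha>)"
  proof (rule AE)
    show "integrable \<mu> (\<lambda>\<alpha>. - Im (leaf_mean \<alpha>))" using integrable_leaf_mean by simp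
    show "0 \<le> (\<integral>\<alpha>. indicator E \<alpha> *\<^sub>R (- Im (leaf_mean \<alpha>)) \<partial>\<mu>)" if "compact E" "E \<subseteq> \<tau>" for E
      using Im[OF that] pos[OF that] by (simp add: complex_nonneg_Reals_iff)
  qed
  ultimately show ?thesis by eventually_elim (simp add: complex_eq_iff)
qed

text \<open>\<open>F\<close> is almost everywhere the function \<open>leaf_mean\<close> of the leaf,
  so Fubini moves it out of the inner integral and onto \<mu>. A density of a measure must be
  nonnegative, hence the real part, which agrees with \<open>leaf_mean\<close> almost
  everywhere.\<close>

lemma uniformly_laminar_density:
  "\<exists>\<mu>'. finite_measure_on \<tau> \<mu>' \<and>
    (\<forall>\<psi>. test_form2 \<psi> \<longrightarrow> (\<integral>x. F x * pullback \<psi> x \<partial>leaf_measure) = laminar_current \<phi> \<mu>' \<psi>)"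
proof -
  let ?c = "\<lambda>\<alpha>. Re (leaf_mean \<alpha>)"
  define \<mu>' where "\<mu>' = density \<mu> (\<lambda>\<alpha>. ennreal (?c \<alpha>))"
  have intc: "integrable \<mu> ?c" using integrable_leaf_mean by simp
  have cm: "?c \<in> borel_measurable \<mu>" using intc by (rule borel_measurable_integrable)
  have nn: "AE \<alpha> in \<mu>. 0 \<le> ?c \<alpha>" using AE_leaf_mean_nonneg by eventually_elim simp
  have "finite_measure \<mu>'"
  proof (rule finite_measureI)
    have "emeasure \<mu>' (space \<mu>') = (\<integral>\<^sup>+\<alpha>. ennreal (?c \<alpha>) * indicator (space \<mu>) \<alpha> \<partial>\<mu>)"
      unfolding \<mu>'_def using cm by (simp add: emeasure_density)
    also have "\<dots> = (\<integral>\<^sup>+\<alpha>. ennreal (?c \<alpha>) \<partial>\<mu>)" by (rule nn_integral_cong) auto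
    also have "\<dots> = ennreal (\<integral>\<alpha>. ?c \<alpha> \<partial>\<mu>)" by (rule nn_integral_eq_integral[OF intc nn])
    finally show "emeasure \<mu>' (space \<mu>') \<noteq> \<infinity>" by simp
  qed
  then have "finite_measure_on \<tau> \<mu>'" by (simp add: finite_measure_on_def \<mu>'_def sets_\<mu>)
  moreover have "(\<integral>x. F x * pullback \<psi> x \<partial>leaf_measure) = laminar_current \<phi> \<mu>' \<psi>" if \<psi>: "test_form2 \<psi>" for \<psi>
  proof -
    have pm: "pullback \<psi> \<in> borel_measurable leaf_measure"
      by (rule borel_measurable_leaf_measure_continuous[OF pullback_test_form(1)[OF \<psi>]])
    obtain r where r: "r < 1" "\<And>x. x \<in> unit_disk \<times> \<tau> \<Longrightarrow> r < norm (fst x) \<Longrightarrow> pullback \<psi> x = 0"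
      using pullback_test_form(2)[OF \<psi>] by blast
    have iF: "integrable leaf_measure (\<lambda>x. F x * pullback \<psi> x)"
      by (rule integrable_leaf_cutoff[OF F_measurable F_integrable[OF r(1)] r(1) pullback_test_form(1)[OF \<psi>] r(2)])
    have cs: "(\<lambda>x. leaf_mean (snd x) * pullback \<psi> x) \<in> borel_measurable leaf_measure"
      by (intro borel_measurable_times borel_measurable_integrable[OF integrable_leaf_mean_snd] pm)
    have ae: "AE x in leaf_measure. F x * pullback \<psi> x = leaf_mean (snd x) * pullback \<psi> x"
      using AE_eq_leaf_mean by eventually_elim simp
    have ic: "integrable leaf_measure (\<lambda>x. leaf_mean (snd x) * pullback \<psi> x)"
      using integrable_cong_AE[OF borel_measurable_integrable[OF iF] cs ae] iF by simp
    let ?I = "\<lambda>\<alpha>. \<integral>z. pullback \<psi> (z, \<alpha>) \<partial>restrict_space lborel unit_disk"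
    have Im: "?I \<in> borel_measurable \<mu>"
      using integrable_snd[of "\<lambda>z \<alpha>. pullback \<psi> (z, \<alpha>)"] integrable_pullback[OF \<psi>]
      by (auto simp: leaf_measure_def intro: borel_measurable_integrable)
    have lm: "leaf_mean \<in> borel_measurable \<mu>" by (rule borel_measurable_integrable[OF integrable_leaf_mean])
    have "(\<integral>x. F x * pullback \<psi> x \<partial>leaf_measure) = (\<integral>x. leaf_mean (snd x) * pullback \<psi> x \<partial>leaf_measure)"
      by (rule integral_cong_AE[OF borel_measurable_integrable[OF iF] cs ae])
    also have "\<dots> = (\<integral>\<alpha>. \<integral>z. leaf_mean \<alpha> * pullback \<psi> (z, \<alpha>) \<partial>restrict_space lborel unit_disk \<partial>\<mu>)"
      using integral_snd[of "\<lambda>z \<alpha>. leaf_mean \<alpha> * pullback \<psi> (z, \<alpha>)"] ic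
      by (simp add: leaf_measure_def case_prod_beta')
    also have "\<dots> = (\<integral>\<alpha>. leaf_mean \<alpha> * ?I \<alpha> \<partial>\<mu>)" by simp
    also have "\<dots> = (\<integral>\<alpha>. ?c \<alpha> *\<^sub>R ?I \<alpha> \<partial>\<mu>)"
    proof (rule integral_cong_AE)
      show "AE \<alpha> in \<mu>. leaf_mean \<alpha> * ?I \<alpha> = ?c \<alpha> *\<^sub>R ?I \<alpha>"
        using AE_leaf_mean_nonneg by eventually_elim (simp add: scaleR_conv_of_real)
      show "(\<lambda>\<alpha>. leaf_mean \<alpha> * ?I \<alpha>) \<in> borel_measurable \<mu>" by (intro borel_measurable_times lm Im)
      show "(\<lambda>\<alpha>. ?c \<alpha> *\<^sub>R ?I \<alpha>) \<in> borel_measurable \<mu>" by (intro borel_measurable_scaleR cm Im)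
    qed
    also have "\<dots> = (\<integral>\<alpha>. ?I \<alpha> \<partial>\<mu>')"
      unfolding \<mu>'_def by (rule integral_density[OF Im cm nn, symmetric])
    also have "\<dots> = laminar_current \<phi> \<mu>' \<psi>"
      by (simp add: laminar_current_def integration_current_eq)
    finally show ?thesis .
  qed
  ultimately show ?thesis by blast
qed

end

text \<open>Pointwise, \<open>y \<le> 1 + y powr (1 + \<epsilon>)\<close>, and
  \<open>jac \<ge> 1\<close> lets the power be integrated against the trace measure; the constant 1
  is integrable since \<open>leaf_measure\<close> is finite.\<close>

lemma (in laminar) set_integrable_density:
  assumes f: "Lp_loc (1 + \<epsilon>) area_measure f" and \<epsilon>: "\<epsilon> > 0" and r: "r < 1"
  shows "set_integrable leaf_measure (cball 0 r \<times> \<tau>) (\<lambda>x. f (leaf_map x))"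
proof -
  let ?C = "cball 0 r \<times> \<tau>"
  let ?K = "leaf_map ` ?C"
  have sub: "?C \<subseteq> unit_disk \<times> \<tau>" using r by auto
  have K: "compact ?K" "?K \<subseteq> bidisk"
    by (intro compact_continuous_image continuous_on_subset[OF continuous_on_leaf_map sub] compact_Times compact_cball compact_\<tau>)
       (use leaf_map_in_bidisk sub in blast)
  have fm: "f \<in> borel_measurable area_measure" using f by (simp add: Lp_loc_def)
  then have fm': "f \<in> borel_measurable (restrict_space borel bidisk)"
    by (simp add: measurable_cong_sets[OF sets_area_measure refl])
  have flm: "(\<lambda>x. f (leaf_map x)) \<in> borel_measurable leaf_measure"
    by (rule measurable_compose[OF measurable_leaf_map fm'])
  have intR: "integrable area_measure (\<lambda>p. indicator ?K p *\<^sub>R (norm (f p) powr (1 + \<epsilon>)))"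
    using f K by (simp add: Lp_loc_def set_integrable_def)
  then have intC: "integrable area_measure (\<lambda>p. complex_of_real (indicator ?K p *\<^sub>R (norm (f p) powr (1 + \<epsilon>))))"
    by (rule integrable_of_real)
  have int: "integrable leaf_measure (\<lambda>x. of_real (jac x) * complex_of_real (indicator ?K (leaf_map x) *\<^sub>R (norm (f (leaf_map x)) powr (1 + \<epsilon>))))"
    using intC integrable_area_measure_iff[OF borel_measurable_integrable[OF intC]] by blast
  have one: "integrable leaf_measure (\<lambda>x. norm (indicator ?C x *\<^sub>R (1::complex)))"
    using set_integrable_one[OF r] by (intro integrable_norm) (simp add: set_integrable_def)
  show ?thesis unfolding set_integrable_def
  proof (rule Bochner_Integration.integrable_bound[OF Bochner_Integration.integrable_add[OF one integrable_norm[OF int]]])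
    show "(\<lambda>x. indicator ?C x *\<^sub>R f (leaf_map x)) \<in> borel_measurable leaf_measure"
      using sets_cylinder[OF r] flm by (intro borel_measurable_scaleR borel_measurable_indicator)
    show "AE x in leaf_measure. norm (indicator ?C x *\<^sub>R f (leaf_map x))
      \<le> norm (norm (indicator ?C x *\<^sub>R (1::complex)) + norm (of_real (jac x) * complex_of_real (indicator ?K (leaf_map x) *\<^sub>R (norm (f (leaf_map x)) powr (1 + \<epsilon>)))))"
    proof (rule AE_I2)
      fix x
      show "norm (indicator ?C x *\<^sub>R f (leaf_map x))
        \<le> norm (norm (indicator ?C x *\<^sub>R (1::complex)) + norm (of_real (jac x) * complex_of_real (indicator ?K (leaf_map x) *\<^sub>R (norm (f (leaf_map x)) powr (1 + \<epsilon>)))))"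
      proof (cases "x \<in> ?C")
        case True
        define y where "y = norm (f (leaf_map x))"
        have y: "0 \<le> y" by (simp add: y_def)
        have "y \<le> 1 + y powr (1 + \<epsilon>)"
        proof (cases "y \<le> 1")
          case True
          then show ?thesis using powr_ge_zero[of y "1 + \<epsilon>"] by linarith
        next
          case False
          then have "y powr 1 \<le> y powr (1 + \<epsilon>)" using \<epsilon> by (intro powr_mono) auto
          then show ?thesis using False by simp
        qed
        also have "\<dots> \<le> 1 + jac x * y powr (1 + \<epsilon>)"
          using mult_right_mono[OF jac_ge_1[of x] powr_ge_zero[of y "1 + \<epsilon>"]] by simp
        finally have "y \<le> 1 + jac x * y powr (1 + \<epsilon>)" .
        moreover have "leaf_map x \<in> ?K" using True by blast
        ultimately show ?thesis
          using True jac_nonneg[of x] by (simp add: y_def[symmetric] norm_mult abs_of_nonneg add_nonneg_nonneg)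
      qed simp
    qed
  qed
qed

theorem mainTheorem3:
  fixes \<tau> :: "complex set"
    and \<phi> :: "complex \<Rightarrow> complex \<Rightarrow> complex"
    and \<mu> :: "complex measure"
    and T :: current2
    and \<epsilon> :: real
    and f :: "C2 \<Rightarrow> complex"
  assumes "lamination \<tau> \<phi>"
    and "finite_measure_on \<tau> \<mu>"
    and "T = laminar_current \<phi> \<mu>"
    and "\<epsilon> > 0"
    and "Lp_loc (1 + \<epsilon>) (trace_measure T) f"
    and "positive_current (mult_current f T)"
    and "closed_current (mult_current f T)"
  shows "uniformly_laminar (mult_current f T)"
proof -
  interpret laminar \<tau> \<phi> \<mu>
    by unfold_locales (use assms(1,2) in auto)
  have f: "Lp_loc (1 + \<epsilon>) area_measure f" and fm: "f \<in> borel_measurable (trace_measure (laminar_current \<phi> \<mu>))"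
    using assms(3,5) by (simp_all add: trace_measure_eq Lp_loc_def)
  have eq: "mult_current f T \<psi> = (\<integral>x. f (leaf_map x) * pullback \<psi> x \<partial>leaf_measure)" if "test_form2 \<psi>" for \<psi>
    unfolding assms(3) by (rule mult_current_eq[OF fm that])
  interpret closed_laminar \<tau> \<phi> \<mu> "\<lambda>x. f (leaf_map x)"
  proof
    have "f \<in> borel_measurable (restrict_space borel bidisk)"
      using fm by (simp add: trace_measure_eq measurable_cong_sets[OF sets_area_measure refl])
    then show "(\<lambda>x. f (leaf_map x)) \<in> borel_measurable leaf_measure"
      by (rule measurable_compose[OF measurable_leaf_map])
    show "set_integrable leaf_measure (cball 0 r \<times> \<tau>) (\<lambda>x. f (leaf_map x))" if "r < 1" for r
      by (rule set_integrable_density[OF f assms(4) that])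
    show "(\<integral>x. f (leaf_map x) * pullback (ext_deriv \<theta>) x \<partial>leaf_measure) = 0" if "test_form1 \<theta>" for \<theta>
      using assms(7) that eq[OF test_form2_ext_deriv[OF that]] by (simp add: closed_current_def)
    show "(\<integral>x. f (leaf_map x) * pullback \<psi> x \<partial>leaf_measure) \<in> \<real>\<^sub>\<ge>\<^sub>0" if "test_form2 \<psi>" "positive_form \<psi>" for \<psi>
      unfolding eq[OF that(1), symmetric] using assms(6) that unfolding positive_current_def by blast
  qed
  \<comment> \<open>The lamination is kept; only the transverse measure changes.\<close>
  show ?thesis
    using uniformly_laminar_density assms(1) eq unfolding uniformly_laminar_def by metis
qed


end
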